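(* Consider either the Allen--Cahn type equation $u_t=\Delta u-f(u)$ (that is, $G=-1$, $D=\Delta$) or the Cahn--Hilliard type equation $u_t=\Delta(-\Delta u+f(u))$ (that is, $G=\Delta$, $D=\Delta$) on $\Omega\times[0,T]$, and the stabilized $s$-stage IMEX Runge--Kutta scheme with coefficient matrices $A,\hat A$, stabilization constants $\alpha,\beta$ and time step $\tau$ described in the context, started from $u_0=u(0)$. Let $E=\mathbf{1}_{s\times s}$ be the $s\times s$ all-ones matrix, $E_L$ the $s\times s$ lower triangular matrix with $(E_L)_{ij}=1$ for $i\ge j$ and $0$ otherwise, $I$ the identity matrix, and $Q=\left(\hat A^{-1}A-I\right)E_L+I$. Assume that: (a) the scheme has $O(\tau^{p+1})$ truncation error (in the sense of the context); (b) the exact solution $u(t)$ is sufficiently smooth; (c) the matrices $H_0=\hat A^{-1}E_L$, $H_1=\beta Q-\frac L2I$, $H_2=\alpha Q+\hat A^{-1}AE_L-\frac12E$ and $Q$ are positive-definite, and $$\beta\ge\frac{L}{2\lambda_{\min}(Q)},\qquad\alpha\ge-\frac{\lambda_{\min}\left(\hat A^{-1}AE_L-\frac12E\right)}{\lambda_{\min}(Q)}.$$ Then, for all $n$ with $t_n=n\tau\le T$, $$\|u(t_n)-u_n\|_{H^1}\le Ce^{CT}\tau^p,$$ where $C$ is a positive constant depending on the Lipschitz constant, the stabilization constants and the smoothness of the exact solution, but independent of $\tau$.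
   Context: Matrices. A real square (not necessarily symmetric) matrix $M$ is called positive-definite if its symmetrization $\frac12(M+M^T)$ is; $\lambda_{\min}(M)$ denotes the smallest eigenvalue of $\frac12(M+M^T)$. Equation. $\Omega\subset\mathbb{R}^d$ ($d=1,2,3$) is a bounded domain, with periodic or homogeneous Neumann boundary conditions. The equation is $u_t=G(-Du+f(u))$; in the Cahn--Hilliard case the initial data have zero mean. $f=F'$ is Lipschitz continuous with constant $L>0$; in particular, for all real $a,b$, $$F(a)-F(b)\le(a-b)f(b)+\frac L2(a-b)^2$$ (for $f(u)=u^3-u$ this standing assumption is met after truncating $F$ to quadratic growth for large $|u|$). Stabilization. Put $D_s=-(1+\alpha)D+\beta I$ and $f_s(u)=-f(u)-\alpha Du+\beta u$; the equation is equivalent to $u_t=G(D_su-f_s(u))$. Set $\mathcal{L}v=GD_sv$ and $N(v)=-Gf_s(v)$. Scheme. $A=(a_{ij})$ and $\hat A=(\hat a_{ij})$ are real lower triangular $s\times s$ matrices, $\hat A$ is invertible, and $\sum_ja_{ij}=\sum_j\hat a_{ij}=c_i$ for all $i$. Given $u_n$ and $\tau>0$, the new value $u_{n+1}$ is defined by $$v_0=u_n,\qquad v_i=v_0+\tau\left(\sum_{j=1}^ia_{ij}\mathcal{L}v_j+\sum_{j=1}^i\hat a_{ij}N(v_{j-1})\right)\ (1\le i\le s),\qquad u_{n+1}=v_s.$$ The stage values are assumed to exist and to be regular enough for all the expressions to make sense. Truncation error. Let $t_n=n\tau$ and let $u$ be the exact solution. Define $\bar v_0=u(t_n)$ and let $\bar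 v_1,\dots,\bar v_s$ be the stages of the scheme started from $\bar v_0$, i.e. $\bar v_i=\bar v_0+\tau\left(\sum_{j=1}^ia_{ij}\mathcal{L}\bar v_j+\sum_{j=1}^i\hat a_{ij}N(\bar v_{j-1})\right)$. The local truncation error $r_{n+1}$ is defined by $$u(t_{n+1})=u(t_n)+\tau\left(\sum_{j=1}^sb_j\mathcal{L}\bar v_j+\sum_{j=1}^s\hat b_jN(\bar v_{j-1})\right)+r_{n+1},\qquad b_j=a_{sj},\ \hat b_j=\hat a_{sj}.$$ The scheme has $O(\tau^{p+1})$ truncation error if $\|r_{n+1}\|_{H^1}\le C\tau^{p+1}$ for all $n$ with $t_{n+1}\le T$, with $C$ independent of $\tau$ and $n$. *)

theory Defs
  imports
    "HOL-Analysis.Analysis"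
    "Jordan_Normal_Form.Char_Poly"
    "Jordan_Normal_Form.Gauss_Jordan_Elimination"
begin

text \<open>
  In the periodic case the argument \<open>l\<close> is the vector of periods: \<open>\<Omega>\<close> is an open box with
  side lengths \<open>l \<bullet> e\<close>, \<open>e \<in> Basis\<close>.
\<close>

datatype 'a boundary = Neumann | Periodic 'a

fun admissible_domain :: "'a::euclidean_space set \<Rightarrow> 'a boundary \<Rightarrow> bool" where
  "admissible_domain \<Omega> Neumann \<longleftrightarrow> open \<Omega> \<and> connected \<Omega> \<and> bounded \<Omega> \<and> \<Omega> \<noteq> {}"
| "admissible_domain \<Omega> (Periodic l) \<longleftrightarrow> (\<forall>e\<in>Basis. 0 < inner l e) \<and> (\<exists>q. \<Omega> = box q (q + l))"

primrec Ck_on :: "nat \<Rightarrow> 'b::euclidean_space set \<Rightarrow> ('b \<Rightarrow> real) \<Rightarrow> bool" where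
  "Ck_on 0 S g \<longleftrightarrow> continuous_on S g"
| "Ck_on (Suc k) S g \<longleftrightarrow>
     (\<exists>g'. (\<forall>x\<in>S. (g has_derivative g' x) (at x within S)) \<and>
           (\<forall>e\<in>Basis. Ck_on k S (\<lambda>x. g' x e)))"

text \<open>\<open>C\<^sup>k\<close> with all partial derivatives of order at most \<open>k\<close> bounded by \<open>B\<close>.\<close>

primrec Ck_bounded_on :: "nat \<Rightarrow> real \<Rightarrow> 'b::euclidean_space set \<Rightarrow> ('b \<Rightarrow> real) \<Rightarrow> bool" where
  "Ck_bounded_on 0 B S g \<longleftrightarrow> continuous_on S g \<and> (\<forall>x\<in>S. \<bar>g x\<bar> \<le> B)"
| "Ck_bounded_on (Suc k) B S g \<longleftrightarrow>
     (\<forall>x\<in>S. \<bar>g x\<bar> \<le> B) \<and>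
     (\<exists>g'. (\<forall>x\<in>S. (g has_derivative g' x) (at x within S)) \<and>
           (\<forall>e\<in>Basis. Ck_bounded_on k B S (\<lambda>x. g' x e)))"

text \<open>
  Test functions for weak derivatives: \<open>C\<^sub>c\<^sup>\<infinity>(\<Omega>)\<close>, respectively the smooth functions on the torus.
\<close>

fun test_function :: "'a::euclidean_space set \<Rightarrow> 'a boundary \<Rightarrow> ('a \<Rightarrow> real) \<Rightarrow> bool" where
  "test_function \<Omega> Neumann \<phi> \<longleftrightarrow> (\<forall>k. Ck_on k UNIV \<phi>) \<and>
     compact (closure {x. \<phi> x \<noteq> 0}) \<and> closure {x. \<phi> x \<noteq> 0} \<subseteq> \<Omega>"
| "test_function \<Omega> (Periodic l) \<phi> \<longleftrightarrow> (\<forall>k. Ck_on k UNIV \<phi>) \<and>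
     (\<forall>x. \<forall>e\<in>Basis. \<phi> (x + inner l e *\<^sub>R e) = \<phi> x)"

definition L2_fun :: "'a::euclidean_space set \<Rightarrow> ('a \<Rightarrow> 'b::euclidean_space) \<Rightarrow> bool" where
  "L2_fun \<Omega> v \<longleftrightarrow> v \<in> borel_measurable (lebesgue_on \<Omega>) \<and>
     integrable (lebesgue_on \<Omega>) (\<lambda>x. (norm (v x))\<^sup>2)"

definition is_weak_grad ::
  "'a::euclidean_space set \<Rightarrow> 'a boundary \<Rightarrow> ('a \<Rightarrow> real) \<Rightarrow> ('a \<Rightarrow> 'a) \<Rightarrow> bool" where
  "is_weak_grad \<Omega> bc v g \<longleftrightarrow> L2_fun \<Omega> v \<and> L2_fun \<Omega> g \<and>
     (\<forall>\<phi>. test_function \<Omega> bc \<phi> \<longrightarrow> (\<forall>e\<in>Basis.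
        integral\<^sup>L (lebesgue_on \<Omega>) (\<lambda>x. v x * frechet_derivative \<phi> (at x) e)
        = - integral\<^sup>L (lebesgue_on \<Omega>) (\<lambda>x. inner (g x) e * \<phi> x)))"

text \<open>
  \<open>H\<^sup>1(\<Omega>)\<close> in the Neumann case, the space of periodic \<open>H\<^sup>1\<close> functions in the periodic case.
\<close>

definition H1_fun :: "'a::euclidean_space set \<Rightarrow> 'a boundary \<Rightarrow> ('a \<Rightarrow> real) \<Rightarrow> bool" where
  "H1_fun \<Omega> bc v \<longleftrightarrow> (\<exists>g. is_weak_grad \<Omega> bc v g)"

definition weak_grad ::
  "'a::euclidean_space set \<Rightarrow> 'a boundary \<Rightarrow> ('a \<Rightarrow> real) \<Rightarrow> 'a \<Rightarrow> 'a" where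
  "weak_grad \<Omega> bc v = (SOME g. is_weak_grad \<Omega> bc v g)"

definition H1_norm :: "'a::euclidean_space set \<Rightarrow> 'a boundary \<Rightarrow> ('a \<Rightarrow> real) \<Rightarrow> real" where
  "H1_norm \<Omega> bc v = sqrt (integral\<^sup>L (lebesgue_on \<Omega>) (\<lambda>x. (v x)\<^sup>2) +
     integral\<^sup>L (lebesgue_on \<Omega>) (\<lambda>x. (norm (weak_grad \<Omega> bc v x))\<^sup>2))"

text \<open>
  The \<open>L\<^sup>2\<close> realization of the Laplacian with the given boundary condition. Testing against all of
  \<open>H\<^sup>1\<close> encodes both \<open>w = \<Delta>v\<close> and the boundary condition (\<open>\<partial>v/\<partial>\<nu> = 0\<close> in the Neumann case,
  periodicity of the derivatives in the periodic case). It determines \<open>w\<close> up to null sets.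
\<close>

definition is_laplacian ::
  "'a::euclidean_space set \<Rightarrow> 'a boundary \<Rightarrow> ('a \<Rightarrow> real) \<Rightarrow> ('a \<Rightarrow> real) \<Rightarrow> bool" where
  "is_laplacian \<Omega> bc v w \<longleftrightarrow> H1_fun \<Omega> bc v \<and> L2_fun \<Omega> w \<and>
     (\<forall>\<phi>. H1_fun \<Omega> bc \<phi> \<longrightarrow>
        integral\<^sup>L (lebesgue_on \<Omega>) (\<lambda>x. inner (weak_grad \<Omega> bc v x) (weak_grad \<Omega> bc \<phi> x))
        = - integral\<^sup>L (lebesgue_on \<Omega>) (\<lambda>x. w x * \<phi> x))"

definition lap_dom :: "'a::euclidean_space set \<Rightarrow> 'a boundary \<Rightarrow> ('a \<Rightarrow> real) \<Rightarrow> bool" where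
  "lap_dom \<Omega> bc v \<longleftrightarrow> (\<exists>w. is_laplacian \<Omega> bc v w)"

definition lap :: "'a::euclidean_space set \<Rightarrow> 'a boundary \<Rightarrow> ('a \<Rightarrow> real) \<Rightarrow> 'a \<Rightarrow> real" where
  "lap \<Omega> bc v = (SOME w. is_laplacian \<Omega> bc v w)"

text \<open>\<open>u\<^sub>t = G (- D u + f(u))\<close> with \<open>D = \<Delta>\<close> and \<open>G = -1\<close> or \<open>G = \<Delta>\<close>.\<close>

datatype equation = AllenCahn | CahnHilliard

fun G_op ::
  "equation \<Rightarrow> 'a::euclidean_space set \<Rightarrow> 'a boundary \<Rightarrow> ('a \<Rightarrow> real) \<Rightarrow> 'a \<Rightarrow> real" where
  "G_op AllenCahn \<Omega> bc v = (\<lambda>x. - v x)"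
| "G_op CahnHilliard \<Omega> bc v = lap \<Omega> bc v"

fun G_dom ::
  "equation \<Rightarrow> 'a::euclidean_space set \<Rightarrow> 'a boundary \<Rightarrow> ('a \<Rightarrow> real) \<Rightarrow> bool" where
  "G_dom AllenCahn \<Omega> bc v \<longleftrightarrow> L2_fun \<Omega> v"
| "G_dom CahnHilliard \<Omega> bc v \<longleftrightarrow> lap_dom \<Omega> bc v"

definition exact_solution ::
  "equation \<Rightarrow> 'a::euclidean_space set \<Rightarrow> 'a boundary \<Rightarrow> (real \<Rightarrow> real) \<Rightarrow> real
    \<Rightarrow> (real \<Rightarrow> 'a \<Rightarrow> real) \<Rightarrow> bool" where
  "exact_solution eqn \<Omega> bc f T u \<longleftrightarrow>
     (\<forall>t\<in>{0..T}. lap_dom \<Omega> bc (u t) \<and>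
        G_dom eqn \<Omega> bc (\<lambda>x. - lap \<Omega> bc (u t) x + f (u t x)) \<and>
        (AE x in lebesgue_on \<Omega>. ((\<lambda>r. u r x) has_real_derivative
            G_op eqn \<Omega> bc (\<lambda>y. - lap \<Omega> bc (u t) y + f (u t y)) x) (at t within {0..T}))) \<and>
     (eqn = CahnHilliard \<longrightarrow> integral\<^sup>L (lebesgue_on \<Omega>) (u 0) = 0)"

definition Ds_op ::
  "'a::euclidean_space set \<Rightarrow> 'a boundary \<Rightarrow> real \<Rightarrow> real \<Rightarrow> ('a \<Rightarrow> real) \<Rightarrow> 'a \<Rightarrow> real" where
  "Ds_op \<Omega> bc \<alpha> \<beta> v = (\<lambda>x. - (1 + \<alpha>) * lap \<Omega> bc v x + \<beta> * v x)"

definition fs_op ::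
  "'a::euclidean_space set \<Rightarrow> 'a boundary \<Rightarrow> (real \<Rightarrow> real) \<Rightarrow> real \<Rightarrow> real \<Rightarrow> ('a \<Rightarrow> real)
    \<Rightarrow> 'a \<Rightarrow> real" where
  "fs_op \<Omega> bc f \<alpha> \<beta> v = (\<lambda>x. - f (v x) - \<alpha> * lap \<Omega> bc v x + \<beta> * v x)"

definition L_op ::
  "equation \<Rightarrow> 'a::euclidean_space set \<Rightarrow> 'a boundary \<Rightarrow> real \<Rightarrow> real \<Rightarrow> ('a \<Rightarrow> real)
    \<Rightarrow> 'a \<Rightarrow> real" where
  "L_op eqn \<Omega> bc \<alpha> \<beta> v = G_op eqn \<Omega> bc (Ds_op \<Omega> bc \<alpha> \<beta> v)"

text \<open>
  \<open>L_dom\<close> and \<open>N_dom\<close> say that the functions are regular enough for \<open>L_op\<close> and \<open>N_op\<close> to be defined;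
  outside of them the choice in \<open>lap\<close> is arbitrary.
\<close>

definition L_dom ::
  "equation \<Rightarrow> 'a::euclidean_space set \<Rightarrow> 'a boundary \<Rightarrow> real \<Rightarrow> real \<Rightarrow> ('a \<Rightarrow> real) \<Rightarrow> bool" where
  "L_dom eqn \<Omega> bc \<alpha> \<beta> v \<longleftrightarrow> lap_dom \<Omega> bc v \<and> G_dom eqn \<Omega> bc (Ds_op \<Omega> bc \<alpha> \<beta> v)"

definition N_op ::
  "equation \<Rightarrow> 'a::euclidean_space set \<Rightarrow> 'a boundary \<Rightarrow> (real \<Rightarrow> real) \<Rightarrow> real \<Rightarrow> real
    \<Rightarrow> ('a \<Rightarrow> real) \<Rightarrow> 'a \<Rightarrow> real" where
  "N_op eqn \<Omega> bc f \<alpha> \<beta> v = (\<lambda>x. - G_op eqn \<Omega> bc (fs_op \<Omega> bc f \<alpha> \<beta> v) x)"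

definition N_dom ::
  "equation \<Rightarrow> 'a::euclidean_space set \<Rightarrow> 'a boundary \<Rightarrow> (real \<Rightarrow> real) \<Rightarrow> real \<Rightarrow> real
    \<Rightarrow> ('a \<Rightarrow> real) \<Rightarrow> bool" where
  "N_dom eqn \<Omega> bc f \<alpha> \<beta> v \<longleftrightarrow> lap_dom \<Omega> bc v \<and> G_dom eqn \<Omega> bc (fs_op \<Omega> bc f \<alpha> \<beta> v)"

text \<open>
  Matrices are indexed from 0, stages from 1: the coefficient \<open>a\<^sub>i\<^sub>j\<close> is \<open>A $$ (i - 1, j - 1)\<close>.
  The number of stages is \<open>dim_row A\<close>. Functions are \<open>L\<^sup>2\<close> representatives, hence the stage
  equations are required almost everywhere.
\<close>

definition imex_stages ::
  "equation \<Rightarrow> 'a::euclidean_space set \<Rightarrow> 'a boundary \<Rightarrow> (real \<Rightarrow> real) \<Rightarrow> real \<Rightarrow> real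
    \<Rightarrow> real mat \<Rightarrow> real mat \<Rightarrow> real \<Rightarrow> ('a \<Rightarrow> real) \<Rightarrow> (nat \<Rightarrow> 'a \<Rightarrow> real) \<Rightarrow> bool" where
  "imex_stages eqn \<Omega> bc f \<alpha> \<beta> A Ah \<tau> w v \<longleftrightarrow>
     v 0 = w \<and>
     (\<forall>i\<in>{1..dim_row A}.
        L_dom eqn \<Omega> bc \<alpha> \<beta> (v i) \<and> N_dom eqn \<Omega> bc f \<alpha> \<beta> (v (i - 1)) \<and>
        (AE x in lebesgue_on \<Omega>. v i x = v 0 x + \<tau> *
           ((\<Sum>j=1..i. A $$ (i - 1, j - 1) * L_op eqn \<Omega> bc \<alpha> \<beta> (v j) x) +
            (\<Sum>j=1..i. Ah $$ (i - 1, j - 1) * N_op eqn \<Omega> bc f \<alpha> \<beta> (v (j - 1)) x))))"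

definition imex_solution ::
  "equation \<Rightarrow> 'a::euclidean_space set \<Rightarrow> 'a boundary \<Rightarrow> (real \<Rightarrow> real) \<Rightarrow> real \<Rightarrow> real
    \<Rightarrow> real mat \<Rightarrow> real mat \<Rightarrow> real \<Rightarrow> real \<Rightarrow> ('a \<Rightarrow> real) \<Rightarrow> (nat \<Rightarrow> 'a \<Rightarrow> real) \<Rightarrow> bool" where
  "imex_solution eqn \<Omega> bc f \<alpha> \<beta> A Ah \<tau> T w U \<longleftrightarrow>
     U 0 = w \<and>
     (\<forall>n. real (n + 1) * \<tau> \<le> T \<longrightarrow>
        (\<exists>v. imex_stages eqn \<Omega> bc f \<alpha> \<beta> A Ah \<tau> (U n) v \<and> U (n + 1) = v (dim_row A)))"

text \<open>Here \<open>v\<close> stands for the stages started from the exact value \<open>u(t\<^sub>n)\<close>.\<close>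

definition truncation_error ::
  "equation \<Rightarrow> 'a::euclidean_space set \<Rightarrow> 'a boundary \<Rightarrow> (real \<Rightarrow> real) \<Rightarrow> real \<Rightarrow> real
    \<Rightarrow> real mat \<Rightarrow> real mat \<Rightarrow> real \<Rightarrow> (real \<Rightarrow> 'a \<Rightarrow> real) \<Rightarrow> nat \<Rightarrow> (nat \<Rightarrow> 'a \<Rightarrow> real)
    \<Rightarrow> 'a \<Rightarrow> real" where
  "truncation_error eqn \<Omega> bc f \<alpha> \<beta> A Ah \<tau> u n v = (let s = dim_row A in
     (\<lambda>x. u (real (n + 1) * \<tau>) x - u (real n * \<tau>) x - \<tau> *
        ((\<Sum>j=1..s. A $$ (s - 1, j - 1) * L_op eqn \<Omega> bc \<alpha> \<beta> (v j) x) +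
         (\<Sum>j=1..s. Ah $$ (s - 1, j - 1) * N_op eqn \<Omega> bc f \<alpha> \<beta> (v (j - 1)) x))))"

definition truncation_stages_exist ::
  "equation \<Rightarrow> 'a::euclidean_space set \<Rightarrow> 'a boundary \<Rightarrow> (real \<Rightarrow> real) \<Rightarrow> real \<Rightarrow> real
    \<Rightarrow> real mat \<Rightarrow> real mat \<Rightarrow> real \<Rightarrow> real \<Rightarrow> (real \<Rightarrow> 'a \<Rightarrow> real) \<Rightarrow> bool" where
  "truncation_stages_exist eqn \<Omega> bc f \<alpha> \<beta> A Ah \<tau> T u \<longleftrightarrow>
     (\<forall>n. real (n + 1) * \<tau> \<le> T \<longrightarrow>
        (\<exists>v. imex_stages eqn \<Omega> bc f \<alpha> \<beta> A Ah \<tau> (u (real n * \<tau>)) v))"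

text \<open>
  The constant \<open>K\<close> of the \<open>O(\<tau>\<^bsup>p+1\<^esup>)\<close> bound is explicit, so that error constants can be stated to
  depend on it. Existence of the stages is the separate condition above, because otherwise the
  bound could hold vacuously.
\<close>

definition truncation_order ::
  "equation \<Rightarrow> 'a::euclidean_space set \<Rightarrow> 'a boundary \<Rightarrow> (real \<Rightarrow> real) \<Rightarrow> real \<Rightarrow> real
    \<Rightarrow> real mat \<Rightarrow> real mat \<Rightarrow> real \<Rightarrow> (real \<Rightarrow> 'a \<Rightarrow> real) \<Rightarrow> nat \<Rightarrow> real \<Rightarrow> bool" where
  "truncation_order eqn \<Omega> bc f \<alpha> \<beta> A Ah T u p K \<longleftrightarrow>
     (\<forall>\<tau>>0. \<forall>n v. real (n + 1) * \<tau> \<le> T \<longrightarrow>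
        imex_stages eqn \<Omega> bc f \<alpha> \<beta> A Ah \<tau> (u (real n * \<tau>)) v \<longrightarrow>
        H1_norm \<Omega> bc (truncation_error eqn \<Omega> bc f \<alpha> \<beta> A Ah \<tau> u n v) \<le> K * \<tau> ^ (p + 1))"

definition symm_part :: "real mat \<Rightarrow> real mat" where
  "symm_part M = (1 / 2) \<cdot>\<^sub>m (M + transpose_mat M)"

definition pos_def :: "real mat \<Rightarrow> bool" where
  "pos_def M \<longleftrightarrow> (\<forall>x \<in> carrier_vec (dim_row M). x \<noteq> 0\<^sub>v (dim_row M) \<longrightarrow>
     0 < scalar_prod x (symm_part M *\<^sub>v x))"

definition lambda_min :: "real mat \<Rightarrow> real" where
  "lambda_min M = Min {k. eigenvalue (symm_part M) k}"

definition lower_triangular :: "real mat \<Rightarrow> bool" where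
  "lower_triangular M \<longleftrightarrow> (\<forall>i<dim_row M. \<forall>j<dim_col M. i < j \<longrightarrow> M $$ (i, j) = 0)"

definition ones_mat :: "nat \<Rightarrow> real mat" where
  "ones_mat s = mat s s (\<lambda>(i, j). 1)"

definition lower_ones_mat :: "nat \<Rightarrow> real mat" where
  "lower_ones_mat s = mat s s (\<lambda>(i, j). if j \<le> i then 1 else 0)"

abbreviation inv_mat :: "real mat \<Rightarrow> real mat" where
  "inv_mat M \<equiv> the (mat_inverse M)"

definition Q_mat :: "real mat \<Rightarrow> real mat \<Rightarrow> real mat" where
  "Q_mat A Ah = (let s = dim_row A in
     (inv_mat Ah * A - 1\<^sub>m s) * lower_ones_mat s + 1\<^sub>m s)"

definition H0_mat :: "real mat \<Rightarrow> real mat" where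
  "H0_mat Ah = inv_mat Ah * lower_ones_mat (dim_row Ah)"

definition H1_mat :: "real \<Rightarrow> real \<Rightarrow> real mat \<Rightarrow> real mat \<Rightarrow> real mat" where
  "H1_mat L \<beta> A Ah = \<beta> \<cdot>\<^sub>m Q_mat A Ah - (L / 2) \<cdot>\<^sub>m 1\<^sub>m (dim_row A)"

definition H2_base_mat :: "real mat \<Rightarrow> real mat \<Rightarrow> real mat" where
  "H2_base_mat A Ah = (let s = dim_row A in
     inv_mat Ah * A * lower_ones_mat s - (1 / 2) \<cdot>\<^sub>m ones_mat s)"

definition H2_mat :: "real \<Rightarrow> real mat \<Rightarrow> real mat \<Rightarrow> real mat" where
  "H2_mat \<alpha> A Ah = \<alpha> \<cdot>\<^sub>m Q_mat A Ah + H2_base_mat A Ah"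

end

theory Submission
  imports Defs
begin

text \<open>
  The numerical stages of each step are compared with the stages of the scheme started from the exact
  solution. The difference between the latter and the exact solution at the next time level is the
  truncation error, so the claim is a stability estimate for differences of two runs of the scheme with
  \<open>O(\<tau>\<^sup>p\<^sup>+\<^sup>1)\<close> perturbations in \<open>H\<^sup>1\<close>.

  \<^emph>\<open>Reduction to scalars.\<close> The error equations of the first \<open>N\<close> steps are weak equations between finitely
  many functions, and it suffices to test them with the span of just these functions. On this finite
  dimensional space the Dirichlet form is diagonal in an orthonormal basis of \<open>L\<^sup>2\<close>
  (\<open>galerkin_eigenbasis\<close>), so that no spectral theory of the Laplacian on the domain is involved. In each
  mode the stages satisfy a scalar recursion with a parameter \<open>\<mu> \<ge> 0\<close> (\<open>modal_stages\<close>); the nonlinearity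
  becomes a source whose \<open>L\<^sup>2\<close> norm is controlled by the Lipschitz condition and Bessel's inequality. The
  \<open>H\<^sup>1\<close> norm is the sum of squares with weight \<open>1 + \<mu>\<close>. The Dirichlet form is well defined because weak
  gradients are unique almost everywhere, by the fundamental lemma of the calculus of variations.

  \<^emph>\<open>One step.\<close> The stage equations, multiplied by the inverse of \<open>Ah\<close> and paired with the stage
  increments, give an energy identity (\<open>energy_identity\<close>) in which \<open>H0\<close>, \<open>H2\<close> and \<open>Q\<close> appear as quadratic
  forms. Their positive definiteness makes the linear part of the scheme stable and leaves a surplus
  that controls the source.

  \<^emph>\<open>Allen--Cahn.\<close> The surplus pays for the source up to a factor \<open>1 + O(\<tau>)\<close> in a norm equivalent to
  that of \<open>H\<^sup>1\<close>, and a discrete Gronwall inequality concludes.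

  \<^emph>\<open>Cahn--Hilliard.\<close> Here the energy at the level of \<open>H\<^sup>1\<close> would need the gradient of the source, which is
  not available since \<open>f\<close> is only Lipschitz. The proof therefore uses that the scheme inherits the
  parabolic smoothing of the equation. One step multiplies the square of a mode by at most
  \<open>1 - c z / (1 + z)\<close> and weakens the source by \<open>1 / (1 + z)\<close>, where \<open>z = \<tau> \<mu>\<^sup>2\<close> (\<open>cahn_hilliard_step\<close>). The \<open>L\<^sup>2\<close> error is
  bounded first by Gronwall's inequality. In the unrolled recursion a source that acted \<open>m\<close> steps ago
  then contributes to the squared gradient at most a multiple of \<open>\<tau>\<^sup>1\<^sup>/\<^sup>2 m\<^sup>-\<^sup>1\<^sup>/\<^sup>2\<close> times its squared
  \<open>L\<^sup>2\<close> norm (\<open>smoothing_kernel_bound\<close>), and these factors add up to a multiple of \<open>T\<^sup>1\<^sup>/\<^sup>2\<close>.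

  \<^emph>\<open>Large steps.\<close> For \<open>\<tau> \<ge> 1\<close> there are at most \<open>T\<close> steps, and it is enough that one step multiplies the
  norm by a constant. This follows from the implicit terms alone (\<open>stage_bound\<close>). Their coefficients are
  positive, since for the lower triangular matrices in question positive definiteness passes to the
  entries on the diagonal and these multiply.
\<close>

section \<open>Spectral theorem for real symmetric matrices\<close>

definition dot :: "'i set \<Rightarrow> ('i \<Rightarrow> real) \<Rightarrow> ('i \<Rightarrow> real) \<Rightarrow> real" where
  "dot I x y = (\<Sum>a\<in>I. x a * y a)"

text \<open>Vectors and matrices are functions on an arbitrary finite index set, so that functions of a Galerkin
  space can serve as their own indices.\<close>

definition mat_app :: "'i set \<Rightarrow> ('i \<Rightarrow> 'i \<Rightarrow> real) \<Rightarrow> ('i \<Rightarrow> real) \<Rightarrow> 'i \<Rightarrow> real" where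
  "mat_app I M x = (\<lambda>a. \<Sum>b\<in>I. M a b * x b)"

definition orthonormal_family :: "'i set \<Rightarrow> nat set \<Rightarrow> (nat \<Rightarrow> 'i \<Rightarrow> real) \<Rightarrow> bool" where
  "orthonormal_family I J P \<longleftrightarrow> (\<forall>k\<in>J. \<forall>l\<in>J. dot I (P k) (P l) = (if k = l then 1 else 0))"

lemma dot_commute: "dot I x y = dot I y x"
  by (simp add: dot_def mult.commute)

lemma dot_add_right: "dot I x (\<lambda>a. y a + z a) = dot I x y + dot I x z"
  by (simp add: dot_def distrib_left sum.distrib)

lemma dot_diff_right: "dot I x (\<lambda>a. y a - z a) = dot I x y - dot I x z"
  by (simp add: dot_def right_diff_distrib sum_subtractf)

lemma dot_scale_right: "dot I x (\<lambda>a. c * y a) = c * dot I x y"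
  by (simp add: dot_def sum_distrib_left mult.left_commute)

lemma dot_sum_right: "dot I x (\<lambda>a. \<Sum>k\<in>J. f k a) = (\<Sum>k\<in>J. dot I x (f k))"
  unfolding dot_def sum_distrib_left by (rule sum.swap)

lemma dot_add_left: "dot I (\<lambda>a. y a + z a) x = dot I y x + dot I z x"
  by (metis dot_commute dot_add_right)

lemma dot_diff_left: "dot I (\<lambda>a. y a - z a) x = dot I y x - dot I z x"
  by (metis dot_commute dot_diff_right)

lemma dot_scale_left: "dot I (\<lambda>a. c * y a) x = c * dot I y x"
  by (metis dot_commute dot_scale_right)

lemma dot_sum_left: "dot I (\<lambda>a. \<Sum>k\<in>J. f k a) x = (\<Sum>k\<in>J. dot I (f k) x)"
  by (subst dot_commute, subst dot_sum_right) (simp add: dot_commute)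

lemmas dot_linear = dot_add_right dot_diff_right dot_scale_right
  dot_add_left dot_diff_left dot_scale_left

lemma mat_app_add: "mat_app I M (\<lambda>a. x a + y a) = (\<lambda>a. mat_app I M x a + mat_app I M y a)"
  by (simp add: mat_app_def distrib_left sum.distrib)

lemma mat_app_scale: "mat_app I M (\<lambda>a. c * x a) = (\<lambda>a. c * mat_app I M x a)"
  by (simp add: mat_app_def sum_distrib_left mult.left_commute)

lemma mat_app_sum: "mat_app I M (\<lambda>a. \<Sum>k\<in>J. f k a) = (\<lambda>a. \<Sum>k\<in>J. mat_app I M (f k) a)"
  unfolding mat_app_def sum_distrib_left by (subst sum.swap) (rule refl)

lemma dot_mat_app_sym:
  assumes "\<And>a b. a \<in> I \<Longrightarrow> b \<in> I \<Longrightarrow> M a b = M b a"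
  shows "dot I x (mat_app I M y) = dot I y (mat_app I M x)"
proof -
  have "dot I x (mat_app I M y) = (\<Sum>a\<in>I. \<Sum>b\<in>I. x a * (M a b * y b))"
    by (simp add: dot_def mat_app_def sum_distrib_left)
  also have "\<dots> = (\<Sum>b\<in>I. \<Sum>a\<in>I. x a * (M a b * y b))"
    by (rule sum.swap)
  also have "\<dots> = (\<Sum>b\<in>I. \<Sum>a\<in>I. y b * (M b a * x a))"
    by (intro sum.cong refl) (simp add: assms)
  also have "\<dots> = dot I y (mat_app I M x)"
    by (simp add: dot_def mat_app_def sum_distrib_left)
  finally show ?thesis .
qed

lemma dot_self_nonneg: "0 \<le> dot I x x"
  by (simp add: dot_def sum_nonneg)

lemma dot_self_eq_0:
  assumes "finite I" "dot I x x = 0" "a \<in> I"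
  shows "x a = 0"
  using assms by (simp add: dot_def sum_nonneg_eq_0_iff)

lemma dot_unit_right: "finite I \<Longrightarrow> a \<in> I \<Longrightarrow> dot I x (\<lambda>b. if b = a then 1 else 0) = x a"
  by (simp add: dot_def if_distrib[of "\<lambda>t. _ * t"] sum.delta cong: if_cong)

lemma continuous_on_dot [continuous_intros]:
  assumes "\<And>a. continuous_on S (\<lambda>x. f x a)" "\<And>a. continuous_on S (\<lambda>x. g x a)"
  shows "continuous_on S (\<lambda>x. dot I (f x) (g x))"
  unfolding dot_def by (intro continuous_intros assms)

lemma continuous_on_coordinate: "continuous_on S (\<lambda>x. x i :: real)"
  by (rule continuous_on_subset[OF continuous_on_product_coordinates]) simp

lemma continuous_on_mat_app: "continuous_on S (\<lambda>x. mat_app I M x a)"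
  unfolding mat_app_def by (intro continuous_intros continuous_on_coordinate)

lemma compact_coordinate_sphere:
  fixes I :: "'i set"
  assumes "finite I"
  shows "compact {x. (\<forall>a. a \<notin> I \<longrightarrow> x a = 0) \<and> dot I x x = 1}" (is "compact ?S")
proof -
  let ?B = "PiE UNIV (\<lambda>a. if a \<in> I then {-1..1::real} else {0})"
  have "compactin (product_topology (\<lambda>_. euclidean) UNIV) ?B"
    by (subst compactin_PiE) auto
  then have "compact ?B"
    by (simp add: euclidean_product_topology)
  moreover have "closed ?S"
  proof -
    have "?S = (\<Inter>a\<in>- I. {x. x a = 0}) \<inter> {x. dot I x x = 1}"
      by auto
    moreover have "closed (\<Inter>a\<in>- I. {x. x a = (0::real)})"
      by (intro closed_INT ballI closed_Collect_eq continuous_on_coordinate continuous_on_const)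
    moreover have "closed {x. dot I x x = 1}"
      by (intro closed_Collect_eq continuous_intros continuous_on_coordinate)
    ultimately show ?thesis by (simp only: closed_Int)
  qed
  moreover have "?S \<subseteq> ?B"
  proof
    fix x assume x: "x \<in> ?S"
    have "\<bar>x a\<bar> \<le> 1" if "a \<in> I" for a
    proof -
      have "x a * x a \<le> dot I x x"
        unfolding dot_def using assms that by (intro member_le_sum) auto
      then show ?thesis using x abs_square_le_1[of "x a"] by (simp add: power2_eq_square)
    qed
    then have "x a \<in> (if a \<in> I then {-1..1} else {0})" for a
      using x by (cases "a \<in> I") (simp_all add: abs_le_iff minus_le_iff)
    then show "x \<in> ?B" by (intro PiE_I) simp_all
  qed
  moreover have "?B \<inter> ?S = ?S" using calculation(3) by (rule inf_absorb2)
  ultimately show ?thesis using compact_Int_closed[of ?B ?S] by simp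
qed

text \<open>The part of the \<open>a\<close>-th unit vector orthogonal to the vectors \<open>P k\<close>, \<open>k \<in> J\<close>.\<close>

definition coord_residual :: "nat set \<Rightarrow> (nat \<Rightarrow> 'i \<Rightarrow> real) \<Rightarrow> 'i \<Rightarrow> 'i \<Rightarrow> real" where
  "coord_residual J P a = (\<lambda>b. (if b = a then 1 else 0) - (\<Sum>k\<in>J. P k a * P k b))"

lemma
  assumes I: "finite I" and J: "finite J" and P: "orthonormal_family I J P" and a: "a \<in> I"
  shows dot_coord_residual: "k \<in> J \<Longrightarrow> dot I (coord_residual J P a) (P k) = 0"
    and dot_coord_residual_self:
      "dot I (coord_residual J P a) (coord_residual J P a) = 1 - (\<Sum>k\<in>J. P k a * P k a)"
proof -
  define u where "u = (\<lambda>b. if b = a then 1 else (0::real))"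
  define q where "q = (\<lambda>b. u b - (\<Sum>k\<in>J. P k a * P k b))"
  have q: "coord_residual J P a = q" by (simp add: coord_residual_def q_def u_def)
  have uP: "dot I u (P k) = P k a" for k
    unfolding u_def using dot_unit_right[OF I a] by (simp add: dot_commute)
  have uu: "dot I u u = 1"
    unfolding u_def using dot_unit_right[OF I a] by simp
  have PP: "dot I (P k) (P l) = (if k = l then 1 else 0)" if "k \<in> J" "l \<in> J" for k l
    using P that by (simp add: orthonormal_family_def)
  have qP: "dot I q (P k) = 0" if k: "k \<in> J" for k
  proof -
    have "(\<Sum>l\<in>J. P l a * dot I (P l) (P k)) = (\<Sum>l\<in>J. if l = k then P k a else 0)"
      using k by (intro sum.cong) (auto simp: PP)
    also have "\<dots> = P k a" using J k by simp
    finally show ?thesis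
      unfolding q_def dot_diff_left dot_sum_left dot_scale_left by (simp add: uP)
  qed
  then show "k \<in> J \<Longrightarrow> dot I (coord_residual J P a) (P k) = 0" using q by simp
  have "dot I q q = dot I q u - (\<Sum>k\<in>J. P k a * dot I q (P k))"
    by (subst (2) q_def) (simp add: dot_diff_right dot_sum_right dot_scale_right)
  also have "\<dots> = dot I q u" using qP by simp
  also have "\<dots> = 1 - (\<Sum>k\<in>J. P k a * P k a)"
    unfolding q_def dot_diff_left dot_sum_left dot_scale_left
    by (simp add: uu uP dot_commute[of I "P _" u])
  finally show "dot I (coord_residual J P a) (coord_residual J P a) = 1 - (\<Sum>k\<in>J. P k a * P k a)"
    using q by simp
qed

text \<open>Counting the residuals of all unit vectors measures the dimension that an orthonormal family leaves
  free. A positive sum yields a further orthogonal direction; the sum zero means completeness.\<close>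

lemma sum_coord_residuals:
  assumes I: "finite I" and J: "finite J" and P: "orthonormal_family I J P"
  shows "(\<Sum>a\<in>I. dot I (coord_residual J P a) (coord_residual J P a)) = real (card I) - real (card J)"
proof -
  have "(\<Sum>a\<in>I. \<Sum>k\<in>J. P k a * P k a) = (\<Sum>k\<in>J. dot I (P k) (P k))"
    unfolding dot_def by (rule sum.swap)
  also have "\<dots> = card J" using P by (simp add: orthonormal_family_def)
  finally show ?thesis
    using assms by (simp add: dot_coord_residual_self sum_subtractf)
qed

lemma exists_unit_orthogonal:
  assumes I: "finite I" and J: "finite J" "card J < card I" and P: "orthonormal_family I J P"
  shows "\<exists>x. (\<forall>a. a \<notin> I \<longrightarrow> x a = 0) \<and> dot I x x = 1 \<and> (\<forall>k\<in>J. dot I x (P k) = 0)"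
proof -
  define q where "q = coord_residual J P"
  have qP: "dot I (q a) (P k) = 0" if "a \<in> I" "k \<in> J" for a k
    unfolding q_def by (rule dot_coord_residual[OF I J(1) P that])
  have "(\<Sum>a\<in>I. dot I (q a) (q a)) > 0"
    using J sum_coord_residuals[OF I J(1) P] by (simp add: q_def)
  then obtain a where a: "a \<in> I" "dot I (q a) (q a) > 0"
    by (meson leD leI sum_nonpos)
  define r where "r = sqrt (dot I (q a) (q a))"
  have r: "r > 0" "r * r = dot I (q a) (q a)" using a by (auto simp: r_def)
  define x where "x b = (if b \<in> I then (1 / r) * q a b else 0)" for b
  have xd: "dot I x y = dot I (\<lambda>b. (1 / r) * q a b) y" for y
    unfolding dot_def x_def by (intro sum.cong) auto
  have "dot I x x = (1 / r) * ((1 / r) * dot I (q a) (q a))"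
    by (metis xd dot_commute dot_scale_left)
  then have "dot I x x = 1" using r(1) unfolding r(2)[symmetric] by simp
  moreover have "dot I x (P k) = 0" if "k \<in> J" for k
    by (simp only: xd dot_scale_left) (simp add: qP a that)
  moreover have "\<forall>b. b \<notin> I \<longrightarrow> x b = 0" by (simp add: x_def)
  ultimately show ?thesis by blast
qed

text \<open>The first order condition at a maximum: moving by \<open>t\<close> changes the value by
  \<open>t\<^sup>2 d + 2 t c\<close>.\<close>

lemma quadratic_max_first_order:
  fixes c d :: real
  assumes "\<And>t. t\<^sup>2 * d + 2 * t * c \<le> 0"
  shows "c = 0"
proof (rule ccontr)
  assume c: "c \<noteq> 0"
  define D where "D = \<bar>d\<bar> + 1"
  have D: "D > 0" "d \<ge> - D" by (auto simp: D_def)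
  have "(c / D)\<^sup>2 * d + 2 * (c / D) * c \<le> 0" by (rule assms)
  moreover have "(c / D)\<^sup>2 * d \<ge> (c / D)\<^sup>2 * (- D)" using D by (intro mult_left_mono) auto
  moreover have "(c / D)\<^sup>2 * (- D) + 2 * (c / D) * c = c\<^sup>2 / D"
    using D by (simp add: field_simps power2_eq_square)
  moreover have "c\<^sup>2 / D > 0" using c D by simp
  ultimately show False by linarith
qed

text \<open>The Rayleigh principle: a maximizer of the quadratic form on the unit sphere orthogonal to the
  eigenvectors found so far is a further eigenvector.\<close>

lemma extend_eigenvectors:
  assumes I: "finite I" and sym: "\<And>a b. a \<in> I \<Longrightarrow> b \<in> I \<Longrightarrow> M a b = M b a"
    and m: "m < card I" and P: "orthonormal_family I {..<m} P"
    and eig: "\<And>k a. k < m \<Longrightarrow> a \<in> I \<Longrightarrow> mat_app I M (P k) a = lam k * P k a"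
  shows "\<exists>x l. dot I x x = 1 \<and> (\<forall>k<m. dot I x (P k) = 0) \<and> (\<forall>a\<in>I. mat_app I M x a = l * x a)"
proof -
  let ?S = "{x. (\<forall>a. a \<notin> I \<longrightarrow> x a = 0) \<and> dot I x x = 1} \<inter> {x. \<forall>k\<in>{..<m}. dot I x (P k) = 0}"
  have "closed {x. \<forall>k\<in>{..<m}. dot I x (P k) = 0}"
  proof -
    have "{x. \<forall>k\<in>{..<m}. dot I x (P k) = 0} = (\<Inter>k\<in>{..<m}. {x. dot I x (P k) = 0})" by auto
    moreover have "closed {x. dot I x (P k) = 0}" for k
      by (intro closed_Collect_eq continuous_intros continuous_on_coordinate)
    ultimately show ?thesis by auto
  qed
  then have cS: "compact ?S" by (rule compact_Int_closed[OF compact_coordinate_sphere[OF I]])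
  have neS: "?S \<noteq> {}"
    using exists_unit_orthogonal[OF I _ _ P] m by auto
  have "continuous_on ?S (\<lambda>x. dot I x (mat_app I M x))"
    by (intro continuous_intros continuous_on_coordinate continuous_on_mat_app)
  from continuous_attains_sup[OF cS neS this]
  obtain x where x: "x \<in> ?S" and mx: "\<forall>y\<in>?S. dot I y (mat_app I M y) \<le> dot I x (mat_app I M x)"
    by (rule bexE)
  define l where "l = dot I x (mat_app I M x)"
  have xx: "dot I x x = 1" and xP: "\<And>k. k < m \<Longrightarrow> dot I x (P k) = 0" using x by auto
  have sym': "dot I u (mat_app I M v) = dot I v (mat_app I M u)" for u v
    using sym by (rule dot_mat_app_sym)
  \<comment> \<open>By homogeneity the maximum on the sphere bounds the form on the whole orthogonal complement.\<close>
  have le: "dot I y (mat_app I M y) \<le> l * dot I y y" if y: "\<And>k. k < m \<Longrightarrow> dot I y (P k) = 0" for y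
  proof (cases "dot I y y = 0")
    case True
    then have "\<And>a. a \<in> I \<Longrightarrow> y a = 0" by (rule dot_self_eq_0[OF I])
    then have "dot I y (mat_app I M y) = 0" by (simp add: dot_def)
    then show ?thesis using True by simp
  next
    case False
    define r where "r = sqrt (dot I y y)"
    have r: "r > 0" "r * r = dot I y y" using False dot_self_nonneg[of I y] by (auto simp: r_def)
    define z where "z b = (if b \<in> I then (1 / r) * y b else 0)" for b
    have zd: "dot I z w = dot I (\<lambda>b. (1 / r) * y b) w" for w
      unfolding dot_def z_def by (intro sum.cong) auto
    have zM: "mat_app I M z = mat_app I M (\<lambda>b. (1 / r) * y b)"
      unfolding mat_app_def z_def by (intro ext sum.cong) auto
    have "dot I z z = (1 / r) * ((1 / r) * dot I y y)"
      by (metis zd dot_commute dot_scale_left)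
    then have "dot I z z = 1" using r(1) unfolding r(2)[symmetric] by simp
    moreover have "dot I z (P k) = 0" if "k < m" for k
      by (simp only: zd dot_scale_left) (simp add: y that)
    ultimately have "z \<in> ?S" by (auto simp: z_def)
    then have "dot I z (mat_app I M z) \<le> l" unfolding l_def by (rule mx[rule_format])
    moreover have "dot I z (mat_app I M z) = (1 / r) * ((1 / r) * dot I y (mat_app I M y))"
      unfolding zd zM mat_app_scale dot_scale_left dot_scale_right ..
    ultimately have "dot I y (mat_app I M y) / (r * r) \<le> l" by simp
    moreover have "r * r > 0" using r(1) by simp
    ultimately show ?thesis unfolding r(2) by (simp add: pos_divide_le_eq)
  qed
  \<comment> \<open>The residual \<open>z\<close> of the eigenvalue equation is an admissible variation, and the first order
    condition in its own direction says that it vanishes.\<close>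
  define z where "z = (\<lambda>a. mat_app I M x a - l * x a)"
  have zx: "dot I z x = 0"
    unfolding z_def dot_diff_left dot_scale_left by (simp add: xx l_def dot_commute)
  have zP: "dot I z (P k) = 0" if "k < m" for k
  proof -
    have "dot I (mat_app I M x) (P k) = dot I x (mat_app I M (P k))"
      by (metis sym' dot_commute)
    also have "\<dots> = dot I x (\<lambda>a. lam k * P k a)"
      unfolding dot_def by (intro sum.cong) (simp_all add: eig that)
    finally show ?thesis using that unfolding z_def dot_diff_left dot_scale_left dot_scale_right
      by (simp add: xP)
  qed
  have "dot I z (mat_app I M x) = 0"
  proof (rule quadratic_max_first_order)
    fix t :: real
    define w where "w = (\<lambda>a. x a + t * z a)"
    have "dot I w (P k) = 0" if "k < m" for k
      unfolding w_def dot_add_left dot_scale_left using that by (simp add: xP zP)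
    then have "dot I w (mat_app I M w) \<le> l * dot I w w" by (rule le)
    moreover have "dot I w w = 1 + t\<^sup>2 * dot I z z"
      unfolding w_def dot_linear using zx by (simp add: xx dot_commute power2_eq_square)
    moreover have "dot I w (mat_app I M w)
        = l + 2 * t * dot I z (mat_app I M x) + t\<^sup>2 * dot I z (mat_app I M z)"
      unfolding w_def mat_app_add mat_app_scale dot_linear
      using sym'[of x z] by (simp add: l_def power2_eq_square algebra_simps)
    ultimately show "t\<^sup>2 * (dot I z (mat_app I M z) - l * dot I z z) + 2 * t * dot I z (mat_app I M x) \<le> 0"
      by (simp add: algebra_simps)
  qed
  then have "dot I z z = 0"
    using zx by (subst (2) z_def) (simp add: dot_diff_right dot_scale_right)
  then have "mat_app I M x a = l * x a" if "a \<in> I" for a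
    using dot_self_eq_0[OF I _ that, of z] by (simp add: z_def)
  then show ?thesis using xx xP by blast
qed

lemma orthonormal_eigenvectors:
  assumes I: "finite I" and sym: "\<And>a b. a \<in> I \<Longrightarrow> b \<in> I \<Longrightarrow> M a b = M b a"
  shows "m \<le> card I \<Longrightarrow> \<exists>P lam. orthonormal_family I {..<m} P \<and>
    (\<forall>k<m. \<forall>a\<in>I. mat_app I M (P k) a = lam k * P k a)"
proof (induction m)
  case 0
  then show ?case by (simp add: orthonormal_family_def)
next
  case (Suc m)
  then obtain P lam where P: "orthonormal_family I {..<m} P"
    and eig: "\<forall>k<m. \<forall>a\<in>I. mat_app I M (P k) a = lam k * P k a" by auto
  obtain x l where x: "dot I x x = 1" "\<forall>k<m. dot I x (P k) = 0" "\<forall>a\<in>I. mat_app I M x a = l * x a"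
    using extend_eigenvectors[where M = M and m = m and lam = lam, OF I sym _ P] Suc.prems eig by auto
  have "orthonormal_family I {..<Suc m} (P(m := x))"
  proof -
    have "\<forall>k<m. dot I (P k) x = 0" using x(2) by (simp add: dot_commute)
    then show ?thesis using P x(1,2) unfolding orthonormal_family_def by (auto simp: less_Suc_eq)
  qed
  moreover have "\<forall>k<Suc m. \<forall>a\<in>I. mat_app I M ((P(m := x)) k) a = (lam(m := l)) k * (P(m := x)) k a"
    using eig x by (auto simp: less_Suc_eq)
  ultimately show ?case by blast
qed

lemma orthonormal_basis_complete:
  assumes I: "finite I" and P: "orthonormal_family I {..<card I} P" and ab: "a \<in> I" "b \<in> I"
  shows "(\<Sum>k<card I. P k a * P k b) = (if a = b then 1 else 0)"
proof -
  define q where "q = coord_residual {..<card I} P"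
  have "(\<Sum>a\<in>I. dot I (q a) (q a)) = 0"
    unfolding q_def using sum_coord_residuals[OF I _ P] by simp
  then have "dot I (q a) (q a) = 0"
    using ab I dot_self_nonneg[of I] by (simp add: sum_nonneg_eq_0_iff)
  then have "q a b = 0" using I ab by (blast intro: dot_self_eq_0)
  then show ?thesis by (auto simp: q_def coord_residual_def split: if_splits)
qed

lemma orthonormal_basis_parseval:
  assumes I: "finite I" and P: "orthonormal_family I {..<card I} P"
  shows "(\<Sum>r<card I. (dot I x (P r))\<^sup>2) = dot I x x"
proof -
  have "(\<Sum>r<card I. (dot I x (P r))\<^sup>2)
      = (\<Sum>r<card I. \<Sum>a\<in>I. \<Sum>b\<in>I. x a * x b * (P r a * P r b))"
    unfolding dot_def power2_eq_square sum_product by (intro sum.cong refl) (simp add: algebra_simps)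
  also have "\<dots> = (\<Sum>a\<in>I. \<Sum>b\<in>I. \<Sum>r<card I. x a * x b * (P r a * P r b))"
    by (subst sum.swap) (intro sum.cong refl, rule sum.swap)
  also have "\<dots> = (\<Sum>a\<in>I. \<Sum>b\<in>I. if b = a then x a * x a else 0)"
    unfolding sum_distrib_left[symmetric]
    by (intro sum.cong refl) (simp add: orthonormal_basis_complete[OF I P])
  also have "\<dots> = dot I x x" using I by (simp add: dot_def)
  finally show ?thesis .
qed

lemma orthonormal_basis_expansion:
  assumes I: "finite I" and P: "orthonormal_family I {..<card I} P" and a: "a \<in> I"
  shows "f a = (\<Sum>k<card I. P k a * dot I f (P k))"
proof -
  have "(\<Sum>k<card I. P k a * dot I f (P k)) = (\<Sum>b\<in>I. f b * (\<Sum>k<card I. P k a * P k b))"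
    unfolding dot_def sum_distrib_left
    by (subst sum.swap) (intro sum.cong refl, simp add: algebra_simps)
  also have "\<dots> = (\<Sum>b\<in>I. if b = a then f a else 0)"
    using a by (intro sum.cong refl) (simp add: orthonormal_basis_complete[OF I P])
  also have "\<dots> = f a" using I a by simp
  finally show ?thesis by simp
qed

text \<open>Cauchy--Schwarz for a semidefinite form: an isotropic vector lies in the kernel.\<close>

lemma psd_form_null_vector:
  assumes I: "finite I" and sym: "\<And>a b. a \<in> I \<Longrightarrow> b \<in> I \<Longrightarrow> K a b = K b a"
    and psd: "\<And>y. 0 \<le> dot I y (mat_app I K y)" and x: "dot I x (mat_app I K x) = 0" and a: "a \<in> I"
  shows "mat_app I K x a = 0"
proof -
  define u where "u = (\<lambda>b. if b = a then 1 else (0::real))"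
  have "dot I u (mat_app I K x) = 0"
  proof (rule quadratic_max_first_order)
    fix t :: real
    have "0 \<le> dot I (\<lambda>b. x b + (- t) * u b) (mat_app I K (\<lambda>b. x b + (- t) * u b))" by (rule psd)
    also have "\<dots> = - 2 * t * dot I u (mat_app I K x) + t\<^sup>2 * dot I u (mat_app I K u)"
      unfolding mat_app_add mat_app_scale dot_linear
      using x dot_mat_app_sym[where I = I and M = K and x = x and y = u, OF sym] by (simp add: power2_eq_square algebra_simps)
    finally show "t\<^sup>2 * (- dot I u (mat_app I K u)) + 2 * t * dot I u (mat_app I K x) \<le> 0" by simp
  qed
  then show ?thesis
    unfolding u_def using dot_unit_right[OF I a, of "mat_app I K x"] by (simp add: dot_commute)
qed

text \<open>The mass matrix \<open>M\<close> is diagonalized first and its kernel discarded, which handles linearly dependent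
  families. In the coordinates normalized by the square roots of its eigenvalues the stiffness matrix
  \<open>K\<close> is again symmetric and is diagonalized by an orthogonal change of basis. Because \<open>K\<close> vanishes
  on the kernel of \<open>M\<close>, nothing is lost.\<close>

theorem gram_simultaneous_diagonalization:
  fixes M K :: "'i \<Rightarrow> 'i \<Rightarrow> real"
  assumes S: "finite S"
    and symM: "\<And>a b. a \<in> S \<Longrightarrow> b \<in> S \<Longrightarrow> M a b = M b a"
    and symK: "\<And>a b. a \<in> S \<Longrightarrow> b \<in> S \<Longrightarrow> K a b = K b a"
    and psdM: "\<And>x. 0 \<le> dot S x (mat_app S M x)"
    and psdK: "\<And>x. 0 \<le> dot S x (mat_app S K x)"
    and null: "\<And>x. dot S x (mat_app S M x) = 0 \<Longrightarrow> dot S x (mat_app S K x) = 0"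
  shows "\<exists>(D :: nat set) P mu. finite D \<and> (\<forall>r\<in>D. 0 \<le> mu r) \<and>
    (\<forall>r\<in>D. \<forall>t\<in>D. dot S (P r) (mat_app S M (P t)) = (if r = t then 1 else 0)) \<and>
    (\<forall>a\<in>S. \<forall>r\<in>D. mat_app S K (P r) a = mu r * mat_app S M (P r) a) \<and>
    (\<forall>a\<in>S. M a a = (\<Sum>r\<in>D. (mat_app S M (P r) a)\<^sup>2)) \<and>
    (\<forall>a\<in>S. K a a = (\<Sum>r\<in>D. mu r * (mat_app S M (P r) a)\<^sup>2))"
proof -
  obtain p m where p: "orthonormal_family S {..<card S} p"
    and mp: "\<And>k a. k < card S \<Longrightarrow> a \<in> S \<Longrightarrow> mat_app S M (p k) a = m k * p k a"
    using orthonormal_eigenvectors[where I = S and M = M and m = "card S", OF S symM] by blast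
  have pp: "dot S (p k) (p l) = (if k = l then 1 else 0)" if "k < card S" "l < card S" for k l
    using p that by (simp add: orthonormal_family_def)
  have dMp: "dot S x (mat_app S M (p k)) = m k * dot S x (p k)" if "k < card S" for x k
    unfolding dot_def sum_distrib_left by (intro sum.cong refl) (simp add: mp that)
  have m0: "m k \<ge> 0" if "k < card S" for k
    using psdM[of "p k"] that by (simp add: dMp pp)
  define D0 where "D0 = {k. k < card S \<and> m k > 0}"
  have D0: "finite D0" "D0 \<subseteq> {..<card S}" "\<And>k. k \<in> D0 \<Longrightarrow> k < card S" "\<And>k. k \<in> D0 \<Longrightarrow> m k > 0"
    by (auto simp: D0_def)
  have outside: "m k = 0" if "k < card S" "k \<notin> D0" for k
    using that m0[of k] by (auto simp: D0_def)
  have Kp0: "mat_app S K (p k) a = 0" if "k < card S" "k \<notin> D0" "a \<in> S" for k a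
    using psd_form_null_vector[where K = K and x = "p k", OF S symK psdK null] that by (simp add: dMp outside)
  \<comment> \<open>\<open>\<phi>\<close> is orthonormal with respect to \<open>M\<close>; \<open>K'\<close> is \<open>K\<close> in this basis and \<open>\<psi>\<close> diagonalizes it.\<close>
  define \<phi> where "\<phi> k = (\<lambda>a. (1 / sqrt (m k)) * p k a)" for k
  have p\<phi>: "p k = (\<lambda>a. sqrt (m k) * \<phi> k a)" if "k \<in> D0" for k
    using D0(4)[OF that] by (simp add: \<phi>_def)
  have M\<phi>: "mat_app S M (\<phi> k) a = sqrt (m k) * p k a" if "k \<in> D0" "a \<in> S" for k a
  proof -
    have "mat_app S M (\<phi> k) a = m k / sqrt (m k) * p k a"
      unfolding \<phi>_def mat_app_scale using D0(3)[OF that(1)] that(2) by (simp add: mp)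
    then show ?thesis using D0(4)[OF that(1)] by (simp add: real_div_sqrt)
  qed
  have \<phi>\<phi>: "dot S (\<phi> k) (mat_app S M (\<phi> l)) = (if k = l then 1 else 0)" if "k \<in> D0" "l \<in> D0" for k l
  proof -
    have "dot S (\<phi> k) (mat_app S M (\<phi> l)) = (1 / sqrt (m k)) * ((1 / sqrt (m l)) * (m l * dot S (p k) (p l)))"
      unfolding \<phi>_def mat_app_scale dot_linear using that by (simp add: dMp D0)
    moreover have "(1 / sqrt (m k)) * ((1 / sqrt (m k)) * m k) = 1"
      using D0(4)[OF that(1)] by simp
    ultimately show ?thesis using that by (auto simp: pp D0)
  qed
  define K' where "K' k l = dot S (\<phi> k) (mat_app S K (\<phi> l))" for k l
  have symK': "K' k l = K' l k" for k l
    unfolding K'_def using symK by (rule dot_mat_app_sym)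
  obtain q mu where q: "orthonormal_family D0 {..<card D0} q"
    and Kq: "\<And>r k. r < card D0 \<Longrightarrow> k \<in> D0 \<Longrightarrow> mat_app D0 K' (q r) k = mu r * q r k"
    using orthonormal_eigenvectors[where I = D0 and M = K' and m = "card D0", OF D0(1) symK'] by blast
  define \<psi> where "\<psi> r = (\<lambda>a. \<Sum>k\<in>D0. q r k * \<phi> k a)" for r
  define c where "c a = (\<lambda>k. sqrt (m k) * p k a)" for a
  have w: "mat_app S M (\<psi> r) a = dot D0 (c a) (q r)" if "a \<in> S" for r a
    unfolding \<psi>_def mat_app_sum mat_app_scale dot_def c_def
    by (intro sum.cong refl) (simp add: M\<phi> that)
  have ortho: "dot S (\<psi> r) (mat_app S M (\<psi> t)) = (if r = t then 1 else 0)"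
    if "r < card D0" "t < card D0" for r t
  proof -
    have "dot S (\<psi> r) (mat_app S M (\<psi> t))
        = (\<Sum>k\<in>D0. \<Sum>l\<in>D0. q r k * (q t l * dot S (\<phi> k) (mat_app S M (\<phi> l))))"
      unfolding \<psi>_def mat_app_sum mat_app_scale dot_sum_left dot_sum_right dot_linear sum_distrib_left
      by (intro sum.cong refl) (simp add: algebra_simps)
    also have "\<dots> = (\<Sum>k\<in>D0. \<Sum>l\<in>D0. if l = k then q r k * q t k else 0)"
      by (intro sum.cong refl) (auto simp: \<phi>\<phi>)
    also have "\<dots> = dot D0 (q r) (q t)" using D0(1) by (simp add: dot_def)
    also have "\<dots> = (if r = t then 1 else 0)" using q that by (simp add: orthonormal_family_def)
    finally show ?thesis .
  qed
  have expand: "mat_app S K x a = (\<Sum>k\<in>D0. p k a * (sqrt (m k) * dot S (\<phi> k) (mat_app S K x)))"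
    if "a \<in> S" for x a
  proof -
    have "mat_app S K x a = (\<Sum>k<card S. p k a * dot S (mat_app S K x) (p k))"
      by (rule orthonormal_basis_expansion[OF S p that])
    also have "\<dots> = (\<Sum>k\<in>D0. p k a * dot S (mat_app S K x) (p k))"
    proof (rule sum.mono_neutral_right)
      show "\<forall>k\<in>{..<card S} - D0. p k a * dot S (mat_app S K x) (p k) = 0"
      proof
        fix k assume k: "k \<in> {..<card S} - D0"
        have "dot S (mat_app S K x) (p k) = dot S x (mat_app S K (p k))"
          using dot_mat_app_sym[where I = S and M = K and x = "p k" and y = x, OF symK] by (simp add: dot_commute)
        also have "\<dots> = 0" using k by (simp add: dot_def Kp0)
        finally show "p k a * dot S (mat_app S K x) (p k) = 0" by simp
      qed
    qed (use D0 in auto)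
    also have "\<dots> = (\<Sum>k\<in>D0. p k a * (sqrt (m k) * dot S (\<phi> k) (mat_app S K x)))"
    proof (intro sum.cong refl)
      fix k assume "k \<in> D0"
      then have "dot S (mat_app S K x) (p k) = sqrt (m k) * dot S (\<phi> k) (mat_app S K x)"
        by (subst dot_commute, subst p\<phi>) (simp_all add: dot_linear)
      then show "p k a * dot S (mat_app S K x) (p k) = p k a * (sqrt (m k) * dot S (\<phi> k) (mat_app S K x))"
        by simp
    qed
    finally show ?thesis .
  qed
  have eig: "mat_app S K (\<psi> r) a = mu r * mat_app S M (\<psi> r) a" if "a \<in> S" "r < card D0" for a r
  proof -
    have "dot S (\<phi> k) (mat_app S K (\<psi> r)) = mu r * q r k" if "k \<in> D0" for k
    proof -
      have "dot S (\<phi> k) (mat_app S K (\<psi> r)) = mat_app D0 K' (q r) k"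
        unfolding \<psi>_def mat_app_sum mat_app_scale dot_sum_right dot_linear K'_def
        by (simp add: mat_app_def K'_def mult.commute)
      then show ?thesis using Kq \<open>r < card D0\<close> that by simp
    qed
    then have "mat_app S K (\<psi> r) a = (\<Sum>k\<in>D0. p k a * (sqrt (m k) * (mu r * q r k)))"
      unfolding expand[OF \<open>a \<in> S\<close>] by (intro sum.cong refl) simp
    also have "\<dots> = mu r * dot D0 (c a) (q r)"
      unfolding dot_def c_def sum_distrib_left by (intro sum.cong refl) (simp add: algebra_simps)
    finally show ?thesis using w[OF \<open>a \<in> S\<close>] by simp
  qed
  have massM: "M a a = (\<Sum>r<card D0. (mat_app S M (\<psi> r) a)\<^sup>2)" if a: "a \<in> S" for a
  proof -
    have "M a a = (\<Sum>k<card S. p k a * mat_app S M (p k) a)"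
      using orthonormal_basis_expansion[OF S p a, of "M a"] by (simp add: dot_def mat_app_def)
    also have "\<dots> = (\<Sum>k<card S. m k * (p k a)\<^sup>2)"
      by (intro sum.cong refl) (simp add: mp a power2_eq_square)
    also have "\<dots> = (\<Sum>k\<in>D0. m k * (p k a)\<^sup>2)"
      using D0 outside by (intro sum.mono_neutral_right) auto
    also have "\<dots> = dot D0 (c a) (c a)"
      unfolding dot_def c_def
    proof (intro sum.cong refl)
      fix k assume "k \<in> D0"
      then have "sqrt (m k) * sqrt (m k) = m k" using D0(4)[of k] by simp
      then show "m k * (p k a)\<^sup>2 = sqrt (m k) * p k a * (sqrt (m k) * p k a)"
        by (metis (no_types, lifting) mult.assoc mult.left_commute power2_eq_square)
    qed
    also have "\<dots> = (\<Sum>r<card D0. (dot D0 (c a) (q r))\<^sup>2)"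
      by (rule orthonormal_basis_parseval[OF D0(1) q, symmetric])
    finally show ?thesis by (simp add: w a)
  qed
  have stiffK: "K a a = (\<Sum>r<card D0. mu r * (mat_app S M (\<psi> r) a)\<^sup>2)" if a: "a \<in> S" for a
  proof -
    have \<phi>\<psi>: "\<phi> k a = (\<Sum>r<card D0. q r k * \<psi> r a)" if "k \<in> D0" for k a
      using orthonormal_basis_expansion[OF D0(1) q that, of "\<lambda>l. \<phi> l a"]
      by (simp add: \<psi>_def dot_def mult.commute)
    have K\<phi>: "mat_app S K (\<phi> k) a = (\<Sum>r<card D0. q r k * (mu r * dot D0 (c a) (q r)))" if "k \<in> D0" for k
    proof -
      have "mat_app S K (\<phi> k) a = (\<Sum>r<card D0. q r k * mat_app S K (\<psi> r) a)"
        by (subst \<phi>\<psi>[OF that, THEN ext]) (simp add: mat_app_sum mat_app_scale)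
      then show ?thesis by (simp add: eig a w)
    qed
    have "K a a = (\<Sum>k<card S. p k a * mat_app S K (p k) a)"
      using orthonormal_basis_expansion[OF S p a, of "K a"] by (simp add: dot_def mat_app_def)
    also have "\<dots> = (\<Sum>k\<in>D0. p k a * mat_app S K (p k) a)"
      using D0 Kp0 a by (intro sum.mono_neutral_right) auto
    also have "\<dots> = (\<Sum>k\<in>D0. c a k * (\<Sum>r<card D0. q r k * (mu r * dot D0 (c a) (q r))))"
    proof (intro sum.cong refl)
      fix k assume k: "k \<in> D0"
      have "mat_app S K (p k) a = sqrt (m k) * mat_app S K (\<phi> k) a"
        by (subst p\<phi>[OF k]) (simp add: mat_app_scale)
      then show "p k a * mat_app S K (p k) a = c a k * (\<Sum>r<card D0. q r k * (mu r * dot D0 (c a) (q r)))"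
        by (simp add: K\<phi>[OF k] c_def)
    qed
    also have "\<dots> = (\<Sum>r<card D0. mu r * dot D0 (c a) (q r) * (\<Sum>k\<in>D0. c a k * q r k))"
      unfolding sum_distrib_left by (subst sum.swap) (intro sum.cong refl, simp add: algebra_simps)
    also have "\<dots> = (\<Sum>r<card D0. mu r * (dot D0 (c a) (q r))\<^sup>2)"
      by (simp add: dot_def power2_eq_square mult.assoc)
    finally show ?thesis by (simp add: w a)
  qed
  have mu0: "0 \<le> mu r" if r: "r < card D0" for r
  proof -
    have "dot S (\<psi> r) (mat_app S K (\<psi> r)) = mu r * dot S (\<psi> r) (mat_app S M (\<psi> r))"
      unfolding dot_def sum_distrib_left by (intro sum.cong refl) (simp add: eig r)
    then show ?thesis using psdK[of "\<psi> r"] ortho[OF r r] by simp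
  qed
  show ?thesis
    by (rule exI[of _ "{..<card D0}"], rule exI[of _ \<psi>], rule exI[of _ mu])
       (use mu0 ortho eig massM stiffK in auto)
qed

section \<open>Positive definite and lower triangular matrices\<close>

definition mat_vec :: "nat \<Rightarrow> real mat \<Rightarrow> (nat \<Rightarrow> real) \<Rightarrow> (nat \<Rightarrow> real)" where
  "mat_vec n M = mat_app {..<n} (\<lambda>i j. M $$ (i, j))"

lemma mat_vec_cong:
  assumes "\<And>j. j < n \<Longrightarrow> x j = y j"
  shows "mat_vec n M x i = mat_vec n M y i"
  unfolding mat_vec_def mat_app_def by (intro sum.cong) (auto simp: assms)

lemma mat_vec_mult:
  assumes "M \<in> carrier_mat n n" "M' \<in> carrier_mat n n" "i < n"
  shows "mat_vec n (M * M') x i = mat_vec n M (mat_vec n M' x) i"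
proof -
  have "mat_vec n (M * M') x i = (\<Sum>j<n. (\<Sum>k<n. M $$ (i, k) * M' $$ (k, j)) * x j)"
    unfolding mat_vec_def mat_app_def using assms
    by (intro sum.cong) (auto simp: scalar_prod_def atLeast0LessThan)
  also have "\<dots> = (\<Sum>k<n. \<Sum>j<n. M $$ (i, k) * M' $$ (k, j) * x j)"
    unfolding sum_distrib_right by (rule sum.swap)
  also have "\<dots> = mat_vec n M (mat_vec n M' x) i"
    unfolding mat_vec_def mat_app_def sum_distrib_left by (simp add: mult.assoc)
  finally show ?thesis .
qed

lemma mat_vec_one: "i < n \<Longrightarrow> mat_vec n (1\<^sub>m n) x i = x i"
proof -
  assume i: "i < n"
  have "mat_vec n (1\<^sub>m n) x i = (\<Sum>j<n. if j = i then x i else 0)"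
    unfolding mat_vec_def mat_app_def using i by (intro sum.cong) auto
  then show ?thesis using i by simp
qed

lemma mat_vec_linear:
  shows "mat_vec n M (\<lambda>j. x j + y j) i = mat_vec n M x i + mat_vec n M y i"
    and "mat_vec n M (\<lambda>j. c * x j) i = c * mat_vec n M x i"
  unfolding mat_vec_def by (simp_all add: mat_app_add mat_app_scale)

lemma mat_vec_matrix_linear:
  assumes "M \<in> carrier_mat n n" "M' \<in> carrier_mat n n" "i < n"
  shows "mat_vec n (M + M') x i = mat_vec n M x i + mat_vec n M' x i"
    and "mat_vec n (M - M') x i = mat_vec n M x i - mat_vec n M' x i"
    and "mat_vec n (c \<cdot>\<^sub>m M) x i = c * mat_vec n M x i"
proof -
  show "mat_vec n (M + M') x i = mat_vec n M x i + mat_vec n M' x i"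
    unfolding mat_vec_def mat_app_def sum.distrib[symmetric] using assms
    by (intro sum.cong) (auto simp: algebra_simps)
  show "mat_vec n (M - M') x i = mat_vec n M x i - mat_vec n M' x i"
    unfolding mat_vec_def mat_app_def sum_subtractf[symmetric] using assms
    by (intro sum.cong) (auto simp: algebra_simps)
  show "mat_vec n (c \<cdot>\<^sub>m M) x i = c * mat_vec n M x i"
    unfolding mat_vec_def mat_app_def sum_distrib_left using assms
    by (intro sum.cong) (auto simp: algebra_simps)
qed

lemma pos_def_quadratic_pos:
  assumes M: "M \<in> carrier_mat n n" and pd: "pos_def M" and x: "\<exists>i<n. x i \<noteq> 0"
  shows "0 < dot {..<n} x (mat_vec n M x)"
proof -
  define v where "v = vec n x"
  have v: "v \<in> carrier_vec (dim_row M)" using M by (simp add: v_def)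
  moreover have "v \<noteq> 0\<^sub>v (dim_row M)"
  proof
    assume "v = 0\<^sub>v (dim_row M)"
    then have "v $ i = 0" if "i < n" for i using that M by simp
    then show False using x by (auto simp: v_def)
  qed
  ultimately have "0 < scalar_prod v (symm_part M *\<^sub>v v)" using pd by (simp add: pos_def_def)
  also have "scalar_prod v (symm_part M *\<^sub>v v)
      = (\<Sum>i<n. \<Sum>j<n. x i * ((M $$ (i, j) + M $$ (j, i)) / 2 * x j))"
  proof -
    have "(symm_part M *\<^sub>v v) $ i = (\<Sum>j<n. (M $$ (i, j) + M $$ (j, i)) / 2 * x j)" if "i < n" for i
    proof -
      have "(symm_part M *\<^sub>v v) $ i = scalar_prod (row (symm_part M) i) v"
        using that M by (simp add: symm_part_def)
      also have "\<dots> = (\<Sum>j<n. (M $$ (i, j) + M $$ (j, i)) / 2 * x j)"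
        unfolding scalar_prod_def using that M
        by (intro sum.cong) (auto simp: v_def symm_part_def)
      finally show ?thesis .
    qed
    moreover have "dim_vec (symm_part M *\<^sub>v v) = n" using M by (simp add: symm_part_def)
    ultimately show ?thesis
      by (simp add: scalar_prod_def atLeast0LessThan v_def sum_distrib_left)
  qed
  also have "\<dots> = (\<Sum>i<n. \<Sum>j<n. x i * (M $$ (i, j) * x j)) / 2 + (\<Sum>i<n. \<Sum>j<n. x i * (M $$ (j, i) * x j)) / 2"
    by (simp add: sum_divide_distrib flip: sum.distrib) (simp add: field_simps)
  also have "(\<Sum>i<n. \<Sum>j<n. x i * (M $$ (j, i) * x j)) = (\<Sum>i<n. \<Sum>j<n. x i * (M $$ (i, j) * x j))"
    by (subst sum.swap) (simp add: mult.left_commute mult.commute)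
  finally show ?thesis by (simp add: dot_def mat_vec_def mat_app_def sum_distrib_left)
qed

lemma pos_def_diag_pos:
  assumes M: "M \<in> carrier_mat n n" and pd: "pos_def M" and i: "i < n"
  shows "0 < M $$ (i, i)"
proof -
  let ?u = "\<lambda>j. if j = i then 1 else (0::real)"
  have "0 < dot {..<n} ?u (mat_vec n M ?u)"
    by (rule pos_def_quadratic_pos[OF M pd]) (use i in auto)
  also have "\<dots> = mat_vec n M ?u i"
    using dot_unit_right[of "{..<n}" i "mat_vec n M ?u"] i by (simp add: dot_commute)
  also have "\<dots> = M $$ (i, i)"
    using dot_unit_right[of "{..<n}" i "\<lambda>j. M $$ (i, j)"] i
    by (simp add: mat_vec_def mat_app_def dot_def)
  finally show ?thesis .
qed

text \<open>Positive definiteness self-improves to a uniform lower bound, because the form attains its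
  minimum on the compact unit sphere.\<close>

lemma pos_def_coercive:
  assumes M: "M \<in> carrier_mat n n" and pd: "pos_def M"
  shows "\<exists>h>0. \<forall>x. h * dot {..<n} x x \<le> dot {..<n} x (mat_vec n M x)"
proof (cases "n = 0")
  case True
  then show ?thesis by (intro exI[of _ 1]) (simp add: dot_def)
next
  case False
  let ?S = "{x. (\<forall>a. a \<notin> {..<n} \<longrightarrow> x a = 0) \<and> dot {..<n} x x = 1}"
  have "(\<lambda>j. if j = 0 then 1 else 0) \<in> ?S"
    using False dot_unit_right[of "{..<n}" 0] by auto
  then have ne: "?S \<noteq> {}" by (rule ex_in_conv[THEN iffD1, OF exI])
  have "continuous_on ?S (\<lambda>x. dot {..<n} x (mat_vec n M x))"
    unfolding mat_vec_def by (intro continuous_intros continuous_on_coordinate continuous_on_mat_app)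
  from continuous_attains_inf[OF compact_coordinate_sphere[OF finite_lessThan] ne this]
  obtain y where y: "y \<in> ?S" and my: "\<forall>x\<in>?S. dot {..<n} y (mat_vec n M y) \<le> dot {..<n} x (mat_vec n M x)"
    by (rule bexE)
  define h where "h = dot {..<n} y (mat_vec n M y)"
  have "\<exists>i<n. y i \<noteq> 0"
  proof (rule ccontr)
    assume "\<not> ?thesis"
    then have "dot {..<n} y y = 0" by (simp add: dot_def)
    then show False using y by simp
  qed
  then have h: "h > 0" unfolding h_def by (rule pos_def_quadratic_pos[OF M pd])
  have "h * dot {..<n} x x \<le> dot {..<n} x (mat_vec n M x)" for x
  proof (cases "dot {..<n} x x = 0")
    case True
    then have "\<And>i. i < n \<Longrightarrow> x i = 0" using dot_self_eq_0[of "{..<n}" x] by simp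
    then have "dot {..<n} x (mat_vec n M x) = 0" by (simp add: dot_def)
    then show ?thesis using True by simp
  next
    case False
    define r where "r = sqrt (dot {..<n} x x)"
    have r: "r > 0" "r * r = dot {..<n} x x"
      using False dot_self_nonneg[of "{..<n}" x] by (auto simp: r_def)
    define z where "z j = (if j < n then (1 / r) * x j else 0)" for j
    have zd: "dot {..<n} z w = dot {..<n} (\<lambda>b. (1 / r) * x b) w" for w
      unfolding dot_def z_def by (intro sum.cong) auto
    have zM: "mat_vec n M z = mat_vec n M (\<lambda>b. (1 / r) * x b)"
      by (rule ext, rule mat_vec_cong) (simp add: z_def)
    have "dot {..<n} z z = (1 / r) * ((1 / r) * dot {..<n} x x)"
      by (metis zd dot_commute dot_scale_left)
    then have "dot {..<n} z z = 1" using r(1) unfolding r(2)[symmetric] by simp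
    then have "z \<in> ?S" by (auto simp: z_def)
    then have "h \<le> dot {..<n} z (mat_vec n M z)" unfolding h_def by (rule my[rule_format])
    also have "\<dots> = (1 / r) * ((1 / r) * dot {..<n} x (mat_vec n M x))"
      unfolding zM zd unfolding mat_vec_def mat_app_scale dot_scale_left dot_scale_right ..
    finally have "h \<le> dot {..<n} x (mat_vec n M x) / (r * r)" by simp
    moreover have "r * r > 0" using r(1) by simp
    ultimately show ?thesis unfolding r(2) by (simp add: pos_le_divide_eq)
  qed
  then show ?thesis using h by blast
qed

text \<open>Forward substitution: the rows of \<open>X\<close> are determined one after the other from those of \<open>N * X\<close>.\<close>

lemma lower_triangular_left_cancel:
  assumes N: "N \<in> carrier_mat n n" "lower_triangular N" "\<And>i. i < n \<Longrightarrow> N $$ (i, i) \<noteq> 0"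
    and X: "X \<in> carrier_mat n n" and NX: "lower_triangular (N * X)"
  shows "lower_triangular X" and "i < n \<Longrightarrow> (N * X) $$ (i, i) = N $$ (i, i) * X $$ (i, i)"
proof -
  have prod: "(N * X) $$ (i, j) = (\<Sum>k<n. N $$ (i, k) * X $$ (k, j))" if "i < n" "j < n" for i j
    using N X that by (auto simp: scalar_prod_def atLeast0LessThan intro!: sum.cong)
  have split: "(N * X) $$ (i, j) = N $$ (i, i) * X $$ (i, j)"
    if "i < n" "j < n" "\<And>k. k < i \<Longrightarrow> X $$ (k, j) = 0" for i j
  proof -
    have "(N * X) $$ (i, j) = (\<Sum>k\<in>{i}. N $$ (i, k) * X $$ (k, j))"
      unfolding prod[OF that(1,2)]
    proof (rule sum.mono_neutral_right)
      show "\<forall>k\<in>{..<n} - {i}. N $$ (i, k) * X $$ (k, j) = 0"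
      proof
        fix k assume "k \<in> {..<n} - {i}"
        then consider "k < i" | "i < k" "k < n" by (metis DiffE lessThan_iff linorder_neqE_nat singletonI)
        then show "N $$ (i, k) * X $$ (k, j) = 0"
          using that N by cases (auto simp: lower_triangular_def)
      qed
    qed (use that in auto)
    then show ?thesis by simp
  qed
  have zero: "X $$ (i, j) = 0" if "i < j" "j < n" for i j
    using that
  proof (induction i rule: less_induct)
    case (less i)
    have "(N * X) $$ (i, j) = N $$ (i, i) * X $$ (i, j)"
      using less by (intro split) auto
    moreover have "(N * X) $$ (i, j) = 0"
      using NX less.prems N X by (auto simp: lower_triangular_def)
    ultimately show ?case using N(3)[of i] less.prems by simp
  qed
  then show "lower_triangular X" using X by (simp add: lower_triangular_def)
  show "i < n \<Longrightarrow> (N * X) $$ (i, i) = N $$ (i, i) * X $$ (i, i)"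
    using zero by (intro split) auto
qed

section \<open>The energy identity of a scalar step\<close>

text \<open>The error stages in one eigenmode of the Laplacian: \<open>\<mu>\<close> is the eigenvalue of \<open>-D\<close>, \<open>\<gamma>\<close> that of \<open>-G\<close>
  (1 for Allen--Cahn, \<open>\<mu>\<close> for Cahn--Hilliard), \<open>e i\<close> the coefficient of the \<open>i\<close>-th stage error and
  \<open>g j\<close> that of the difference of \<open>f\<close> at stage \<open>j - 1\<close>.\<close>

definition modal_stages ::
  "real mat \<Rightarrow> real mat \<Rightarrow> real \<Rightarrow> real \<Rightarrow> real \<Rightarrow> real \<Rightarrow> real \<Rightarrow> (nat \<Rightarrow> real) \<Rightarrow> (nat \<Rightarrow> real) \<Rightarrow> bool" where
  "modal_stages A Ah \<alpha> \<beta> \<tau> \<gamma> \<mu> g e \<longleftrightarrow> (\<forall>i\<in>{1..dim_row A}. e i = e 0 - \<tau> * \<gamma> *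
     ((\<Sum>j=1..i. A $$ (i - 1, j - 1) * (((1 + \<alpha>) * \<mu> + \<beta>) * e j)) +
      (\<Sum>j=1..i. Ah $$ (i - 1, j - 1) * (g j - (\<alpha> * \<mu> + \<beta>) * e (j - 1)))))"

locale stable_imex =
  fixes A Ah :: "real mat" and s :: nat and \<alpha> \<beta> L :: real
  assumes L_pos: "0 < L"
    and s_pos: "1 \<le> s"
    and A: "A \<in> carrier_mat s s" "lower_triangular A"
    and Ah: "Ah \<in> carrier_mat s s" "lower_triangular Ah" "invertible_mat Ah"
    and row_sums: "\<forall>i<s. (\<Sum>j<s. A $$ (i, j)) = (\<Sum>j<s. Ah $$ (i, j))"
    and pd: "pos_def (H0_mat Ah)" "pos_def (H1_mat L \<beta> A Ah)" "pos_def (H2_mat \<alpha> A Ah)"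
      "pos_def (Q_mat A Ah)"
begin

definition "B = inv_mat Ah"

definition "EL = lower_ones_mat s"

text \<open>The matrix \<open>P\<close> is the part that \<open>Q\<close> and \<open>H2\<close> share.\<close>

definition "P = B * A * EL"

lemma B_inverse: "Ah * B = 1\<^sub>m s" "B * Ah = 1\<^sub>m s" "B \<in> carrier_mat s s"
proof -
  obtain B' where B': "inverts_mat Ah B'" "inverts_mat B' Ah"
    using Ah(3) by (auto simp: invertible_mat_def)
  have "Ah * B' = 1\<^sub>m s" "B' * Ah = 1\<^sub>m (dim_row B')"
    using B' Ah(1) by (auto simp: inverts_mat_def)
  then have "B' \<in> carrier_mat s s"
    using Ah(1) by (metis carrier_matD(2) carrier_matI index_mult_mat(3) index_one_mat(3))
  then have "Ah \<in> Units (ring_mat TYPE(real) s ())"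
    using B' Ah(1) by (auto simp: Units_def ring_mat_def inverts_mat_def)
  then obtain X where X: "mat_inverse Ah = Some X"
    using mat_inverse(1)[OF Ah(1), where b = "()"] by (cases "mat_inverse Ah") auto
  show "Ah * B = 1\<^sub>m s" "B * Ah = 1\<^sub>m s" "B \<in> carrier_mat s s"
    using mat_inverse(2)[OF Ah(1) X] X by (auto simp: B_def)
qed

lemma EL: "EL \<in> carrier_mat s s" "\<And>i j. i < s \<Longrightarrow> j < s \<Longrightarrow> EL $$ (i, j) = (if j \<le> i then 1 else 0)"
  by (auto simp: EL_def lower_ones_mat_def)

lemma P: "P \<in> carrier_mat s s"
  using A(1) B_inverse(3) EL(1) by (simp add: P_def)

lemma H0_eq: "H0_mat Ah = B * EL" and H0: "H0_mat Ah \<in> carrier_mat s s"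
  using Ah(1) B_inverse(3) EL(1) by (auto simp: H0_mat_def B_def EL_def)

lemma Q_eq: "Q_mat A Ah = P - EL + 1\<^sub>m s" and Q: "Q_mat A Ah \<in> carrier_mat s s"
proof -
  have "(B * A - 1\<^sub>m s) * EL = P - EL"
    unfolding P_def using A(1) B_inverse(3) EL(1)
    by (subst minus_mult_distrib_mat[where n = s]) auto
  then show eq: "Q_mat A Ah = P - EL + 1\<^sub>m s"
    using A(1) by (simp add: Q_mat_def B_def[symmetric] EL_def[symmetric] Let_def)
  show "Q_mat A Ah \<in> carrier_mat s s"
    using P EL(1) by (simp add: eq)
qed

lemma H2_eq: "H2_mat \<alpha> A Ah = \<alpha> \<cdot>\<^sub>m Q_mat A Ah + (P - (1 / 2) \<cdot>\<^sub>m ones_mat s)"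
  and H2: "H2_mat \<alpha> A Ah \<in> carrier_mat s s"
proof -
  show eq: "H2_mat \<alpha> A Ah = \<alpha> \<cdot>\<^sub>m Q_mat A Ah + (P - (1 / 2) \<cdot>\<^sub>m ones_mat s)"
    using A(1) by (simp add: H2_mat_def H2_base_mat_def P_def B_def[symmetric] EL_def[symmetric] Let_def)
  show "H2_mat \<alpha> A Ah \<in> carrier_mat s s"
    unfolding eq by (intro add_carrier_mat minus_carrier_mat smult_carrier_mat) (simp add: ones_mat_def)
qed

lemma H1: "H1_mat L \<beta> A Ah \<in> carrier_mat s s"
  unfolding H1_mat_def using A(1) by (intro minus_carrier_mat smult_carrier_mat) simp

lemma Ah_diag_nonzero: "i < s \<Longrightarrow> Ah $$ (i, i) \<noteq> 0"
proof
  assume i: "i < s" and z: "Ah $$ (i, i) = 0"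
  have "det Ah = prod_list (diag_mat Ah)"
    using Ah by (intro det_lower_triangular) (auto simp: lower_triangular_def)
  also have "\<dots> = 0"
    using i z Ah(1) by (auto simp: prod_list_zero_iff diag_mat_def image_iff intro!: bexI[of _ i])
  finally have "det (Ah * B) = 0"
    using Ah(1) B_inverse(3) by (simp add: det_mult)
  then show False by (simp add: B_inverse(1))
qed

text \<open>All matrices involved are lower triangular, so their diagonals multiply.\<close>

lemma diagonal_entries:
  assumes i: "i < s"
  shows "0 < Ah $$ (i, i)" and "Ah $$ (i, i) * P $$ (i, i) = A $$ (i, i)"
    and "Q_mat A Ah $$ (i, i) = P $$ (i, i)"
proof -
  have "Ah * (B * EL) = EL"
    using Ah(1) B_inverse EL(1) by (simp flip: assoc_mult_mat[of _ s s _ s _ s])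
  then have AH: "Ah * H0_mat Ah = EL" by (simp add: H0_eq)
  have "lower_triangular EL" using EL by (auto simp: lower_triangular_def)
  then have "EL $$ (i, i) = Ah $$ (i, i) * H0_mat Ah $$ (i, i)"
    using lower_triangular_left_cancel(2)[OF Ah(1,2) Ah_diag_nonzero H0 _ i] AH by simp
  then have "Ah $$ (i, i) * H0_mat Ah $$ (i, i) = 1" using EL(2) i by simp
  moreover have "0 < H0_mat Ah $$ (i, i)" by (rule pos_def_diag_pos[OF H0 pd(1) i])
  ultimately show "0 < Ah $$ (i, i)"
    using zero_less_mult_pos2[of "Ah $$ (i, i)" "H0_mat Ah $$ (i, i)"] by simp
  have AP: "Ah * P = A * EL"
  proof -
    have "Ah * P = (Ah * B) * A * EL"
      unfolding P_def using Ah(1) B_inverse(3) A(1) EL(1)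
      by (simp add: assoc_mult_mat[of _ s s _ s _ s])
    then show ?thesis using A(1) by (simp add: B_inverse(1))
  qed
  have AEL: "(A * EL) $$ (k, j) = (\<Sum>l<s. A $$ (k, l) * EL $$ (l, j))" if "k < s" "j < s" for k j
    using A EL(1) that by (auto simp: scalar_prod_def atLeast0LessThan intro!: sum.cong)
  have "(A * EL) $$ (k, j) = 0" if "k < j" "j < s" for k j
  proof -
    have "A $$ (k, l) * EL $$ (l, j) = 0" if "l < s" for l
      using that \<open>k < j\<close> \<open>j < s\<close> A EL by (cases "l \<le> k") (auto simp: lower_triangular_def)
    then show ?thesis using that by (subst AEL) (auto intro!: sum.neutral simp del: mult_eq_0_iff)
  qed
  then have tri: "lower_triangular (A * EL)" using A EL by (auto simp: lower_triangular_def)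
  have "(A * EL) $$ (i, i) = (\<Sum>l\<in>{i}. A $$ (i, l) * EL $$ (l, i))"
    unfolding AEL[OF i i]
  proof (rule sum.mono_neutral_right)
    show "\<forall>l\<in>{..<s} - {i}. A $$ (i, l) * EL $$ (l, i) = 0"
    proof
      fix l assume "l \<in> {..<s} - {i}"
      then show "A $$ (i, l) * EL $$ (l, i) = 0"
        using i A EL by (cases "l < i") (auto simp: lower_triangular_def)
    qed
  qed (use i in auto)
  also have "\<dots> = A $$ (i, i)" using EL(2) i by simp
  finally show "Ah $$ (i, i) * P $$ (i, i) = A $$ (i, i)"
    using lower_triangular_left_cancel(2)[OF Ah(1,2) Ah_diag_nonzero P _ i] AP tri by simp
  show "Q_mat A Ah $$ (i, i) = P $$ (i, i)"
    using P EL i by (simp add: Q_eq)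
qed

lemma A_diag_pos: "i < s \<Longrightarrow> 0 < A $$ (i, i)"
  using diagonal_entries pos_def_diag_pos[OF Q pd(4)] by (metis mult_pos_pos)

lemma \<beta>_pos: "0 < \<beta>"
proof -
  have "0 < H1_mat L \<beta> A Ah $$ (0, 0)" by (rule pos_def_diag_pos[OF H1 pd(2)]) (use s_pos in simp)
  also have "\<dots> = \<beta> * Q_mat A Ah $$ (0, 0) - L / 2"
    using Q A(1) s_pos by (simp add: H1_mat_def)
  finally have "0 < \<beta> * Q_mat A Ah $$ (0, 0)" using L_pos by simp
  moreover have "0 < Q_mat A Ah $$ (0, 0)" by (rule pos_def_diag_pos[OF Q pd(4)]) (use s_pos in simp)
  ultimately show ?thesis by (simp add: zero_less_mult_iff)
qed

lemma \<alpha>_gt: "0 < 1 + \<alpha>"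
proof -
  have "0 < H2_mat \<alpha> A Ah $$ (0, 0)" by (rule pos_def_diag_pos[OF H2 pd(3)]) (use s_pos in simp)
  also have "\<dots> = \<alpha> * Q_mat A Ah $$ (0, 0) + (P $$ (0, 0) - 1 / 2)"
    using Q P s_pos by (simp add: H2_eq ones_mat_def)
  also have "\<dots> = (1 + \<alpha>) * Q_mat A Ah $$ (0, 0) - 1 / 2"
    using diagonal_entries(3)[of 0] s_pos by (simp add: algebra_simps)
  finally have "0 < (1 + \<alpha>) * Q_mat A Ah $$ (0, 0)" by simp
  moreover have "0 < Q_mat A Ah $$ (0, 0)" by (rule pos_def_diag_pos[OF Q pd(4)]) (use s_pos in simp)
  ultimately show ?thesis by (simp add: zero_less_mult_iff)
qed

lemma first_row: "Ah $$ (0, 0) = A $$ (0, 0)"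
proof -
  have "(\<Sum>j<s. M $$ (0, j)) = M $$ (0, 0)" if "M \<in> carrier_mat s s" "lower_triangular M" for M :: "real mat"
  proof -
    have "(\<Sum>j<s. M $$ (0, j)) = (\<Sum>j\<in>{0}. M $$ (0, j))"
      using that s_pos by (intro sum.mono_neutral_right) (auto simp: lower_triangular_def)
    then show ?thesis by simp
  qed
  from this[OF A] this[OF Ah(1,2)] show ?thesis using row_sums s_pos by simp
qed

lemma lower_sum_shift:
  assumes "M \<in> carrier_mat s s" "lower_triangular M" "i < s"
  shows "(\<Sum>j=1..Suc i. M $$ (i, j - 1) * f j) = mat_vec s M (\<lambda>j. f (Suc j)) i"
proof -
  have "(\<Sum>j=1..Suc i. M $$ (i, j - 1) * f j) = (\<Sum>j\<le>i. M $$ (i, j) * f (Suc j))"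
    by (rule sum.reindex_bij_witness[of _ Suc "\<lambda>j. j - 1"]) auto
  also have "\<dots> = (\<Sum>j<s. M $$ (i, j) * f (Suc j))"
    using assms by (intro sum.mono_neutral_left) (auto simp: lower_triangular_def)
  finally show ?thesis by (simp add: mat_vec_def mat_app_def)
qed

text \<open>Multiplication by the inverse of \<open>Ah\<close> turns the stage equations for the increments \<open>d\<close> into
  \<open>H0 d = - \<tau> \<gamma> (\<mu> (e 0 + P d) + g + (\<alpha> \<mu> + \<beta>) Q d)\<close>; the equal row sums are what makes \<open>e 0\<close> appear
  with the factor \<open>\<mu>\<close> alone. The pairing with \<open>d\<close> produces the difference of the squares of \<open>e s\<close> and
  \<open>e 0\<close>, because the increments add up to \<open>e s - e 0\<close>; the square of this sum is the contribution of
  the all-ones matrix that is subtracted in \<open>H2\<close>.\<close>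

lemma energy_identity:
  assumes st: "modal_stages A Ah \<alpha> \<beta> \<tau> \<gamma> \<mu> g e"
  defines "d \<equiv> \<lambda>k. e (Suc k) - e k"
  shows "dot {..<s} d (mat_vec s (H0_mat Ah) d) + \<tau> * \<gamma> *
    (\<mu> / 2 * ((e s)\<^sup>2 - (e 0)\<^sup>2) + \<mu> * dot {..<s} d (mat_vec s (H2_mat \<alpha> A Ah) d) +
     \<beta> * dot {..<s} d (mat_vec s (Q_mat A Ah) d) + (\<Sum>k<s. g (Suc k) * d k)) = 0"
proof -
  define E where "E = (\<lambda>k. e (Suc k))"
  define \<kappa> where "\<kappa> = \<alpha> * \<mu> + \<beta>"
  define W where "W = (\<lambda>k. g (Suc k) - \<kappa> * e k)"
  have ELd: "mat_vec s EL d i = e (Suc i) - e 0" if "i < s" for i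
  proof -
    have "mat_vec s EL d i = (\<Sum>j\<le>i. d j)"
      unfolding mat_vec_def mat_app_def using that EL by (intro sum.mono_neutral_cong_right) auto
    also have "\<dots> = e (Suc i) - e 0"
      unfolding d_def lessThan_Suc_atMost[symmetric] by (rule sum_lessThan_telescope)
    finally show ?thesis .
  qed
  have stage: "e (Suc i) - e 0 = - (\<tau> * \<gamma>) * ((\<mu> + \<kappa>) * mat_vec s A E i + mat_vec s Ah W i)" if "i < s" for i
  proof -
    have "e (Suc i) = e 0 - \<tau> * \<gamma> *
     ((\<Sum>j=1..Suc i. A $$ (i, j - 1) * (((1 + \<alpha>) * \<mu> + \<beta>) * e j)) +
      (\<Sum>j=1..Suc i. Ah $$ (i, j - 1) * (g j - (\<alpha> * \<mu> + \<beta>) * e (j - 1))))"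
      using bspec[OF st[unfolded modal_stages_def], of "Suc i"] that A(1) by simp
    also have "(\<Sum>j=1..Suc i. A $$ (i, j - 1) * (((1 + \<alpha>) * \<mu> + \<beta>) * e j)) = (\<mu> + \<kappa>) * mat_vec s A E i"
      unfolding lower_sum_shift[OF A that] mat_vec_linear E_def \<kappa>_def by (simp add: algebra_simps)
    also have "(\<Sum>j=1..Suc i. Ah $$ (i, j - 1) * (g j - (\<alpha> * \<mu> + \<beta>) * e (j - 1))) = mat_vec s Ah W i"
      unfolding lower_sum_shift[OF Ah(1,2) that] by (simp add: W_def \<kappa>_def)
    finally show ?thesis by simp
  qed
  have BAh: "mat_vec s B (mat_vec s Ah x) i = x i" if "i < s" for x i
    using mat_vec_mult[OF B_inverse(3) Ah(1) that, of x] that by (simp add: B_inverse(2) mat_vec_one)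
  have BA1: "mat_vec s B (mat_vec s A (\<lambda>_. c)) i = c" if "i < s" for c i
  proof -
    have "mat_vec s A (\<lambda>_. c) j = mat_vec s Ah (\<lambda>_. c) j" if "j < s" for j
      unfolding mat_vec_def mat_app_def using row_sums that by (simp flip: sum_distrib_right)
    then have "mat_vec s B (mat_vec s A (\<lambda>_. c)) i = mat_vec s B (mat_vec s Ah (\<lambda>_. c)) i"
      by (rule mat_vec_cong)
    then show ?thesis by (simp add: BAh that)
  qed
  have BAE: "mat_vec s B (mat_vec s A E) i = e 0 + mat_vec s P d i" if i: "i < s" for i
  proof -
    have "mat_vec s A E k = mat_vec s A (\<lambda>_. e 0) k + mat_vec s A (mat_vec s EL d) k" for k
    proof -
      have "mat_vec s A E k = mat_vec s A (\<lambda>j. e 0 + mat_vec s EL d j) k"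
        by (rule mat_vec_cong) (simp add: E_def ELd)
      then show ?thesis by (simp only: mat_vec_linear(1))
    qed
    then have fA: "mat_vec s A E = (\<lambda>k. mat_vec s A (\<lambda>_. e 0) k + mat_vec s A (mat_vec s EL d) k)" by blast
    have "mat_vec s B (mat_vec s A E) i
        = mat_vec s B (mat_vec s A (\<lambda>_. e 0)) i + mat_vec s B (mat_vec s A (mat_vec s EL d)) i"
      unfolding fA mat_vec_linear(1) ..
    also have "mat_vec s B (mat_vec s A (mat_vec s EL d)) i = mat_vec s P d i"
      unfolding P_def using mat_vec_mult[of "B * A" s EL i d] mat_vec_mult[of B s A i "mat_vec s EL d"]
        i A(1) B_inverse(3) EL(1) by (metis mult_carrier_mat)
    finally show ?thesis using BA1[OF i] by simp
  qed
  have Qd: "mat_vec s (Q_mat A Ah) d i = mat_vec s P d i - (e i - e 0)" if i: "i < s" for i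
  proof -
    have "mat_vec s (Q_mat A Ah) d i = mat_vec s P d i - mat_vec s EL d i + d i"
      unfolding Q_eq using i P EL(1) mat_vec_matrix_linear(1)[of "P - EL" s "1\<^sub>m s" i d]
        mat_vec_matrix_linear(2)[of P s EL i d] by (simp add: mat_vec_one minus_carrier_mat)
    then have "mat_vec s (Q_mat A Ah) d i = mat_vec s P d i - (e (Suc i) - e 0) + d i" by (simp add: ELd i)
    then show ?thesis by (simp add: d_def)
  qed
  have H0d: "mat_vec s (H0_mat Ah) d i = - (\<tau> * \<gamma>) *
      (\<mu> * (e 0 + mat_vec s P d i) + g (Suc i) + \<kappa> * mat_vec s (Q_mat A Ah) d i)" if i: "i < s" for i
  proof -
    have "mat_vec s (H0_mat Ah) d i = mat_vec s B (mat_vec s EL d) i"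
      unfolding H0_eq using i B_inverse(3) EL(1) by (rule mat_vec_mult[rotated -1])
    also have "\<dots> = mat_vec s B (\<lambda>k. (- (\<tau> * \<gamma>)) * ((\<mu> + \<kappa>) * mat_vec s A E k + mat_vec s Ah W k)) i"
      by (rule mat_vec_cong) (simp add: ELd stage)
    also have "\<dots> = - (\<tau> * \<gamma>) * ((\<mu> + \<kappa>) * (e 0 + mat_vec s P d i) + W i)"
      unfolding mat_vec_linear by (simp add: BAE BAh i)
    also have "\<dots> = - (\<tau> * \<gamma>) * (\<mu> * (e 0 + mat_vec s P d i) + g (Suc i) + \<kappa> * mat_vec s (Q_mat A Ah) d i)"
      unfolding Qd[OF i] W_def by (simp add: algebra_simps)
    finally show ?thesis .
  qed
  define S where "S = (\<Sum>k<s. d k)"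
  have S: "S = e s - e 0"
    unfolding S_def d_def by (rule sum_lessThan_telescope)
  have H2d: "dot {..<s} d (mat_vec s (H2_mat \<alpha> A Ah) d)
      = \<alpha> * dot {..<s} d (mat_vec s (Q_mat A Ah) d) + dot {..<s} d (mat_vec s P d) - S\<^sup>2 / 2"
  proof -
    have "mat_vec s (H2_mat \<alpha> A Ah) d i = \<alpha> * mat_vec s (Q_mat A Ah) d i + mat_vec s P d i - S / 2" if i: "i < s" for i
    proof -
      have ones: "ones_mat s \<in> carrier_mat s s" by (simp add: ones_mat_def)
      have "mat_vec s (ones_mat s) d i = S"
        unfolding mat_vec_def mat_app_def S_def using i by (intro sum.cong) (auto simp: ones_mat_def)
      then show ?thesis
        unfolding H2_eq using i Q P ones
          mat_vec_matrix_linear(1)[of "\<alpha> \<cdot>\<^sub>m Q_mat A Ah" s "P - (1 / 2) \<cdot>\<^sub>m ones_mat s" i d]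
          mat_vec_matrix_linear(2)[of P s "(1 / 2) \<cdot>\<^sub>m ones_mat s" i d]
          mat_vec_matrix_linear(3)[of "Q_mat A Ah" s P i \<alpha> d] mat_vec_matrix_linear(3)[of "ones_mat s" s P i "1 / 2" d]
        by (simp add: minus_carrier_mat)
    qed
    then have "dot {..<s} d (mat_vec s (H2_mat \<alpha> A Ah) d)
        = dot {..<s} d (\<lambda>i. \<alpha> * mat_vec s (Q_mat A Ah) d i + mat_vec s P d i - S / 2)"
      unfolding dot_def by (intro sum.cong) auto
    also have "\<dots> = \<alpha> * dot {..<s} d (mat_vec s (Q_mat A Ah) d) + dot {..<s} d (mat_vec s P d) - dot {..<s} d (\<lambda>_. S / 2)"
      unfolding dot_linear ..
    also have "dot {..<s} d (\<lambda>_. S / 2) = S\<^sup>2 / 2"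
      by (simp add: dot_def S_def power2_eq_square flip: sum_distrib_right sum_divide_distrib)
    finally show ?thesis .
  qed
  have "dot {..<s} d (mat_vec s (H0_mat Ah) d) = (\<Sum>i<s. - (\<tau> * \<gamma>) *
      (\<mu> * e 0 * d i + \<mu> * (d i * mat_vec s P d i) + g (Suc i) * d i + \<kappa> * (d i * mat_vec s (Q_mat A Ah) d i)))"
    unfolding dot_def by (intro sum.cong) (simp_all add: H0d algebra_simps)
  also have "\<dots> = - (\<tau> * \<gamma>) * (\<mu> * e 0 * S + \<mu> * dot {..<s} d (mat_vec s P d) + (\<Sum>k<s. g (Suc k) * d k)
      + \<kappa> * dot {..<s} d (mat_vec s (Q_mat A Ah) d))"
    unfolding dot_def S_def sum_distrib_left[symmetric] sum.distrib ..
  also have "\<mu> * e 0 * S + \<mu> * dot {..<s} d (mat_vec s P d) + (\<Sum>k<s. g (Suc k) * d k)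
      + \<kappa> * dot {..<s} d (mat_vec s (Q_mat A Ah) d)
    = \<mu> / 2 * ((e s)\<^sup>2 - (e 0)\<^sup>2) + \<mu> * dot {..<s} d (mat_vec s (H2_mat \<alpha> A Ah) d) +
     \<beta> * dot {..<s} d (mat_vec s (Q_mat A Ah) d) + (\<Sum>k<s. g (Suc k) * d k)"
    unfolding H2d S \<kappa>_def by (simp add: power2_eq_square algebra_simps) (simp add: field_simps)
  finally show ?thesis by simp
qed

lemma energy_estimate:
  "\<exists>h0>0. \<exists>h2>0. \<forall>\<tau> \<gamma> \<mu> g e. 0 \<le> \<tau> \<longrightarrow> 0 \<le> \<gamma> \<longrightarrow> 0 \<le> \<mu> \<longrightarrow> modal_stages A Ah \<alpha> \<beta> \<tau> \<gamma> \<mu> g e \<longrightarrow>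
    (h0 + \<tau> * \<gamma> * \<mu> * h2) * (\<Sum>k<s. (e (Suc k) - e k)\<^sup>2) + \<tau> * \<gamma> * \<mu> / 2 * ((e s)\<^sup>2 - (e 0)\<^sup>2)
      \<le> - (\<tau> * \<gamma> * (\<Sum>k<s. g (Suc k) * (e (Suc k) - e k)))"
proof -
  obtain h0 where h0: "h0 > 0" "\<And>x. h0 * dot {..<s} x x \<le> dot {..<s} x (mat_vec s (H0_mat Ah) x)"
    using pos_def_coercive[OF H0 pd(1)] by blast
  obtain h2 where h2: "h2 > 0" "\<And>x. h2 * dot {..<s} x x \<le> dot {..<s} x (mat_vec s (H2_mat \<alpha> A Ah) x)"
    using pos_def_coercive[OF H2 pd(3)] by blast
  obtain hq where hq: "hq > 0" "\<And>x. hq * dot {..<s} x x \<le> dot {..<s} x (mat_vec s (Q_mat A Ah) x)"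
    using pos_def_coercive[OF Q pd(4)] by blast
  have "(h0 + \<tau> * \<gamma> * \<mu> * h2) * (\<Sum>k<s. (e (Suc k) - e k)\<^sup>2) + \<tau> * \<gamma> * \<mu> / 2 * ((e s)\<^sup>2 - (e 0)\<^sup>2)
      \<le> - (\<tau> * \<gamma> * (\<Sum>k<s. g (Suc k) * (e (Suc k) - e k)))"
    if nn: "0 \<le> \<tau>" "0 \<le> \<gamma>" "0 \<le> \<mu>" and st: "modal_stages A Ah \<alpha> \<beta> \<tau> \<gamma> \<mu> g e" for \<tau> \<gamma> \<mu> g e
  proof -
    define d where "d = (\<lambda>k. e (Suc k) - e k)"
    have dd: "(\<Sum>k<s. (e (Suc k) - e k)\<^sup>2) = dot {..<s} d d"
      by (simp add: dot_def d_def power2_eq_square)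
    have q: "0 \<le> dot {..<s} d (mat_vec s (Q_mat A Ah) d)"
      using hq(2)[of d] hq(1) dot_self_nonneg[of "{..<s}" d] by (smt (verit) mult_nonneg_nonneg)
    have "h0 * dot {..<s} d d \<le> dot {..<s} d (mat_vec s (H0_mat Ah) d)" by (rule h0(2))
    moreover have "\<tau> * \<gamma> * \<mu> * (h2 * dot {..<s} d d) \<le> \<tau> * \<gamma> * \<mu> * dot {..<s} d (mat_vec s (H2_mat \<alpha> A Ah) d)"
      using nn by (intro mult_left_mono h2(2)) auto
    moreover have "0 \<le> \<tau> * \<gamma> * (\<beta> * dot {..<s} d (mat_vec s (Q_mat A Ah) d))"
      using nn q \<beta>_pos by simp
    moreover define G where "G = (\<Sum>k<s. g (Suc k) * d k)"
    moreover have "dot {..<s} d (mat_vec s (H0_mat Ah) d) + \<tau> * \<gamma> *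
      (\<mu> / 2 * ((e s)\<^sup>2 - (e 0)\<^sup>2) + \<mu> * dot {..<s} d (mat_vec s (H2_mat \<alpha> A Ah) d) +
       \<beta> * dot {..<s} d (mat_vec s (Q_mat A Ah) d) + G) = 0"
      using energy_identity[OF st] unfolding G_def by (simp only: d_def)
    ultimately have "(h0 + \<tau> * \<gamma> * \<mu> * h2) * dot {..<s} d d + \<tau> * \<gamma> * \<mu> / 2 * ((e s)\<^sup>2 - (e 0)\<^sup>2)
      \<le> - (\<tau> * \<gamma> * G)"
      by (simp add: algebra_simps)
    then show ?thesis
      unfolding dd G_def by (simp only: d_def)
  qed
  then show ?thesis using h0(1) h2(1) by blast
qed

end

section \<open>Bounds for a scalar step\<close>

lemma sum_abs_squared_le:
  fixes f :: "nat \<Rightarrow> real"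
  assumes "finite I"
  shows "(\<Sum>j\<in>I. \<bar>f j\<bar>)\<^sup>2 \<le> card I * (\<Sum>j\<in>I. (f j)\<^sup>2)"
  using sum_squared_le_sum_of_squares[of "\<lambda>j. \<bar>f j\<bar>" I] by (simp add: mult.commute)

context stable_imex
begin

lemma coefficient_bounds:
  "\<exists>a0>0. \<exists>M>0. (\<forall>i<s. a0 \<le> A $$ (i, i)) \<and>
    (\<forall>i<s. \<forall>j<s. \<bar>A $$ (i, j)\<bar> \<le> M \<and> \<bar>Ah $$ (i, j)\<bar> \<le> M)"
proof -
  define a0 where "a0 = Min ((\<lambda>i. A $$ (i, i)) ` {..<s})"
  define M where "M = 1 + (\<Sum>i<s. \<Sum>j<s. \<bar>A $$ (i, j)\<bar> + \<bar>Ah $$ (i, j)\<bar>)"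
  have ne: "{..<s} \<noteq> {}" using s_pos by (simp add: lessThan_empty_iff)
  have "a0 > 0" unfolding a0_def using A_diag_pos ne by (subst Min_gr_iff) auto
  moreover have "a0 \<le> A $$ (i, i)" if "i < s" for i
    unfolding a0_def using that by (intro Min_le) auto
  moreover have le: "\<bar>A $$ (i, j)\<bar> + \<bar>Ah $$ (i, j)\<bar> \<le> M" if "i < s" "j < s" for i j
  proof -
    have "\<bar>A $$ (i, j)\<bar> + \<bar>Ah $$ (i, j)\<bar> \<le> (\<Sum>j<s. \<bar>A $$ (i, j)\<bar> + \<bar>Ah $$ (i, j)\<bar>)"
      using that by (intro member_le_sum[where f = "\<lambda>j. \<bar>A $$ (i, j)\<bar> + \<bar>Ah $$ (i, j)\<bar>"]) auto
    also have "\<dots> \<le> (\<Sum>i<s. \<Sum>j<s. \<bar>A $$ (i, j)\<bar> + \<bar>Ah $$ (i, j)\<bar>)"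
      using that
      by (intro member_le_sum[where f = "\<lambda>i. \<Sum>j<s. \<bar>A $$ (i, j)\<bar> + \<bar>Ah $$ (i, j)\<bar>"]) (auto intro!: sum_nonneg)
    finally show ?thesis by (simp add: M_def)
  qed
  moreover have "M > 0" unfolding M_def by (intro add_pos_nonneg sum_nonneg) auto
  moreover have "\<bar>A $$ (i, j)\<bar> \<le> M \<and> \<bar>Ah $$ (i, j)\<bar> \<le> M" if "i < s" "j < s" for i j
    using le[OF that] by linarith
  ultimately show ?thesis by blast
qed

text \<open>The implicit term makes every single stage bounded by the earlier ones, uniformly in the time
  step and in the mode: the factors \<open>\<tau> \<gamma> (1 + \<mu>)\<close> of the explicit terms are divided by the same
  factor from the left-hand side.\<close>

lemma stage_bound:
  "\<exists>C>0. \<forall>\<tau> \<gamma> \<mu> g e i. 0 \<le> \<tau> \<longrightarrow> 0 \<le> \<gamma> \<longrightarrow> 0 \<le> \<mu> \<longrightarrow> modal_stages A Ah \<alpha> \<beta> \<tau> \<gamma> \<mu> g e \<longrightarrow>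
    1 \<le> i \<longrightarrow> i \<le> s \<longrightarrow> \<bar>e i\<bar> \<le> C * ((\<Sum>j<i. \<bar>e j\<bar>) + (\<Sum>j=1..i. \<bar>g j\<bar>) / (1 + \<mu>))"
proof -
  obtain a0 M where a0: "a0 > 0" "\<And>i. i < s \<Longrightarrow> a0 \<le> A $$ (i, i)" and M: "M > 0"
    "\<And>i j. i < s \<Longrightarrow> j < s \<Longrightarrow> \<bar>A $$ (i, j)\<bar> \<le> M" "\<And>i j. i < s \<Longrightarrow> j < s \<Longrightarrow> \<bar>Ah $$ (i, j)\<bar> \<le> M"
    using coefficient_bounds by blast
  define c1 where "c1 = min (1 + \<alpha>) \<beta>"
  define K where "K = 1 + 2 * \<bar>\<alpha>\<bar> + \<beta>"
  define c where "c = a0 * c1"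
  define E where "E = 2 * M * K + M"
  have c1: "c1 > 0" using \<alpha>_gt \<beta>_pos by (simp add: c1_def)
  have c: "c > 0" using a0(1) c1 by (simp add: c_def)
  have K: "K > 0" using \<beta>_pos by (simp add: K_def)
  have E: "E > 0" using M(1) K by (simp add: E_def add_pos_pos)
  have "\<bar>e i\<bar> \<le> (1 + E / c) * ((\<Sum>j<i. \<bar>e j\<bar>) + (\<Sum>j=1..i. \<bar>g j\<bar>) / (1 + \<mu>))"
    if nn: "0 \<le> \<tau>" "0 \<le> \<gamma>" "0 \<le> \<mu>" and st: "modal_stages A Ah \<alpha> \<beta> \<tau> \<gamma> \<mu> g e" and i: "1 \<le> i" "i \<le> s"
    for \<tau> \<gamma> \<mu> g e i
  proof -
    define lam where "lam = (1 + \<alpha>) * \<mu> + \<beta>"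
    define \<kappa> where "\<kappa> = \<alpha> * \<mu> + \<beta>"
    \<comment> \<open>\<open>x\<close> measures the stiffness of the mode. The explicit terms are at most \<open>E x T\<close>, the implicit
      factor on the left is at least \<open>1 + c x\<close>.\<close>
    define S where "S = (\<Sum>j<i. \<bar>e j\<bar>)"
    define G where "G = (\<Sum>j=1..i. \<bar>g j\<bar>)"
    define x where "x = \<tau> * \<gamma> * (1 + \<mu>)"
    define T where "T = S + G / (1 + \<mu>)"
    have x: "0 \<le> x" using nn by (simp add: x_def)
    have S: "0 \<le> S" "\<bar>e 0\<bar> \<le> S"
      unfolding S_def using i by (auto intro!: sum_nonneg member_le_sum[where f = "\<lambda>j. \<bar>e j\<bar>"])
    have G: "0 \<le> G" unfolding G_def by (intro sum_nonneg) auto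
    have T: "S \<le> T" "G \<le> T * (1 + \<mu>)" "0 \<le> T"
      using S G nn by (auto simp: T_def field_simps)
    have lam: "c1 * (1 + \<mu>) \<le> lam" "lam \<le> K * (1 + \<mu>)" "\<bar>\<kappa>\<bar> \<le> K * (1 + \<mu>)"
    proof -
      have "c1 * \<mu> \<le> (1 + \<alpha>) * \<mu>" "c1 \<le> \<beta>" using nn by (auto simp: c1_def intro!: mult_right_mono)
      then show "c1 * (1 + \<mu>) \<le> lam" by (simp add: lam_def algebra_simps)
      define b where "b = \<bar>\<alpha>\<bar> * \<mu>"
      have "\<bar>\<alpha> * \<mu>\<bar> = b" using nn by (simp add: b_def abs_mult)
      then have "\<alpha> * \<mu> \<le> b" "- (\<alpha> * \<mu>) \<le> b" by linarith+
      moreover have "0 \<le> \<beta> * \<mu>" "0 \<le> b" using nn \<beta>_pos by (auto simp: b_def)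
      moreover have "K * (1 + \<mu>) = 1 + \<mu> + 2 * \<bar>\<alpha>\<bar> + 2 * b + \<beta> + \<beta> * \<mu>"
        by (simp add: K_def b_def algebra_simps)
      moreover have "lam = \<mu> + \<alpha> * \<mu> + \<beta>" "\<kappa> = \<alpha> * \<mu> + \<beta>" by (auto simp: lam_def \<kappa>_def algebra_simps)
      ultimately show "lam \<le> K * (1 + \<mu>)" "\<bar>\<kappa>\<bar> \<le> K * (1 + \<mu>)"
        using nn \<beta>_pos by linarith+
    qed
    have lam0: "0 \<le> lam" using lam(1) c1 nn by (smt (verit) mult_nonneg_nonneg)
    obtain i' where i': "i = Suc i'" using i by (cases i) auto
    define R1 where "R1 = (\<Sum>j=1..i'. A $$ (i', j - 1) * (lam * e j))"
    define R2 where "R2 = (\<Sum>j=1..i. Ah $$ (i', j - 1) * (g j - \<kappa> * e (j - 1)))"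
    have "e i = e 0 - \<tau> * \<gamma> * ((\<Sum>j=1..i. A $$ (i', j - 1) * (lam * e j)) + R2)"
      using bspec[OF st[unfolded modal_stages_def], of i] i i' A(1)
      by (simp add: lam_def \<kappa>_def R2_def)
    also have "(\<Sum>j=1..i. A $$ (i', j - 1) * (lam * e j)) = R1 + A $$ (i', i') * (lam * e i)"
      unfolding i' R1_def by simp
    finally have eq: "(1 + \<tau> * \<gamma> * (A $$ (i', i') * lam)) * e i = e 0 - \<tau> * \<gamma> * (R1 + R2)"
      by (simp add: algebra_simps)
    have "\<bar>R1\<bar> \<le> (\<Sum>j=1..i'. M * (K * (1 + \<mu>)) * \<bar>e j\<bar>)"
      unfolding R1_def
    proof (intro order_trans[OF sum_abs] sum_mono)
      fix j assume j: "j \<in> {1..i'}"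
      have "\<bar>A $$ (i', j - 1) * (lam * e j)\<bar> = \<bar>A $$ (i', j - 1)\<bar> * (lam * \<bar>e j\<bar>)"
        using lam0 by (simp add: abs_mult)
      also have "\<dots> \<le> M * ((K * (1 + \<mu>)) * \<bar>e j\<bar>)"
        using j i i' lam lam0 M(1) by (intro mult_mono M(2)) auto
      finally show "\<bar>A $$ (i', j - 1) * (lam * e j)\<bar> \<le> M * (K * (1 + \<mu>)) * \<bar>e j\<bar>" by simp
    qed
    also have "\<dots> = M * (K * (1 + \<mu>)) * (\<Sum>j=1..i'. \<bar>e j\<bar>)" by (simp only: sum_distrib_left)
    also have "\<dots> \<le> M * (K * (1 + \<mu>)) * S"
      unfolding S_def i' using M(1) K nn by (intro mult_left_mono sum_mono2) auto
    finally have R1: "\<bar>R1\<bar> \<le> M * (K * (1 + \<mu>)) * S" .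
    have "\<bar>R2\<bar> \<le> (\<Sum>j=1..i. M * \<bar>g j\<bar> + M * (K * (1 + \<mu>)) * \<bar>e (j - 1)\<bar>)"
      unfolding R2_def
    proof (intro order_trans[OF sum_abs] sum_mono)
      fix j assume j: "j \<in> {1..i}"
      have "\<bar>g j - \<kappa> * e (j - 1)\<bar> \<le> \<bar>g j\<bar> + \<bar>\<kappa>\<bar> * \<bar>e (j - 1)\<bar>"
        using abs_triangle_ineq4[of "g j" "\<kappa> * e (j - 1)"] by (simp add: abs_mult)
      also have "\<dots> \<le> \<bar>g j\<bar> + (K * (1 + \<mu>)) * \<bar>e (j - 1)\<bar>"
        using lam(3) by (intro add_left_mono mult_right_mono) auto
      finally have "\<bar>Ah $$ (i', j - 1)\<bar> * \<bar>g j - \<kappa> * e (j - 1)\<bar>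
          \<le> M * (\<bar>g j\<bar> + (K * (1 + \<mu>)) * \<bar>e (j - 1)\<bar>)"
        using j i i' M(1) by (intro mult_mono M(3)) auto
      then show "\<bar>Ah $$ (i', j - 1) * (g j - \<kappa> * e (j - 1))\<bar>
          \<le> M * \<bar>g j\<bar> + M * (K * (1 + \<mu>)) * \<bar>e (j - 1)\<bar>"
        by (simp only: abs_mult distrib_left[of M] mult.assoc)
    qed
    also have "\<dots> = M * G + M * (K * (1 + \<mu>)) * (\<Sum>j=1..i. \<bar>e (j - 1)\<bar>)"
      by (simp only: sum.distrib sum_distrib_left[symmetric] G_def)
    also have "(\<Sum>j=1..i. \<bar>e (j - 1)\<bar>) = S"
      unfolding S_def by (rule sum.reindex_bij_witness[of _ Suc "\<lambda>j. j - 1"]) auto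
    finally have R2: "\<bar>R2\<bar> \<le> M * G + M * (K * (1 + \<mu>)) * S" .
    have "\<bar>R1 + R2\<bar> \<le> 2 * (M * (K * (1 + \<mu>)) * S) + M * G"
      using R1 R2 abs_triangle_ineq[of R1 R2] by linarith
    also have "\<dots> \<le> 2 * (M * (K * (1 + \<mu>)) * T) + M * (T * (1 + \<mu>))"
      using T M(1) K nn by (intro add_mono mult_left_mono) auto
    also have "\<dots> = E * T * (1 + \<mu>)" by (simp add: E_def algebra_simps)
    finally have R: "\<bar>R1 + R2\<bar> \<le> E * T * (1 + \<mu>)" .
    have "(1 + c * x) * \<bar>e i\<bar> \<le> (1 + \<tau> * \<gamma> * (A $$ (i', i') * lam)) * \<bar>e i\<bar>"
    proof (rule mult_right_mono)
      have "a0 * (c1 * (1 + \<mu>)) \<le> A $$ (i', i') * lam"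
        using a0 lam(1) i i' nn c1 less_imp_le[OF A_diag_pos] by (intro mult_mono) auto
      then have "\<tau> * \<gamma> * (a0 * (c1 * (1 + \<mu>))) \<le> \<tau> * \<gamma> * (A $$ (i', i') * lam)"
        using nn by (intro mult_left_mono) auto
      then show "1 + c * x \<le> 1 + \<tau> * \<gamma> * (A $$ (i', i') * lam)"
        by (simp add: c_def x_def mult_ac)
    qed simp
    also have "\<dots> = \<bar>e 0 - \<tau> * \<gamma> * (R1 + R2)\<bar>"
    proof -
      have "0 \<le> \<tau> * \<gamma> * (A $$ (i', i') * lam)"
        using nn lam0 less_imp_le[OF A_diag_pos, of i'] i i' by simp
      then show ?thesis unfolding eq[symmetric] abs_mult by simp
    qed
    also have "\<dots> \<le> \<bar>e 0\<bar> + \<tau> * \<gamma> * \<bar>R1 + R2\<bar>"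
      using abs_triangle_ineq4[of "e 0" "\<tau> * \<gamma> * (R1 + R2)"] nn by (simp add: abs_mult)
    also have "\<dots> \<le> T + \<tau> * \<gamma> * (E * T * (1 + \<mu>))"
      using S T R nn by (intro add_mono mult_left_mono) auto
    also have "\<dots> = T + E * x * T" by (simp add: x_def algebra_simps)
    also have "\<dots> \<le> (1 + c * x) * ((1 + E / c) * T)"
    proof -
      have "0 \<le> E / c * T" "0 \<le> c * x * T" using E c T x by auto
      moreover have "(1 + c * x) * ((1 + E / c) * T) = T + E * x * T + E / c * T + c * x * T"
        using c by (simp add: field_simps)
      ultimately show ?thesis by linarith
    qed
    finally have "(1 + c * x) * \<bar>e i\<bar> \<le> (1 + c * x) * ((1 + E / c) * T)" .
    moreover have "0 < 1 + c * x" using c x by (simp add: add_pos_nonneg)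
    ultimately show ?thesis unfolding T_def S_def G_def by (simp only: mult_le_cancel_left_pos)
  qed
  moreover have "1 + E / c > 0" using E c by (simp add: add_pos_pos)
  ultimately show ?thesis by blast
qed

lemma stage_bound_squared:
  "\<exists>C>0. \<forall>\<tau> \<gamma> \<mu> g e i. 0 \<le> \<tau> \<longrightarrow> 0 \<le> \<gamma> \<longrightarrow> 0 \<le> \<mu> \<longrightarrow> modal_stages A Ah \<alpha> \<beta> \<tau> \<gamma> \<mu> g e \<longrightarrow>
    1 \<le> i \<longrightarrow> i \<le> s \<longrightarrow> (e i)\<^sup>2 \<le> C * ((\<Sum>j<i. (e j)\<^sup>2) + (\<Sum>j=1..i. (g j)\<^sup>2) / (1 + \<mu>))"
proof -
  obtain C where C: "C > 0" and bound: "\<And>\<tau> \<gamma> \<mu> g e i. 0 \<le> \<tau> \<Longrightarrow> 0 \<le> \<gamma> \<Longrightarrow> 0 \<le> \<mu> \<Longrightarrow>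
    modal_stages A Ah \<alpha> \<beta> \<tau> \<gamma> \<mu> g e \<Longrightarrow> 1 \<le> i \<Longrightarrow> i \<le> s \<Longrightarrow>
    \<bar>e i\<bar> \<le> C * ((\<Sum>j<i. \<bar>e j\<bar>) + (\<Sum>j=1..i. \<bar>g j\<bar>) / (1 + \<mu>))"
    using stage_bound by blast
  have "(e i)\<^sup>2 \<le> C\<^sup>2 * (2 * s) * ((\<Sum>j<i. (e j)\<^sup>2) + (\<Sum>j=1..i. (g j)\<^sup>2) / (1 + \<mu>))"
    if nn: "0 \<le> \<tau>" "0 \<le> \<gamma>" "0 \<le> \<mu>" and st: "modal_stages A Ah \<alpha> \<beta> \<tau> \<gamma> \<mu> g e" and i: "1 \<le> i" "i \<le> s"
    for \<tau> \<gamma> \<mu> g e i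
  proof -
    define S where "S = (\<Sum>j<i. \<bar>e j\<bar>)"
    define G where "G = (\<Sum>j=1..i. \<bar>g j\<bar>) / (1 + \<mu>)"
    define S2 where "S2 = (\<Sum>j<i. (e j)\<^sup>2)"
    define G2 where "G2 = (\<Sum>j=1..i. (g j)\<^sup>2)"
    have nn2: "0 \<le> S2" "0 \<le> G2" by (auto simp: S2_def G2_def intro!: sum_nonneg)
    have "S\<^sup>2 \<le> i * S2" unfolding S_def S2_def using sum_abs_squared_le[of "{..<i}" e] by simp
    also have "\<dots> \<le> s * S2" using i nn2 by (intro mult_right_mono) auto
    finally have S: "S\<^sup>2 \<le> s * S2" .
    have "G\<^sup>2 = (\<Sum>j=1..i. \<bar>g j\<bar>)\<^sup>2 / (1 + \<mu>)\<^sup>2" by (simp add: G_def power_divide)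
    also have "\<dots> \<le> (i * G2) / (1 + \<mu>)\<^sup>2"
      unfolding G2_def using sum_abs_squared_le[of "{1..i}" g] by (intro divide_right_mono) auto
    also have "\<dots> \<le> (s * G2) / (1 + \<mu>)"
    proof (rule frac_le)
      show "real i * G2 \<le> real s * G2" using i nn2 by (intro mult_right_mono) auto
      show "1 + \<mu> \<le> (1 + \<mu>)\<^sup>2" using nn by (simp add: power2_eq_square algebra_simps)
    qed (use nn nn2 in auto)
    finally have G: "G\<^sup>2 \<le> s * (G2 / (1 + \<mu>))" by simp
    have "(e i)\<^sup>2 = \<bar>e i\<bar>\<^sup>2" by simp
    also have "\<dots> \<le> (C * (S + G))\<^sup>2"
      using bound[OF nn st i] by (intro power_mono) (auto simp: S_def G_def)
    also have "\<dots> = C\<^sup>2 * (S + G)\<^sup>2" by (simp add: power_mult_distrib)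
    also have "(S + G)\<^sup>2 \<le> 2 * S\<^sup>2 + 2 * G\<^sup>2"
      using zero_le_power2[of "S - G"] by (simp add: power2_eq_square algebra_simps)
    also have "\<dots> \<le> 2 * (s * S2) + 2 * (s * (G2 / (1 + \<mu>)))" using S G by (intro add_mono mult_left_mono) auto
    also have "\<dots> = (2 * s) * (S2 + G2 / (1 + \<mu>))" by (simp add: distrib_left)
    finally show ?thesis using C by (simp add: S2_def G2_def mult.assoc)
  qed
  moreover have "C\<^sup>2 * (2 * s) > 0" using C s_pos by simp
  ultimately show ?thesis by blast
qed

end

lemma partial_sums_growth:
  fixes a :: "nat \<Rightarrow> real"
  assumes "\<And>i. 1 \<le> i \<Longrightarrow> i \<le> n \<Longrightarrow> a i \<le> K * (\<Sum>j<i. a j)" and "0 \<le> K" and "i \<le> n"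
  shows "(\<Sum>j\<le>i. a j) \<le> (1 + K) ^ i * a 0"
  using \<open>i \<le> n\<close>
proof (induction i)
  case 0
  then show ?case by simp
next
  case (Suc i)
  have "(\<Sum>j\<le>Suc i. a j) \<le> (\<Sum>j\<le>i. a j) + K * (\<Sum>j\<le>i. a j)"
    using assms(1)[of "Suc i"] Suc.prems by (simp add: lessThan_Suc_atMost)
  also have "\<dots> = (1 + K) * (\<Sum>j\<le>i. a j)" by (simp add: algebra_simps)
  also have "\<dots> \<le> (1 + K) * ((1 + K) ^ i * a 0)"
    using Suc assms(2) by (intro mult_left_mono) auto
  finally show ?case by simp
qed

lemma young_sum:
  fixes x y :: "nat \<Rightarrow> real"
  assumes c: "0 < c"
  shows "- (\<Sum>k<n. x k * y k) \<le> (\<Sum>k<n. (x k)\<^sup>2) / (2 * c) + c / 2 * (\<Sum>k<n. (y k)\<^sup>2)"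
proof -
  have "- (x k * y k) \<le> (x k)\<^sup>2 / (2 * c) + c / 2 * (y k)\<^sup>2" for k
  proof -
    have "0 \<le> (x k + c * y k)\<^sup>2 / (2 * c)" using c by simp
    also have "\<dots> = (x k)\<^sup>2 / (2 * c) + x k * y k + c / 2 * (y k)\<^sup>2"
      using c by (simp add: power2_eq_square field_simps)
    finally show ?thesis by simp
  qed
  then have "(\<Sum>k<n. - (x k * y k)) \<le> (\<Sum>k<n. (x k)\<^sup>2 / (2 * c) + c / 2 * (y k)\<^sup>2)" by (intro sum_mono)
  then show ?thesis by (simp add: sum_negf sum.distrib sum_divide_distrib sum_distrib_left)
qed

lemma square_add_le:
  fixes a b t :: real
  assumes "0 < t" "t \<le> 1"
  shows "(a + b)\<^sup>2 \<le> (1 + t) * a\<^sup>2 + 2 / t * b\<^sup>2"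
proof -
  have "0 \<le> (t * a - b)\<^sup>2 / t" using assms by simp
  also have "(t * a - b)\<^sup>2 / t = t * a\<^sup>2 - 2 * a * b + b\<^sup>2 / t"
    using assms by (simp add: power2_eq_square field_simps)
  finally have "2 * a * b \<le> t * a\<^sup>2 + b\<^sup>2 / t" by simp
  moreover have "b\<^sup>2 \<le> b\<^sup>2 / t" using assms by (simp add: le_divide_eq mult_left_le)
  moreover have "2 / t * b\<^sup>2 = b\<^sup>2 / t + b\<^sup>2 / t" by simp
  moreover have "(a + b)\<^sup>2 = a\<^sup>2 + 2 * a * b + b\<^sup>2" by (rule power2_sum[THEN trans]) simp
  moreover have "(1 + t) * a\<^sup>2 = a\<^sup>2 + t * a\<^sup>2" by (simp add: distrib_right)
  ultimately show ?thesis by linarith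
qed

context stable_imex
begin

text \<open>The energy identity controls the gradient part \<open>\<mu> (e s)\<^sup>2\<close>. The mass part follows from the triangle
  inequality, whose cost of order \<open>1 / \<tau>\<close> times the squared increments is covered by the \<open>H0\<close> term.
  This fixes the weight \<open>\<kappa>\<close> of the mass part.\<close>

lemma allen_cahn_step:
  "\<exists>\<kappa>>0. \<exists>C>0. \<forall>\<tau> \<mu> g e. 0 < \<tau> \<longrightarrow> \<tau> \<le> 1 \<longrightarrow> 0 \<le> \<mu> \<longrightarrow> modal_stages A Ah \<alpha> \<beta> \<tau> 1 \<mu> g e \<longrightarrow>
    (\<mu> + \<kappa>) * (e s)\<^sup>2 \<le> (1 + \<tau>) * ((\<mu> + \<kappa>) * (e 0)\<^sup>2) + C * \<tau> * (\<Sum>k<s. (g (Suc k))\<^sup>2)"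
proof -
  obtain h0 h2 where h0: "h0 > 0" and h2: "h2 > 0" and
    energy: "\<And>\<tau> \<gamma> \<mu> g e. 0 \<le> \<tau> \<Longrightarrow> 0 \<le> \<gamma> \<Longrightarrow> 0 \<le> \<mu> \<Longrightarrow> modal_stages A Ah \<alpha> \<beta> \<tau> \<gamma> \<mu> g e \<Longrightarrow>
    (h0 + \<tau> * \<gamma> * \<mu> * h2) * (\<Sum>k<s. (e (Suc k) - e k)\<^sup>2) + \<tau> * \<gamma> * \<mu> / 2 * ((e s)\<^sup>2 - (e 0)\<^sup>2)
      \<le> - (\<tau> * \<gamma> * (\<Sum>k<s. g (Suc k) * (e (Suc k) - e k)))"
    using energy_estimate by blast
  define \<kappa> where "\<kappa> = h0 / (2 * s)"
  have \<kappa>: "\<kappa> > 0" using h0 s_pos by (simp add: \<kappa>_def)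
  have "(\<mu> + \<kappa>) * (e s)\<^sup>2 \<le> (1 + \<tau>) * ((\<mu> + \<kappa>) * (e 0)\<^sup>2) + 1 / h0 * \<tau> * (\<Sum>k<s. (g (Suc k))\<^sup>2)"
    if \<tau>: "0 < \<tau>" "\<tau> \<le> 1" and \<mu>: "0 \<le> \<mu>" and st: "modal_stages A Ah \<alpha> \<beta> \<tau> 1 \<mu> g e" for \<tau> \<mu> g e
  proof -
    define d where "d = (\<lambda>k. e (Suc k) - e k)"
    define D where "D = (\<Sum>k<s. (d k)\<^sup>2)"
    define G where "G = (\<Sum>k<s. (g (Suc k))\<^sup>2)"
    have D: "0 \<le> D" by (auto simp: D_def intro!: sum_nonneg)
    have "(h0 + \<tau> * \<mu> * h2) * D + \<tau> * \<mu> / 2 * ((e s)\<^sup>2 - (e 0)\<^sup>2) \<le> \<tau> * (- (\<Sum>k<s. g (Suc k) * d k))"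
      using energy[of \<tau> 1 \<mu> g e] \<tau> \<mu> st by (simp add: D_def d_def)
    also have "\<dots> \<le> \<tau> * (G / (2 * (h0 / \<tau>)) + h0 / \<tau> / 2 * D)"
      unfolding G_def D_def using \<tau> h0 by (intro mult_left_mono young_sum) auto
    also have "\<dots> = \<tau>\<^sup>2 * G / (2 * h0) + h0 / 2 * D"
      using \<tau> h0 by (simp add: power2_eq_square field_simps)
    finally have "(h0 / 2 + \<tau> * \<mu> * h2) * D + \<tau> * \<mu> / 2 * ((e s)\<^sup>2 - (e 0)\<^sup>2) \<le> \<tau>\<^sup>2 * G / (2 * h0)"
      by (simp add: algebra_simps)
    moreover have "0 \<le> \<tau> * \<mu> * h2 * D" using \<tau> \<mu> h2 D by simp
    ultimately have "h0 / 2 * D + \<tau> * \<mu> / 2 * ((e s)\<^sup>2 - (e 0)\<^sup>2) \<le> \<tau>\<^sup>2 * G / (2 * h0)"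
      by (simp add: algebra_simps)
    then have "2 / \<tau> * (h0 / 2 * D + \<tau> * \<mu> / 2 * ((e s)\<^sup>2 - (e 0)\<^sup>2)) \<le> 2 / \<tau> * (\<tau>\<^sup>2 * G / (2 * h0))"
      using \<tau> by (intro mult_left_mono) auto
    then have grad: "h0 / \<tau> * D + \<mu> * ((e s)\<^sup>2 - (e 0)\<^sup>2) \<le> 1 / h0 * \<tau> * G"
      using \<tau> h0 by (simp add: power2_eq_square field_simps)
    have "e s = e 0 + (\<Sum>k<s. d k)"
      unfolding d_def sum_lessThan_telescope by simp
    then have "(e s)\<^sup>2 \<le> (1 + \<tau>) * (e 0)\<^sup>2 + 2 / \<tau> * (\<Sum>k<s. d k)\<^sup>2"
      using square_add_le[OF \<tau>] by simp
    moreover have "2 / \<tau> * (\<Sum>k<s. d k)\<^sup>2 \<le> 2 / \<tau> * (s * D)"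
      unfolding D_def using sum_squared_le_sum_of_squares[of d "{..<s}"] \<tau>
      by (intro mult_left_mono) (simp_all add: mult.commute)
    ultimately have "(e s)\<^sup>2 \<le> (1 + \<tau>) * (e 0)\<^sup>2 + 2 / \<tau> * (s * D)" by linarith
    then have "\<kappa> * (e s)\<^sup>2 \<le> \<kappa> * ((1 + \<tau>) * (e 0)\<^sup>2 + 2 / \<tau> * (s * D))"
      using \<kappa> by (intro mult_left_mono) auto
    also have "\<dots> = (1 + \<tau>) * (\<kappa> * (e 0)\<^sup>2) + h0 / \<tau> * D"
      using s_pos \<tau> by (simp add: \<kappa>_def field_simps)
    finally have mass: "\<kappa> * (e s)\<^sup>2 \<le> (1 + \<tau>) * (\<kappa> * (e 0)\<^sup>2) + h0 / \<tau> * D" .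
    have "0 \<le> \<tau> * (\<mu> * (e 0)\<^sup>2)" using \<tau> \<mu> by simp
    then show ?thesis using grad mass unfolding G_def by (simp add: algebra_simps)
  qed
  then show ?thesis using \<kappa> h0 by (metis zero_less_divide_1_iff)
qed

text \<open>With \<open>z = \<tau> \<mu>\<^sup>2\<close> the energy identity, divided by \<open>z\<close>, bounds \<open>(e s)\<^sup>2\<close> by \<open>(e 0)\<^sup>2\<close> minus a
  multiple of the squared increments. These cannot be small: the first stage alone forces the first
  increment to be at least of the order \<open>z / (1 + z)\<close> times \<open>e 0\<close>, up to the source. So every step
  damps a mode by a fixed fraction of \<open>z / (1 + z)\<close>, and the source is weakened by \<open>1 / (1 + z)\<close>.\<close>

lemma cahn_hilliard_step:
  "\<exists>c>0. c \<le> 1 / 2 \<and> (\<exists>C>0. \<forall>\<tau> \<mu> g e. 0 < \<tau> \<longrightarrow> \<tau> \<le> 1 \<longrightarrow> 0 \<le> \<mu> \<longrightarrow> modal_stages A Ah \<alpha> \<beta> \<tau> \<mu> \<mu> g e \<longrightarrow>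
    (e s)\<^sup>2 \<le> (1 - c * (\<tau> * \<mu>\<^sup>2 / (1 + \<tau> * \<mu>\<^sup>2))) * (e 0)\<^sup>2
      + C * \<tau> * (\<Sum>k<s. (g (Suc k))\<^sup>2) / (1 + \<tau> * \<mu>\<^sup>2))"
proof -
  obtain h0 h2 where h0: "h0 > 0" and h2: "h2 > 0" and
    energy: "\<And>\<tau> \<gamma> \<mu> g e. 0 \<le> \<tau> \<Longrightarrow> 0 \<le> \<gamma> \<Longrightarrow> 0 \<le> \<mu> \<Longrightarrow> modal_stages A Ah \<alpha> \<beta> \<tau> \<gamma> \<mu> g e \<Longrightarrow>
    (h0 + \<tau> * \<gamma> * \<mu> * h2) * (\<Sum>k<s. (e (Suc k) - e k)\<^sup>2) + \<tau> * \<gamma> * \<mu> / 2 * ((e s)\<^sup>2 - (e 0)\<^sup>2)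
      \<le> - (\<tau> * \<gamma> * (\<Sum>k<s. g (Suc k) * (e (Suc k) - e k)))"
    using energy_estimate by blast
  define h where "h = min h0 h2"
  have h: "h > 0" "h \<le> h0" "h \<le> h2" using h0 h2 by (auto simp: h_def)
  define a where "a = A $$ (0, 0)"
  have a: "a > 0" unfolding a_def using A_diag_pos s_pos by simp
  define K where "K = 1 + \<bar>\<alpha>\<bar> + \<beta>"
  have K: "K > 0" using \<beta>_pos by (simp add: K_def)
  define C1 where "C1 = 1 + 2 * a * K"
  have C1: "C1 > 0" using a K by (simp add: C1_def add_pos_pos)
  define c where "c = min (1 / 2) (h * a\<^sup>2 / (2 * C1\<^sup>2))"
  have c: "c > 0" "c \<le> 1 / 2" "c \<le> h * a\<^sup>2 / (2 * C1\<^sup>2)" using h a C1 by (auto simp: c_def)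
  define C where "C = 1 / h + h * a\<^sup>2 / C1\<^sup>2"
  have C: "C > 0" using h a C1 by (simp add: C_def add_pos_pos)
  have "(e s)\<^sup>2 \<le> (1 - c * (\<tau> * \<mu>\<^sup>2 / (1 + \<tau> * \<mu>\<^sup>2))) * (e 0)\<^sup>2
      + C * \<tau> * (\<Sum>k<s. (g (Suc k))\<^sup>2) / (1 + \<tau> * \<mu>\<^sup>2)"
    if \<tau>: "0 < \<tau>" "\<tau> \<le> 1" and \<mu>: "0 \<le> \<mu>" and st: "modal_stages A Ah \<alpha> \<beta> \<tau> \<mu> \<mu> g e" for \<tau> \<mu> g e
  proof (cases "\<mu> = 0")
    case True
    have "e s = e 0"
      using bspec[OF st[unfolded modal_stages_def], of s] s_pos A(1) True by simp
    moreover have "0 \<le> C * \<tau> * (\<Sum>k<s. (g (Suc k))\<^sup>2)" using C \<tau> by (intro mult_nonneg_nonneg sum_nonneg) auto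
    ultimately show ?thesis using True by simp
  next
    case False
    define d where "d = (\<lambda>k. e (Suc k) - e k)"
    define D where "D = (\<Sum>k<s. (d k)\<^sup>2)"
    define G where "G = (\<Sum>k<s. (g (Suc k))\<^sup>2)"
    define z where "z = \<tau> * \<mu>\<^sup>2"
    have z: "z > 0" using \<tau> \<mu> False by (simp add: z_def)
    have D: "0 \<le> D" "(d 0)\<^sup>2 \<le> D" unfolding D_def using s_pos
      by (auto intro!: sum_nonneg member_le_sum[where f = "\<lambda>k. (d k)\<^sup>2"])
    have G: "0 \<le> G" "(g 1)\<^sup>2 \<le> G" unfolding G_def using s_pos
      by (auto intro!: sum_nonneg member_le_sum[where f = "\<lambda>k. (g (Suc k))\<^sup>2" and i = 0, simplified])
    have t\<mu>: "\<tau> * \<mu> \<le> 1 + z"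
    proof -
      have "\<mu> \<le> 1 + \<mu>\<^sup>2"
      proof (cases "\<mu> \<le> 1")
        case False
        then have "\<mu> * 1 \<le> \<mu> * \<mu>" by (intro mult_left_mono) auto
        then show ?thesis by (simp add: power2_eq_square)
      qed (use zero_le_power2[of \<mu>] in linarith)
      then have "\<tau> * \<mu> \<le> \<tau> * (1 + \<mu>\<^sup>2)" using \<tau> by (intro mult_left_mono) auto
      also have "\<dots> = \<tau> + z" by (simp add: z_def algebra_simps)
      finally show ?thesis using \<tau> by linarith
    qed
    have "(h0 + z * h2) * D + z / 2 * ((e s)\<^sup>2 - (e 0)\<^sup>2) \<le> \<tau> * \<mu> * (- (\<Sum>k<s. g (Suc k) * d k))"
      using energy[of \<tau> \<mu> \<mu> g e] \<tau> \<mu> st by (simp add: D_def d_def z_def power2_eq_square mult.assoc)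
    also have "\<dots> \<le> \<tau> * \<mu> * (G / (2 * (h * (1 + z) / (\<tau> * \<mu>))) + h * (1 + z) / (\<tau> * \<mu>) / 2 * D)"
      unfolding G_def D_def using \<tau> \<mu> False h z by (intro mult_left_mono young_sum) auto
    also have "\<dots> = \<tau> * z * G / (2 * (h * (1 + z))) + h * (1 + z) / 2 * D"
    proof -
      have ne: "\<tau> * \<mu> \<noteq> 0" "h * (1 + z) \<noteq> 0" using \<tau> False h z by auto
      have tz: "\<tau> * z = (\<tau> * \<mu>) * (\<tau> * \<mu>)" by (simp add: z_def power2_eq_square)
      have "t * (G / (2 * (w / t)) + w / t / 2 * D) = t * t * G / (2 * w) + w / 2 * D"
        if "t \<noteq> 0" "w \<noteq> 0" for t w :: real using that by (simp add: field_simps)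
      from this[OF ne] show ?thesis by (simp only: tz)
    qed
    finally have "(h0 + z * h2) * D + z / 2 * ((e s)\<^sup>2 - (e 0)\<^sup>2)
      \<le> \<tau> * z * G / (2 * (h * (1 + z))) + h * (1 + z) / 2 * D" .
    moreover have "h * (1 + z) * D \<le> (h0 + z * h2) * D"
    proof -
      have "z * h \<le> z * h2" using h z by (intro mult_left_mono) auto
      then have "h * (1 + z) \<le> h0 + z * h2" using h by (simp add: algebra_simps)
      then show ?thesis using D by (intro mult_right_mono) auto
    qed
    ultimately
    have main: "h * (1 + z) * D + z * ((e s)\<^sup>2 - (e 0)\<^sup>2) \<le> \<tau> * z * G / (h * (1 + z))"
    proof -
      have "\<tau> * z * G / (2 * (h * (1 + z))) = (\<tau> * z * G / (h * (1 + z))) / 2"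
        "h * (1 + z) / 2 * D = (h * (1 + z) * D) / 2"
        "z / 2 * ((e s)\<^sup>2 - (e 0)\<^sup>2) = (z * ((e s)\<^sup>2 - (e 0)\<^sup>2)) / 2" by simp_all
      moreover have "X + Y / 2 \<le> Z / 2 + W / 2 \<Longrightarrow> W \<le> X \<Longrightarrow> W + Y \<le> Z" for X Y Z W :: real
        by linarith
      ultimately show ?thesis
        using \<open>(h0 + z * h2) * D + z / 2 * ((e s)\<^sup>2 - (e 0)\<^sup>2)
          \<le> \<tau> * z * G / (2 * (h * (1 + z))) + h * (1 + z) / 2 * D\<close>
          \<open>h * (1 + z) * D \<le> (h0 + z * h2) * D\<close> by metis
    qed
    define lam where "lam = (1 + \<alpha>) * \<mu> + \<beta>"
    have lam0: "0 \<le> lam" using \<alpha>_gt \<beta>_pos \<mu> by (simp add: lam_def)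
    have "lam \<le> K * (1 + \<mu>)"
    proof -
      have "\<alpha> * \<mu> \<le> \<bar>\<alpha>\<bar> * \<mu>" using \<mu> by (intro mult_right_mono) auto
      moreover have "0 \<le> \<beta> * \<mu>" using \<mu> \<beta>_pos by auto
      ultimately show ?thesis unfolding lam_def K_def using \<mu> by (simp add: algebra_simps)
    qed
    then have "\<tau> * \<mu> * (a * lam) \<le> \<tau> * \<mu> * (a * (K * (1 + \<mu>)))"
      using \<tau> \<mu> a by (intro mult_left_mono) auto
    also have "\<dots> = a * K * (\<tau> * \<mu> + z)" by (simp add: z_def power2_eq_square algebra_simps)
    also have "\<dots> \<le> a * K * (2 * (1 + z))" using t\<mu> z a K by (intro mult_left_mono) auto
    finally have "1 + \<tau> * \<mu> * (a * lam) \<le> C1 * (1 + z)"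
      using z by (simp add: C1_def algebra_simps)
    then have w: "(1 + \<tau> * \<mu> * (a * lam))\<^sup>2 \<le> (C1 * (1 + z))\<^sup>2"
      using \<tau> \<mu> a lam0 by (intro power_mono) auto
    \<comment> \<open>The first stage; by the row sums \<open>a\<close> is also the first entry of \<open>Ah\<close>, so the terms with \<open>\<alpha>\<close>
      and \<open>\<beta>\<close> cancel in front of \<open>e 0\<close>.\<close>
    have "e 1 = e 0 - \<tau> * \<mu> * (a * (lam * e 1) + a * (g 1 - (\<alpha> * \<mu> + \<beta>) * e 0))"
      using bspec[OF st[unfolded modal_stages_def], of 1] s_pos A(1) first_row
      by (simp add: a_def lam_def)
    then have "a * z * e 0 = - (1 + \<tau> * \<mu> * (a * lam)) * d 0 - a * (\<tau> * \<mu>) * g 1"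
      unfolding d_def lam_def z_def by (simp add: power2_eq_square algebra_simps)
    then have "(a * z * e 0)\<^sup>2 = (- (1 + \<tau> * \<mu> * (a * lam)) * d 0 - a * (\<tau> * \<mu>) * g 1)\<^sup>2" by simp
    also have "\<dots> \<le> 2 * ((1 + \<tau> * \<mu> * (a * lam)) * d 0)\<^sup>2 + 2 * (a * (\<tau> * \<mu>) * g 1)\<^sup>2"
    proof -
      have "(- x * w - y)\<^sup>2 \<le> 2 * (x * w)\<^sup>2 + 2 * y\<^sup>2" for x y w :: real
        using zero_le_power2[of "x * w - y"] by (simp add: power2_eq_square algebra_simps)
      then show ?thesis .
    qed
    also have "\<dots> = 2 * ((1 + \<tau> * \<mu> * (a * lam))\<^sup>2 * (d 0)\<^sup>2) + 2 * (a\<^sup>2 * (\<tau> * z) * (g 1)\<^sup>2)"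
      by (simp add: z_def power2_eq_square algebra_simps)
    also have "\<dots> \<le> 2 * ((C1 * (1 + z))\<^sup>2 * D) + 2 * (a\<^sup>2 * (\<tau> * z) * G)"
      using w D G \<tau> z by (intro add_mono mult_left_mono mult_mono) auto
    finally have decay: "a\<^sup>2 * z\<^sup>2 * (e 0)\<^sup>2 \<le> 2 * C1\<^sup>2 * (1 + z)\<^sup>2 * D + 2 * a\<^sup>2 * \<tau> * z * G"
      by (simp add: power_mult_distrib mult.assoc)
    have "h * a\<^sup>2 / (2 * C1\<^sup>2) * z\<^sup>2 / (1 + z) * (e 0)\<^sup>2
        = h / (2 * C1\<^sup>2 * (1 + z)) * (a\<^sup>2 * z\<^sup>2 * (e 0)\<^sup>2)"
      using C1 z by (simp add: field_simps)
    also have "\<dots> \<le> h / (2 * C1\<^sup>2 * (1 + z)) * (2 * C1\<^sup>2 * (1 + z)\<^sup>2 * D + 2 * a\<^sup>2 * \<tau> * z * G)"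
      using h C1 z by (intro mult_left_mono decay) auto
    also have "\<dots> = h * (1 + z) * D + z * (h * a\<^sup>2 / C1\<^sup>2 * \<tau> * G / (1 + z))"
    proof -
      have "h / (2 * C1\<^sup>2 * (1 + z)) * (2 * C1\<^sup>2 * (1 + z)\<^sup>2 * D) = h * (1 + z) * D"
        using C1 z by (simp add: power2_eq_square)
      moreover have "h / (2 * C1\<^sup>2 * (1 + z)) * (2 * a\<^sup>2 * \<tau> * z * G) = z * (h * a\<^sup>2 / C1\<^sup>2 * \<tau> * G / (1 + z))"
        by simp
      ultimately show ?thesis by (simp only: distrib_left)
    qed
    finally have "h * a\<^sup>2 / (2 * C1\<^sup>2) * z\<^sup>2 / (1 + z) * (e 0)\<^sup>2 + z * ((e s)\<^sup>2 - (e 0)\<^sup>2)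
        \<le> \<tau> * z * G / (h * (1 + z)) + z * (h * a\<^sup>2 / C1\<^sup>2 * \<tau> * G / (1 + z))"
      using main by linarith
    also have "\<dots> = z * (C * \<tau> * G / (1 + z))"
    proof -
      have "\<tau> * z * G / (h * (1 + z)) = z * (1 / h * \<tau> * G / (1 + z))" by (simp add: mult.commute)
      then show ?thesis
        unfolding C_def by (simp only: distrib_right add_divide_distrib distrib_left)
    qed
    finally have "z * (h * a\<^sup>2 / (2 * C1\<^sup>2) * (z / (1 + z)) * (e 0)\<^sup>2 + ((e s)\<^sup>2 - (e 0)\<^sup>2))
        \<le> z * (C * \<tau> * G / (1 + z))"
      by (simp add: power2_eq_square algebra_simps)
    then have "h * a\<^sup>2 / (2 * C1\<^sup>2) * (z / (1 + z)) * (e 0)\<^sup>2 + ((e s)\<^sup>2 - (e 0)\<^sup>2) \<le> C * \<tau> * G / (1 + z)"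
      using z by (simp only: mult_le_cancel_left_pos)
    moreover have "c * (z / (1 + z)) * (e 0)\<^sup>2 \<le> h * a\<^sup>2 / (2 * C1\<^sup>2) * (z / (1 + z)) * (e 0)\<^sup>2"
      using c z by (intro mult_right_mono) auto
    moreover have "(1 - c * (z / (1 + z))) * (e 0)\<^sup>2 = (e 0)\<^sup>2 - c * (z / (1 + z)) * (e 0)\<^sup>2"
      by (simp add: left_diff_distrib)
    ultimately show ?thesis unfolding G_def z_def by linarith
  qed
  then show ?thesis using c(1,2) C by blast
qed

end

section \<open>Error propagation over many steps\<close>

lemma self_le_exp: "x \<le> exp (x :: real)"
  using exp_ge_add_one_self[of x] by linarith

lemma discrete_gronwall:
  fixes a :: "nat \<Rightarrow> real"
  assumes "\<And>n. n < N \<Longrightarrow> a (Suc n) \<le> (1 + c * \<tau>) * a n + b * \<tau>" and "a 0 = 0"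
    and "0 \<le> c" "0 \<le> \<tau>" "0 \<le> b" and "n \<le> N"
  shows "a n \<le> b * (n * \<tau>) * exp (c * (n * \<tau>))"
  using \<open>n \<le> N\<close>
proof (induction n)
  case 0
  then show ?case using assms by simp
next
  case (Suc n)
  have "a (Suc n) \<le> (1 + c * \<tau>) * a n + b * \<tau>" using assms(1) Suc.prems by simp
  also have "\<dots> \<le> (1 + c * \<tau>) * (b * (n * \<tau>) * exp (c * (n * \<tau>))) + b * \<tau>"
    using Suc assms by (intro add_mono mult_left_mono) auto
  also have "\<dots> \<le> exp (c * \<tau>) * (b * (n * \<tau>) * exp (c * (n * \<tau>))) + b * \<tau> * exp (c * (Suc n * \<tau>))"
  proof (intro add_mono mult_right_mono)
    have "b * \<tau> * 1 \<le> b * \<tau> * exp (c * (Suc n * \<tau>))"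
      using assms by (intro mult_left_mono) auto
    then show "b * \<tau> \<le> b * \<tau> * exp (c * (Suc n * \<tau>))" by simp
    show "1 + c * \<tau> \<le> exp (c * \<tau>)" by (rule exp_ge_add_one_self)
  qed (use assms in auto)
  also have "\<dots> = b * (Suc n * \<tau>) * exp (c * (Suc n * \<tau>))"
  proof -
    have "exp (c * (Suc n * \<tau>)) = exp (c * \<tau>) * exp (c * (n * \<tau>))"
      by (simp add: algebra_simps flip: exp_add)
    then show ?thesis by (simp add: algebra_simps)
  qed
  finally show ?case .
qed

text \<open>The factor \<open>q\<close> of the sources costs \<open>q ^ n\<close> over all steps, while each source \<open>f m\<close> keeps the damping of
  the steps after it. The terms \<open>h m\<close> are carried along undamped.\<close>

lemma damped_recursion:
  fixes b :: "nat \<Rightarrow> real"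
  assumes step: "\<And>n. n < N \<Longrightarrow> b (Suc n) \<le> q * (\<theta> * b n + f n) + h n" and "b 0 = 0"
    and "1 \<le> q" "0 \<le> \<theta>" "\<theta> \<le> 1" and nonneg: "\<And>n. n < N \<Longrightarrow> 0 \<le> f n" "\<And>n. n < N \<Longrightarrow> 0 \<le> h n" and "n \<le> N"
  shows "b n \<le> q ^ n * (\<Sum>m<n. \<theta> ^ (n - Suc m) * f m + h m)"
  using \<open>n \<le> N\<close>
proof (induction n)
  case 0
  then show ?case using assms by simp
next
  case (Suc n)
  define S where "S = (\<Sum>m<n. \<theta> ^ (n - Suc m) * f m + h m)"
  define S' where "S' = (\<Sum>m<n. \<theta> ^ (Suc n - Suc m) * f m + h m)"
  have "\<theta> * S \<le> S'"
    unfolding S_def S'_def sum_distrib_left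
  proof (rule sum_mono)
    fix m assume m: "m \<in> {..<n}"
    have "\<theta> ^ (Suc n - Suc m) = \<theta> * \<theta> ^ (n - Suc m)"
      using m by (simp flip: power_Suc add: Suc_diff_Suc)
    moreover have "\<theta> * h m \<le> 1 * h m" using m assms Suc.prems by (intro mult_right_mono) auto
    ultimately show "\<theta> * (\<theta> ^ (n - Suc m) * f m + h m) \<le> \<theta> ^ (Suc n - Suc m) * f m + h m"
      by (simp add: algebra_simps)
  qed
  have qn: "1 \<le> q ^ n" "0 \<le> q" using assms by (auto simp: one_le_power)
  have "b (Suc n) \<le> q * (\<theta> * b n + f n) + h n" using step Suc.prems by simp
  also have "\<dots> \<le> q * (\<theta> * (q ^ n * S) + q ^ n * f n) + q * q ^ n * h n"
  proof (intro add_mono mult_left_mono)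
    show "b n \<le> q ^ n * S" using Suc by (simp add: S_def)
    show "f n \<le> q ^ n * f n" using qn nonneg(1)[of n] Suc.prems by (simp add: mult_le_cancel_right1)
    have "1 * 1 \<le> q * q ^ n" using qn assms by (intro mult_mono) auto
    then show "h n \<le> q * q ^ n * h n"
      using nonneg(2)[of n] Suc.prems by (simp add: mult_le_cancel_right1)
  qed (use qn assms in auto)
  also have "\<dots> = q ^ Suc n * (\<theta> * S + f n + h n)" by (simp add: algebra_simps)
  also have "\<dots> \<le> q ^ Suc n * (S' + f n + h n)"
    using \<open>\<theta> * S \<le> S'\<close> qn by (intro mult_left_mono add_mono) auto
  also have "S' + f n + h n = (\<Sum>m<Suc n. \<theta> ^ (Suc n - Suc m) * f m + h m)"
    by (simp add: S'_def)
  finally show ?case .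
qed

lemma sum_inverse_sqrt_le: "(\<Sum>m<N. 1 / sqrt (real (N - m))) \<le> 2 * sqrt N"
proof -
  have "(\<Sum>m<N. 1 / sqrt (real (N - m))) = (\<Sum>k<N. 1 / sqrt (real (Suc k)))"
    by (rule sum.reindex_bij_witness[of _ "\<lambda>k. N - Suc k" "\<lambda>m. N - Suc m"]) auto
  also have "\<dots> \<le> 2 * sqrt N"
  proof (induction N)
    case (Suc N)
    define p where "p = sqrt (real (Suc N))"
    define q where "q = sqrt (real N)"
    have pq: "p > 0" "q \<ge> 0" "q \<le> p" "p\<^sup>2 - q\<^sup>2 = 1" by (auto simp: p_def q_def)
    have "1 = (p - q) * (p + q)" using pq(4) by (simp add: power2_eq_square algebra_simps)
    also have "\<dots> \<le> (p - q) * (2 * p)" using pq by (intro mult_left_mono) auto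
    also have "\<dots> = (2 * p - 2 * q) * p" by (simp add: algebra_simps)
    finally have "1 / p \<le> 2 * p - 2 * q" using pq(1) by (simp only: pos_divide_le_eq)
    then show ?case using Suc by (simp add: p_def q_def)
  qed simp
  finally show ?thesis .
qed

text \<open>Discrete parabolic smoothing: for a source in \<open>L\<^sup>2\<close> that has been damped for \<open>m\<close> steps, the
  squared gradient decays like \<open>m\<^sup>-\<^sup>1\<^sup>/\<^sup>2\<close>, uniformly in the mode. The reason is that
  \<open>q (1 - c q)\<^sup>m\<close> is at most of order \<open>1 / m\<close> for \<open>0 \<le> q \<le> 1\<close>, by Bernoulli's inequality.\<close>

lemma smoothing_kernel_bound:
  assumes \<tau>: "0 < \<tau>" and \<mu>: "0 \<le> \<mu>" and c: "0 < c" "c \<le> 1 / 2"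
  defines "z \<equiv> \<tau> * \<mu>\<^sup>2"
  shows "\<mu> * (\<tau> * (1 - c * (z / (1 + z))) ^ m / (1 + z)) \<le> sqrt (1 + 1 / c) * (sqrt \<tau> * (1 / sqrt (Suc m)))"
proof -
  define q where "q = z / (1 + z)"
  have z: "z \<ge> 0" using \<tau> by (simp add: z_def)
  have q: "0 \<le> q" "q \<le> 1" using z by (auto simp: q_def)
  define \<theta> where "\<theta> = 1 - c * q"
  have cq: "0 \<le> c * q" "c * q \<le> 1" using c q by (auto simp: mult_le_one)
  have \<theta>: "0 \<le> \<theta>" "\<theta> \<le> 1" using cq by (auto simp: \<theta>_def)
  have "\<theta> ^ m * (1 + m * (c * q)) \<le> \<theta> ^ m * (1 + c * q) ^ m"
    using Bernoulli_inequality[of "c * q" m] \<theta> cq by (intro mult_left_mono) auto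
  also have "\<dots> = (\<theta> * (1 + c * q)) ^ m" by (simp add: power_mult_distrib)
  also have "\<dots> \<le> 1"
  proof (rule power_le_one)
    show "0 \<le> \<theta> * (1 + c * q)" using cq \<theta> by simp
    have "\<theta> * (1 + c * q) = 1 - (c * q) * (c * q)" by (simp add: \<theta>_def algebra_simps)
    then show "\<theta> * (1 + c * q) \<le> 1" using cq by (smt (verit) mult_nonneg_nonneg)
  qed
  finally have bern: "\<theta> ^ m * (1 + m * (c * q)) \<le> 1" .
  have "\<theta> ^ m * (q * Suc m) \<le> 1 + 1 / c"
  proof -
    have "q * Suc m \<le> (1 + 1 / c) * (1 + m * (c * q))"
    proof -
      have "(1 + 1 / c) * (1 + m * (c * q)) = 1 + m * (c * q) + 1 / c + m * q"
        using c by (simp add: field_simps)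
      moreover have "0 \<le> m * (c * q)" "0 \<le> 1 / c" using cq c by auto
      moreover have "q * Suc m = q + m * q" by (simp add: algebra_simps)
      ultimately show ?thesis using q by linarith
    qed
    then have "\<theta> ^ m * (q * Suc m) \<le> \<theta> ^ m * ((1 + 1 / c) * (1 + m * (c * q)))"
      using \<theta> by (intro mult_left_mono) auto
    also have "\<dots> = (1 + 1 / c) * (\<theta> ^ m * (1 + m * (c * q)))" by simp
    also have "\<dots> \<le> (1 + 1 / c) * 1" using bern c by (intro mult_left_mono) auto
    finally show ?thesis by simp
  qed
  moreover have "(\<theta> ^ m)\<^sup>2 \<le> \<theta> ^ m"
    using \<theta> by (simp add: power2_eq_square mult_left_le power_le_one)
  then have "(\<theta> ^ m)\<^sup>2 * (q * Suc m) \<le> \<theta> ^ m * (q * Suc m)"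
    using q by (intro mult_right_mono) auto
  ultimately have "(\<theta> ^ m)\<^sup>2 * (q * Suc m) \<le> 1 + 1 / c" by linarith
  then have *: "(\<theta> ^ m)\<^sup>2 * q \<le> (1 + 1 / c) / Suc m" by (simp add: pos_le_divide_eq mult.assoc)
  have "(\<mu> * (\<tau> * \<theta> ^ m / (1 + z)))\<^sup>2 = \<tau> * ((\<theta> ^ m)\<^sup>2 * (q * (1 / (1 + z))))"
    using z by (simp add: q_def z_def power2_eq_square field_simps)
  also have "\<dots> \<le> \<tau> * ((\<theta> ^ m)\<^sup>2 * (q * 1))"
    using \<tau> q z by (intro mult_left_mono) auto
  also have "\<dots> \<le> \<tau> * ((1 + 1 / c) / Suc m)" using * \<tau> by (intro mult_left_mono) auto
  finally have "sqrt ((\<mu> * (\<tau> * \<theta> ^ m / (1 + z)))\<^sup>2) \<le> sqrt (\<tau> * ((1 + 1 / c) / Suc m))"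
    by (rule real_sqrt_le_mono)
  moreover have "0 \<le> \<mu> * (\<tau> * \<theta> ^ m / (1 + z))" using \<tau> \<mu> \<theta> z by simp
  moreover have "sqrt (\<tau> * ((1 + 1 / c) / Suc m)) = sqrt (1 + 1 / c) * (sqrt \<tau> * (1 / sqrt (Suc m)))"
    by (simp add: real_sqrt_mult real_sqrt_divide)
  ultimately have "\<mu> * (\<tau> * \<theta> ^ m / (1 + z)) \<le> sqrt (1 + 1 / c) * (sqrt \<tau> * (1 / sqrt (Suc m)))"
    by (simp only: real_sqrt_abs abs_of_nonneg)
  then show ?thesis by (simp only: \<theta>_def q_def)
qed

text \<open>The error over \<open>N\<close> steps in coordinates with respect to eigenmodes: \<open>x n r\<close> is the coefficient of the
  error at time \<open>n\<close> in mode \<open>r\<close>. The stages evolve mode by mode, but the source is controlled only in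
  the norm summed over all modes, since the nonlinearity couples them. What one step leaves over is the
  truncation error, bounded by \<open>R\<close> in the \<open>H\<^sup>1\<close> norm.\<close>

definition modal_error_run ::
  "real mat \<Rightarrow> real mat \<Rightarrow> real \<Rightarrow> real \<Rightarrow> real \<Rightarrow> nat \<Rightarrow> real \<Rightarrow> real \<Rightarrow> nat set \<Rightarrow> (nat \<Rightarrow> real) \<Rightarrow> (nat \<Rightarrow> real)
    \<Rightarrow> (nat \<Rightarrow> nat \<Rightarrow> real) \<Rightarrow> bool" where
  "modal_error_run A Ah \<alpha> \<beta> L N \<tau> R D \<gamma> \<mu> x \<longleftrightarrow>
    finite D \<and> (\<forall>r\<in>D. x 0 r = 0) \<and>
    (\<forall>n<N. \<exists>e g. (\<forall>r\<in>D. e 0 r = x n r) \<and>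
      (\<forall>r\<in>D. modal_stages A Ah \<alpha> \<beta> \<tau> (\<gamma> r) (\<mu> r) (\<lambda>j. g j r) (\<lambda>i. e i r)) \<and>
      (\<forall>j\<in>{1..dim_row A}. (\<Sum>r\<in>D. (g j r)\<^sup>2) \<le> L\<^sup>2 * (\<Sum>r\<in>D. (e (j - 1) r)\<^sup>2)) \<and>
      (\<Sum>r\<in>D. (1 + \<mu> r) * (x (Suc n) r - e (dim_row A) r)\<^sup>2) \<le> R\<^sup>2)"

context stable_imex
begin

text \<open>The stage bound, summed over the modes: the source of a stage is controlled by the stages before it, so
  an induction over the stages applies. The weight 1 gives the \<open>L\<^sup>2\<close> norm, the weight \<open>1 + \<mu>\<close> the
  \<open>H\<^sup>1\<close> norm.\<close>

lemma stages_norm_bound: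
  "\<exists>C>0. \<forall>(D :: nat set) \<tau> \<gamma> \<mu> \<omega> e g i. finite D \<longrightarrow> 0 \<le> \<tau> \<longrightarrow> (\<forall>r\<in>D. 0 \<le> \<gamma> r \<and> 0 \<le> \<mu> r \<and> 1 \<le> \<omega> r \<and> \<omega> r \<le> 1 + \<mu> r) \<longrightarrow>
    (\<forall>r\<in>D. modal_stages A Ah \<alpha> \<beta> \<tau> (\<gamma> r) (\<mu> r) (\<lambda>j. g j r) (\<lambda>i. e i r)) \<longrightarrow>
    (\<forall>j\<in>{1..s}. (\<Sum>r\<in>D. (g j r)\<^sup>2) \<le> L\<^sup>2 * (\<Sum>r\<in>D. (e (j - 1) r)\<^sup>2)) \<longrightarrow> i \<le> s \<longrightarrow>
    (\<Sum>r\<in>D. \<omega> r * (e i r)\<^sup>2) \<le> C * (\<Sum>r\<in>D. \<omega> r * (e 0 r)\<^sup>2)"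
proof -
  obtain C where C: "C > 0" and bound: "\<And>\<tau> \<gamma> \<mu> g e i. 0 \<le> \<tau> \<Longrightarrow> 0 \<le> \<gamma> \<Longrightarrow> 0 \<le> \<mu> \<Longrightarrow>
    modal_stages A Ah \<alpha> \<beta> \<tau> \<gamma> \<mu> g e \<Longrightarrow> 1 \<le> i \<Longrightarrow> i \<le> s \<Longrightarrow>
    (e i)\<^sup>2 \<le> C * ((\<Sum>j<i. (e j)\<^sup>2) + (\<Sum>j=1..i. (g j)\<^sup>2) / (1 + \<mu>))"
    using stage_bound_squared by blast
  define K where "K = C * (1 + L\<^sup>2)"
  have K: "K \<ge> 0" using C by (simp add: K_def)
  have "(\<Sum>r\<in>D. \<omega> r * (e i r)\<^sup>2) \<le> (1 + K) ^ s * (\<Sum>r\<in>D. \<omega> r * (e 0 r)\<^sup>2)"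
    if D: "finite (D :: nat set)" and \<tau>: "0 \<le> \<tau>"
      and nn: "\<forall>r\<in>D. 0 \<le> \<gamma> r \<and> 0 \<le> \<mu> r \<and> 1 \<le> \<omega> r \<and> \<omega> r \<le> 1 + \<mu> r"
      and st: "\<forall>r\<in>D. modal_stages A Ah \<alpha> \<beta> \<tau> (\<gamma> r) (\<mu> r) (\<lambda>j. g j r) (\<lambda>i. e i r)"
      and lip: "\<forall>j\<in>{1..s}. (\<Sum>r\<in>D. (g j r)\<^sup>2) \<le> L\<^sup>2 * (\<Sum>r\<in>D. (e (j - 1) r)\<^sup>2)" and i: "i \<le> s"
    for D \<tau> \<gamma> \<mu> \<omega> e g i
  proof -
    define a where "a i = (\<Sum>r\<in>D. \<omega> r * (e i r)\<^sup>2)" for i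
    have a0: "0 \<le> a i" for i
      unfolding a_def using nn by (intro sum_nonneg) (smt (verit) mult_nonneg_nonneg zero_le_power2)
    have "a i \<le> K * (\<Sum>j<i. a j)" if i: "1 \<le> i" "i \<le> s" for i
    proof -
      have "a i \<le> (\<Sum>r\<in>D. C * ((\<Sum>j<i. \<omega> r * (e j r)\<^sup>2) + (\<Sum>j=1..i. (g j r)\<^sup>2)))"
        unfolding a_def
      proof (rule sum_mono)
        fix r assume r: "r \<in> D"
        have "\<omega> r * (e i r)\<^sup>2 \<le> \<omega> r * (C * ((\<Sum>j<i. (e j r)\<^sup>2) + (\<Sum>j=1..i. (g j r)\<^sup>2) / (1 + \<mu> r)))"
          using bound[of \<tau> "\<gamma> r" "\<mu> r" "\<lambda>j. g j r" "\<lambda>i. e i r" i] \<tau> nn st r i by (intro mult_left_mono) auto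
        also have "\<dots> = C * ((\<Sum>j<i. \<omega> r * (e j r)\<^sup>2) + \<omega> r / (1 + \<mu> r) * (\<Sum>j=1..i. (g j r)\<^sup>2))"
          by (simp add: sum_distrib_left[symmetric] distrib_left mult.left_commute)
        also have "\<dots> \<le> C * ((\<Sum>j<i. \<omega> r * (e j r)\<^sup>2) + 1 * (\<Sum>j=1..i. (g j r)\<^sup>2))"
          using C nn r by (intro mult_left_mono add_left_mono mult_right_mono sum_nonneg) auto
        finally show "\<omega> r * (e i r)\<^sup>2 \<le> C * ((\<Sum>j<i. \<omega> r * (e j r)\<^sup>2) + (\<Sum>j=1..i. (g j r)\<^sup>2))" by simp
      qed
      also have "\<dots> = C * ((\<Sum>j<i. a j) + (\<Sum>j=1..i. \<Sum>r\<in>D. (g j r)\<^sup>2))"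
      proof -
        have "(\<Sum>j<i. a j) = (\<Sum>r\<in>D. \<Sum>j<i. \<omega> r * (e j r)\<^sup>2)"
          unfolding a_def by (rule sum.swap)
        moreover have "(\<Sum>j=1..i. \<Sum>r\<in>D. (g j r)\<^sup>2) = (\<Sum>r\<in>D. \<Sum>j=1..i. (g j r)\<^sup>2)" by (rule sum.swap)
        ultimately show ?thesis by (simp only: sum.distrib sum_distrib_left[symmetric, of C])
      qed
      also have "\<dots> \<le> C * ((\<Sum>j<i. a j) + (\<Sum>j=1..i. L\<^sup>2 * a (j - 1)))"
      proof (intro mult_left_mono add_left_mono sum_mono)
        fix j assume j: "j \<in> {1..i}"
        have "(\<Sum>r\<in>D. (g j r)\<^sup>2) \<le> L\<^sup>2 * (\<Sum>r\<in>D. (e (j - 1) r)\<^sup>2)" using lip j i by auto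
        also have "\<dots> \<le> L\<^sup>2 * a (j - 1)"
          unfolding a_def using nn
          by (intro mult_left_mono sum_mono) (auto simp: mult_le_cancel_right1)
        finally show "(\<Sum>r\<in>D. (g j r)\<^sup>2) \<le> L\<^sup>2 * a (j - 1)" .
      qed (use C in auto)
      also have "(\<Sum>j=1..i. L\<^sup>2 * a (j - 1)) = L\<^sup>2 * (\<Sum>j<i. a j)"
        unfolding sum_distrib_left by (rule sum.reindex_bij_witness[of _ Suc "\<lambda>j. j - 1"]) auto
      finally show ?thesis by (simp add: K_def algebra_simps)
    qed
    then have "(\<Sum>j\<le>i. a j) \<le> (1 + K) ^ i * a 0"
      using K i by (rule partial_sums_growth)
    moreover have "a i \<le> (\<Sum>j\<le>i. a j)" using a0 by (intro member_le_sum) auto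
    moreover have "(1 + K) ^ i * a 0 \<le> (1 + K) ^ s * a 0"
      using K i a0 by (intro mult_right_mono power_increasing) auto
    ultimately show ?thesis unfolding a_def by linarith
  qed
  moreover have "(1 + K) ^ s > 0" using K by (intro zero_less_power) linarith
  ultimately show ?thesis by blast
qed

lemma source_bound:
  "\<exists>C>0. \<forall>(D :: nat set) \<tau> \<gamma> \<mu> e g. finite D \<longrightarrow> 0 \<le> \<tau> \<longrightarrow> (\<forall>r\<in>D. 0 \<le> \<gamma> r \<and> 0 \<le> \<mu> r) \<longrightarrow>
    (\<forall>r\<in>D. modal_stages A Ah \<alpha> \<beta> \<tau> (\<gamma> r) (\<mu> r) (\<lambda>j. g j r) (\<lambda>i. e i r)) \<longrightarrow>
    (\<forall>j\<in>{1..s}. (\<Sum>r\<in>D. (g j r)\<^sup>2) \<le> L\<^sup>2 * (\<Sum>r\<in>D. (e (j - 1) r)\<^sup>2)) \<longrightarrow>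
    (\<Sum>r\<in>D. \<Sum>k<s. (g (Suc k) r)\<^sup>2) \<le> C * (\<Sum>r\<in>D. (e 0 r)\<^sup>2)"
proof -
  obtain C where C: "C > 0" and bound: "\<And>(D :: nat set) \<tau> \<gamma> \<mu> \<omega> e g i. finite D \<Longrightarrow> 0 \<le> \<tau> \<Longrightarrow>
    (\<forall>r\<in>D. 0 \<le> \<gamma> r \<and> 0 \<le> \<mu> r \<and> 1 \<le> \<omega> r \<and> \<omega> r \<le> 1 + \<mu> r) \<Longrightarrow>
    (\<forall>r\<in>D. modal_stages A Ah \<alpha> \<beta> \<tau> (\<gamma> r) (\<mu> r) (\<lambda>j. g j r) (\<lambda>i. e i r)) \<Longrightarrow>
    (\<forall>j\<in>{1..s}. (\<Sum>r\<in>D. (g j r)\<^sup>2) \<le> L\<^sup>2 * (\<Sum>r\<in>D. (e (j - 1) r)\<^sup>2)) \<Longrightarrow> i \<le> s \<Longrightarrow>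
    (\<Sum>r\<in>D. \<omega> r * (e i r)\<^sup>2) \<le> C * (\<Sum>r\<in>D. \<omega> r * (e 0 r)\<^sup>2)"
    using stages_norm_bound by blast
  have "(\<Sum>r\<in>D. \<Sum>k<s. (g (Suc k) r)\<^sup>2) \<le> s * L\<^sup>2 * C * (\<Sum>r\<in>D. (e 0 r)\<^sup>2)"
    if D: "finite (D :: nat set)" and \<tau>: "0 \<le> \<tau>" and nn: "\<forall>r\<in>D. 0 \<le> \<gamma> r \<and> 0 \<le> \<mu> r"
      and st: "\<forall>r\<in>D. modal_stages A Ah \<alpha> \<beta> \<tau> (\<gamma> r) (\<mu> r) (\<lambda>j. g j r) (\<lambda>i. e i r)"
      and lip: "\<forall>j\<in>{1..s}. (\<Sum>r\<in>D. (g j r)\<^sup>2) \<le> L\<^sup>2 * (\<Sum>r\<in>D. (e (j - 1) r)\<^sup>2)"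
    for D \<tau> \<gamma> \<mu> e g
  proof -
    have "(\<Sum>r\<in>D. \<Sum>k<s. (g (Suc k) r)\<^sup>2) = (\<Sum>k<s. \<Sum>r\<in>D. (g (Suc k) r)\<^sup>2)" by (rule sum.swap)
    also have "\<dots> \<le> (\<Sum>k<s. L\<^sup>2 * (C * (\<Sum>r\<in>D. (e 0 r)\<^sup>2)))"
    proof (rule sum_mono)
      fix k assume k: "k \<in> {..<s}"
      have "(\<Sum>r\<in>D. (g (Suc k) r)\<^sup>2) \<le> L\<^sup>2 * (\<Sum>r\<in>D. (e k r)\<^sup>2)"
        using bspec[OF lip, of "Suc k"] k by simp
      also have "\<dots> \<le> L\<^sup>2 * (C * (\<Sum>r\<in>D. (e 0 r)\<^sup>2))"
        using bound[OF D \<tau> _ st lip, where \<omega> = "\<lambda>_. 1" and i = k] nn k by (intro mult_left_mono) auto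
      finally show "(\<Sum>r\<in>D. (g (Suc k) r)\<^sup>2) \<le> L\<^sup>2 * (C * (\<Sum>r\<in>D. (e 0 r)\<^sup>2))" .
    qed
    finally show ?thesis by (simp add: mult.assoc)
  qed
  moreover have "s * L\<^sup>2 * C > 0" using s_pos L_pos C by simp
  ultimately show ?thesis by blast
qed


lemma error_run_step:
  assumes "modal_error_run A Ah \<alpha> \<beta> L N \<tau> R D \<gamma> \<mu> x" "n < N"
  obtains e g where "finite D" "\<And>r. r \<in> D \<Longrightarrow> e 0 r = x n r"
    "\<forall>r\<in>D. modal_stages A Ah \<alpha> \<beta> \<tau> (\<gamma> r) (\<mu> r) (\<lambda>j. g j r) (\<lambda>i. e i r)"
    "\<forall>j\<in>{1..s}. (\<Sum>r\<in>D. (g j r)\<^sup>2) \<le> L\<^sup>2 * (\<Sum>r\<in>D. (e (j - 1) r)\<^sup>2)"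
    "(\<Sum>r\<in>D. (1 + \<mu> r) * (x (Suc n) r - e s r)\<^sup>2) \<le> R\<^sup>2"
  proof -
  from assms A(1) obtain e g where "finite D \<and> (\<forall>r\<in>D. e 0 r = x n r) \<and>
    (\<forall>r\<in>D. modal_stages A Ah \<alpha> \<beta> \<tau> (\<gamma> r) (\<mu> r) (\<lambda>j. g j r) (\<lambda>i. e i r)) \<and>
    (\<forall>j\<in>{1..s}. (\<Sum>r\<in>D. (g j r)\<^sup>2) \<le> L\<^sup>2 * (\<Sum>r\<in>D. (e (j - 1) r)\<^sup>2)) \<and>
    (\<Sum>r\<in>D. (1 + \<mu> r) * (x (Suc n) r - e s r)\<^sup>2) \<le> R\<^sup>2"
    unfolding modal_error_run_def by force
  then show thesis by (intro that[of e g]) auto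
qed

text \<open>When \<open>\<tau> \<ge> 1\<close>, the number of steps is at most \<open>T\<close>, so a constant growth factor per step is
  harmless.\<close>

lemma error_large_steps:
  "\<exists>C>0. \<forall>N \<tau> \<rho> T D \<gamma> \<mu> x. 1 \<le> \<tau> \<longrightarrow> real N * \<tau> \<le> T \<longrightarrow> (\<forall>r\<in>D. 0 \<le> \<gamma> r \<and> 0 \<le> \<mu> r) \<longrightarrow>
    modal_error_run A Ah \<alpha> \<beta> L N \<tau> (\<tau> * \<rho>) D \<gamma> \<mu> x \<longrightarrow>
    (\<Sum>r\<in>D. (1 + \<mu> r) * (x N r)\<^sup>2) \<le> C * exp (C * T) * \<rho>\<^sup>2"
proof -
  obtain C where C: "C > 0" and bound: "\<And>(D :: nat set) \<tau> \<gamma> \<mu> \<omega> e g i. finite D \<Longrightarrow> 0 \<le> \<tau> \<Longrightarrow>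
    (\<forall>r\<in>D. 0 \<le> \<gamma> r \<and> 0 \<le> \<mu> r \<and> 1 \<le> \<omega> r \<and> \<omega> r \<le> 1 + \<mu> r) \<Longrightarrow>
    (\<forall>r\<in>D. modal_stages A Ah \<alpha> \<beta> \<tau> (\<gamma> r) (\<mu> r) (\<lambda>j. g j r) (\<lambda>i. e i r)) \<Longrightarrow>
    (\<forall>j\<in>{1..s}. (\<Sum>r\<in>D. (g j r)\<^sup>2) \<le> L\<^sup>2 * (\<Sum>r\<in>D. (e (j - 1) r)\<^sup>2)) \<Longrightarrow> i \<le> s \<Longrightarrow>
    (\<Sum>r\<in>D. \<omega> r * (e i r)\<^sup>2) \<le> C * (\<Sum>r\<in>D. \<omega> r * (e 0 r)\<^sup>2)"
    using stages_norm_bound by blast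
  define q where "q = 1 + 2 * C"
  have q: "q > 1" "2 * C \<le> q" using C by (auto simp: q_def)
  define C' where "C' = 2 + ln q"
  have "(\<Sum>r\<in>D. (1 + \<mu> r) * (x N r)\<^sup>2) \<le> C' * exp (C' * T) * \<rho>\<^sup>2"
    if \<tau>: "1 \<le> \<tau>" and T: "real N * \<tau> \<le> T" and nn: "\<forall>r\<in>D. 0 \<le> \<gamma> r \<and> 0 \<le> \<mu> r"
      and run: "modal_error_run A Ah \<alpha> \<beta> L N \<tau> (\<tau> * \<rho>) D \<gamma> \<mu> x" for N \<tau> \<rho> T D \<gamma> \<mu> x
  proof -
    define X where "X n = (\<Sum>r\<in>D. (1 + \<mu> r) * (x n r)\<^sup>2)" for n
    have X0: "X 0 = 0" using run by (simp add: X_def modal_error_run_def)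
    have step: "X (Suc n) \<le> q * (1 * X n + 0) + 2 * (\<tau> * \<rho>)\<^sup>2" if n: "n < N" for n
      using run n
    proof (rule error_run_step)
      fix e g assume fD: "finite D" and e0: "\<And>r. r \<in> D \<Longrightarrow> e 0 r = x n r"
        and st: "\<forall>r\<in>D. modal_stages A Ah \<alpha> \<beta> \<tau> (\<gamma> r) (\<mu> r) (\<lambda>j. g j r) (\<lambda>i. e i r)"
        and lip: "\<forall>j\<in>{1..s}. (\<Sum>r\<in>D. (g j r)\<^sup>2) \<le> L\<^sup>2 * (\<Sum>r\<in>D. (e (j - 1) r)\<^sup>2)"
        and res: "(\<Sum>r\<in>D. (1 + \<mu> r) * (x (Suc n) r - e s r)\<^sup>2) \<le> (\<tau> * \<rho>)\<^sup>2"
      have "X (Suc n) \<le> (\<Sum>r\<in>D. (1 + \<mu> r) * (2 * (e s r)\<^sup>2 + 2 * (x (Suc n) r - e s r)\<^sup>2))"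
        unfolding X_def
      proof (intro sum_mono mult_left_mono)
        fix r
        have "(a + b)\<^sup>2 \<le> 2 * a\<^sup>2 + 2 * b\<^sup>2" for a b :: real
          using square_add_le[of 1 a b] by simp
        from this[of "e s r" "x (Suc n) r - e s r"]
        show "(x (Suc n) r)\<^sup>2 \<le> 2 * (e s r)\<^sup>2 + 2 * (x (Suc n) r - e s r)\<^sup>2" by simp
      qed (use nn in auto)
      also have "\<dots> = 2 * (\<Sum>r\<in>D. (1 + \<mu> r) * (e s r)\<^sup>2) + 2 * (\<Sum>r\<in>D. (1 + \<mu> r) * (x (Suc n) r - e s r)\<^sup>2)"
        by (simp add: distrib_left sum.distrib sum_distrib_left mult.left_commute)
      also have "\<dots> \<le> 2 * (C * X n) + 2 * (\<tau> * \<rho>)\<^sup>2"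
      proof (intro add_mono mult_left_mono)
        have "(\<Sum>r\<in>D. (1 + \<mu> r) * (e s r)\<^sup>2) \<le> C * (\<Sum>r\<in>D. (1 + \<mu> r) * (e 0 r)\<^sup>2)"
          using \<tau> nn by (intro bound[OF fD _ _ st lip]) auto
        then show "(\<Sum>r\<in>D. (1 + \<mu> r) * (e s r)\<^sup>2) \<le> C * X n"
          unfolding X_def by (simp add: e0 cong: sum.cong)
      qed (use res in auto)
      also have "2 * (C * X n) \<le> q * (1 * X n + 0)"
      proof -
        have "0 \<le> X n" unfolding X_def using nn by (intro sum_nonneg) auto
        then show ?thesis using q by (simp flip: mult.assoc) (intro mult_right_mono, auto)
      qed
      finally show ?thesis by simp
    qed
    have "X N \<le> q ^ N * (\<Sum>m<N. 1 ^ (N - Suc m) * 0 + 2 * (\<tau> * \<rho>)\<^sup>2)"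
      by (rule damped_recursion[where N = N, OF step X0]) (use q in auto)
    also have "\<dots> = q ^ N * (2 * (N * \<tau>\<^sup>2) * \<rho>\<^sup>2)" by (simp add: power_mult_distrib)
    also have "\<dots> \<le> exp (ln q * T) * (2 * T\<^sup>2 * \<rho>\<^sup>2)"
    proof (intro mult_mono)
      have "real N \<le> N * \<tau>" using \<tau> by (simp add: mult_le_cancel_left1)
      then have NT: "real N \<le> T" using T by simp
      have "q ^ N = exp (ln q * N)" using q by (simp add: exp_of_nat2_mult)
      also have "\<dots> \<le> exp (ln q * T)" using q NT by simp
      finally show "q ^ N \<le> exp (ln q * T)" .
      have "real N * \<tau>\<^sup>2 \<le> (N * \<tau>)\<^sup>2"
      proof -
        have "N \<le> N * N" by (cases N) auto
        then have "real N \<le> real N * real N" by (simp only: of_nat_le_iff flip: of_nat_mult)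
        then have "real N * \<tau>\<^sup>2 \<le> real N * real N * \<tau>\<^sup>2" by (intro mult_right_mono) auto
        then show ?thesis by (simp add: power2_eq_square mult_ac)
      qed
      also have "\<dots> \<le> T\<^sup>2" using T \<tau> by (intro power_mono) auto
      finally show "real N * \<tau>\<^sup>2 \<le> T\<^sup>2" .
    qed (use q in auto)
    also have "\<dots> \<le> exp (ln q * T) * (C' * exp (2 * T) * \<rho>\<^sup>2)"
    proof (intro mult_left_mono mult_right_mono)
      have T0: "0 \<le> T" using T \<tau> by (smt (verit) mult_nonneg_nonneg of_nat_0_le_iff)
      have "T\<^sup>2 \<le> (exp T)\<^sup>2" using T0 self_le_exp[of T] by (intro power_mono) auto
      also have "\<dots> = exp (2 * T)" by (simp add: exp_double)
      finally have "2 * T\<^sup>2 \<le> 2 * exp (2 * T)" by simp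
      also have "\<dots> \<le> C' * exp (2 * T)" using q by (intro mult_right_mono) (auto simp: C'_def)
      finally show "2 * T\<^sup>2 \<le> C' * exp (2 * T)" .
    qed auto
    also have "\<dots> = C' * exp (C' * T) * \<rho>\<^sup>2"
    proof -
      have "exp (C' * T) = exp (2 * T) * exp (ln q * T)"
        by (simp add: C'_def distrib_right exp_add)
      then show ?thesis by simp
    qed
    finally show ?thesis by (simp add: X_def)
  qed
  moreover have "C' > 0" using q by (simp add: C'_def add_pos_pos)
  ultimately show ?thesis by blast
qed

text \<open>For small steps the squared error, weighted so that one step is stable up to \<open>O(\<tau>)\<close>, obeys
  a discrete Gronwall recursion. The Young inequality splits off the truncation error at the price
  of a factor \<open>2 / \<tau>\<close>, which its extra power of \<open>\<tau>\<close> absorbs.\<close>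

lemma weighted_error_gronwall:
  assumes \<omega>: "\<And>r. r \<in> D \<Longrightarrow> 0 \<le> \<omega> r" "\<And>r. r \<in> D \<Longrightarrow> \<omega> r \<le> K * (1 + \<mu> r)"
    and \<omega>0: "\<And>r. r \<in> D \<Longrightarrow> \<kappa> \<le> \<omega> r" and \<kappa>: "0 < \<kappa>" and K: "0 \<le> K"
    and nn: "\<forall>r\<in>D. 0 \<le> \<gamma> r \<and> 0 \<le> \<mu> r" and \<tau>: "0 < \<tau>" "\<tau> \<le> 1" and C: "0 \<le> C"
    and run: "modal_error_run A Ah \<alpha> \<beta> L N \<tau> (\<tau> * \<rho>) D \<gamma> \<mu> x"
    and Cs: "0 < Cs" and src: "\<And>e g. (\<forall>r\<in>D. modal_stages A Ah \<alpha> \<beta> \<tau> (\<gamma> r) (\<mu> r) (\<lambda>j. g j r) (\<lambda>i. e i r)) \<Longrightarrow>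
    (\<forall>j\<in>{1..s}. (\<Sum>r\<in>D. (g j r)\<^sup>2) \<le> L\<^sup>2 * (\<Sum>r\<in>D. (e (j - 1) r)\<^sup>2)) \<Longrightarrow>
    (\<Sum>r\<in>D. \<Sum>k<s. (g (Suc k) r)\<^sup>2) \<le> Cs * (\<Sum>r\<in>D. (e 0 r)\<^sup>2)"
    and step: "\<And>r g e. r \<in> D \<Longrightarrow> modal_stages A Ah \<alpha> \<beta> \<tau> (\<gamma> r) (\<mu> r) g e \<Longrightarrow>
      \<omega> r * (e s)\<^sup>2 \<le> (1 + \<tau>) * (\<omega> r * (e 0)\<^sup>2) + C * \<tau> * (\<Sum>k<s. (g (Suc k))\<^sup>2)"
    and n: "n \<le> N"
  shows "(\<Sum>r\<in>D. \<omega> r * (x n r)\<^sup>2)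
    \<le> 2 * K * \<rho>\<^sup>2 * (n * \<tau>) * exp ((3 + 2 * C * Cs / \<kappa>) * (n * \<tau>))"
proof (rule discrete_gronwall[where N = N and a = "\<lambda>n. \<Sum>r\<in>D. \<omega> r * (x n r)\<^sup>2", OF _ _ _ _ _ n])
  show "(\<Sum>r\<in>D. \<omega> r * (x 0 r)\<^sup>2) = 0" using run by (simp add: modal_error_run_def)
  show "0 \<le> 3 + 2 * C * Cs / \<kappa>" "0 \<le> \<tau>" "0 \<le> 2 * K * \<rho>\<^sup>2" using C Cs \<kappa> \<tau> K by auto
  fix n assume n: "n < N"
  show "(\<Sum>r\<in>D. \<omega> r * (x (Suc n) r)\<^sup>2)
      \<le> (1 + (3 + 2 * C * Cs / \<kappa>) * \<tau>) * (\<Sum>r\<in>D. \<omega> r * (x n r)\<^sup>2) + 2 * K * \<rho>\<^sup>2 * \<tau>"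
    using run n
  proof (rule error_run_step)
    fix e g assume fD: "finite D" and e0: "\<And>r. r \<in> D \<Longrightarrow> e 0 r = x n r"
      and st: "\<forall>r\<in>D. modal_stages A Ah \<alpha> \<beta> \<tau> (\<gamma> r) (\<mu> r) (\<lambda>j. g j r) (\<lambda>i. e i r)"
      and lip: "\<forall>j\<in>{1..s}. (\<Sum>r\<in>D. (g j r)\<^sup>2) \<le> L\<^sup>2 * (\<Sum>r\<in>D. (e (j - 1) r)\<^sup>2)"
      and res: "(\<Sum>r\<in>D. (1 + \<mu> r) * (x (Suc n) r - e s r)\<^sup>2) \<le> (\<tau> * \<rho>)\<^sup>2"
    define X where "X = (\<Sum>r\<in>D. \<omega> r * (x n r)\<^sup>2)"
    have X: "0 \<le> X" unfolding X_def using \<omega> by (intro sum_nonneg) auto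
    have "(\<Sum>r\<in>D. \<omega> r * (x (Suc n) r)\<^sup>2)
        \<le> (\<Sum>r\<in>D. (1 + \<tau>) * (\<omega> r * (e s r)\<^sup>2) + 2 / \<tau> * (\<omega> r * (x (Suc n) r - e s r)\<^sup>2))"
    proof (rule sum_mono)
      fix r assume r: "r \<in> D"
      have "(x (Suc n) r)\<^sup>2 \<le> (1 + \<tau>) * (e s r)\<^sup>2 + 2 / \<tau> * (x (Suc n) r - e s r)\<^sup>2"
        using square_add_le[OF \<tau>, of "e s r" "x (Suc n) r - e s r"] by simp
      then have "\<omega> r * (x (Suc n) r)\<^sup>2 \<le> \<omega> r * ((1 + \<tau>) * (e s r)\<^sup>2 + 2 / \<tau> * (x (Suc n) r - e s r)\<^sup>2)"
        using \<omega> r by (intro mult_left_mono) auto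
      then show "\<omega> r * (x (Suc n) r)\<^sup>2 \<le> (1 + \<tau>) * (\<omega> r * (e s r)\<^sup>2) + 2 / \<tau> * (\<omega> r * (x (Suc n) r - e s r)\<^sup>2)"
        by (simp add: distrib_left mult.left_commute)
    qed
    also have "\<dots> = (1 + \<tau>) * (\<Sum>r\<in>D. \<omega> r * (e s r)\<^sup>2) + 2 / \<tau> * (\<Sum>r\<in>D. \<omega> r * (x (Suc n) r - e s r)\<^sup>2)"
      by (simp only: sum.distrib sum_distrib_left)
    also have "\<dots> \<le> (1 + \<tau>) * ((1 + \<tau>) * X + C * \<tau> * (Cs * (X / \<kappa>))) + 2 / \<tau> * (K * (\<tau> * \<rho>)\<^sup>2)"
    proof (intro add_mono mult_left_mono)
      have "(\<Sum>r\<in>D. \<omega> r * (e s r)\<^sup>2)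
          \<le> (\<Sum>r\<in>D. (1 + \<tau>) * (\<omega> r * (e 0 r)\<^sup>2) + C * \<tau> * (\<Sum>k<s. (g (Suc k) r)\<^sup>2))"
        using st by (intro sum_mono step) auto
      also have "\<dots> = (1 + \<tau>) * X + C * \<tau> * (\<Sum>r\<in>D. \<Sum>k<s. (g (Suc k) r)\<^sup>2)"
        unfolding X_def by (simp add: sum.distrib sum_distrib_left e0 cong: sum.cong)
      also have "\<dots> \<le> (1 + \<tau>) * X + C * \<tau> * (Cs * (X / \<kappa>))"
      proof (intro add_left_mono mult_left_mono)
        have "(\<Sum>r\<in>D. \<Sum>k<s. (g (Suc k) r)\<^sup>2) \<le> Cs * (\<Sum>r\<in>D. (e 0 r)\<^sup>2)"
          by (rule src[OF st lip])
        also have "\<dots> \<le> Cs * (X / \<kappa>)"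
        proof (intro mult_left_mono)
          have "\<kappa> * (\<Sum>r\<in>D. (e 0 r)\<^sup>2) \<le> X"
            unfolding X_def sum_distrib_left by (intro sum_mono) (simp add: e0 mult_right_mono \<omega>0)
          then show "(\<Sum>r\<in>D. (e 0 r)\<^sup>2) \<le> X / \<kappa>" using \<kappa> by (simp add: pos_le_divide_eq mult.commute)
        qed (use Cs in auto)
        finally show "(\<Sum>r\<in>D. \<Sum>k<s. (g (Suc k) r)\<^sup>2) \<le> Cs * (X / \<kappa>)" .
      qed (use C \<tau> in auto)
      finally show "(\<Sum>r\<in>D. \<omega> r * (e s r)\<^sup>2) \<le> (1 + \<tau>) * X + C * \<tau> * (Cs * (X / \<kappa>))" .
      have "(\<Sum>r\<in>D. \<omega> r * (x (Suc n) r - e s r)\<^sup>2)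
          \<le> K * (\<Sum>r\<in>D. (1 + \<mu> r) * (x (Suc n) r - e s r)\<^sup>2)"
        unfolding sum_distrib_left mult.assoc[symmetric] using \<omega> by (intro sum_mono mult_right_mono) auto
      also have "\<dots> \<le> K * (\<tau> * \<rho>)\<^sup>2" using res K by (intro mult_left_mono) auto
      finally show "(\<Sum>r\<in>D. \<omega> r * (x (Suc n) r - e s r)\<^sup>2) \<le> K * (\<tau> * \<rho>)\<^sup>2" .
    qed (use \<tau> in auto)
    also have "2 / \<tau> * (K * (\<tau> * \<rho>)\<^sup>2) = 2 * K * \<rho>\<^sup>2 * \<tau>"
      using \<tau> by (simp add: power2_eq_square)
    also have "(1 + \<tau>) * ((1 + \<tau>) * X + C * \<tau> * (Cs * (X / \<kappa>)))
        = ((1 + \<tau>) * (1 + \<tau>) + (1 + \<tau>) * (C * \<tau> * Cs / \<kappa>)) * X"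
      by (simp add: distrib_left distrib_right mult.assoc)
    also have "\<dots> \<le> (1 + (3 + 2 * C * Cs / \<kappa>) * \<tau>) * X"
    proof (intro mult_right_mono X)
      have "\<tau> * \<tau> \<le> \<tau>" using \<tau> by (simp add: mult_left_le)
      then have "(1 + \<tau>) * (1 + \<tau>) \<le> 1 + 3 * \<tau>" by (simp add: algebra_simps)
      moreover have "(1 + \<tau>) * (C * \<tau> * Cs / \<kappa>) \<le> 2 * (C * \<tau> * Cs / \<kappa>)"
        using \<tau> C Cs \<kappa> by (intro mult_right_mono) auto
      moreover have "(1 + (3 + 2 * C * Cs / \<kappa>) * \<tau>) = 1 + 3 * \<tau> + 2 * (C * \<tau> * Cs / \<kappa>)"
        by (simp add: algebra_simps)
      ultimately show "(1 + \<tau>) * (1 + \<tau>) + (1 + \<tau>) * (C * \<tau> * Cs / \<kappa>) \<le> 1 + (3 + 2 * C * Cs / \<kappa>) * \<tau>"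
        by linarith
    qed
    finally show ?thesis by (simp add: X_def)
  qed
qed

text \<open>The weight \<open>\<mu> + \<kappa>\<close> is the one for which a step is stable up to \<open>O(\<tau>)\<close>; it is equivalent to the weight
  \<open>1 + \<mu>\<close> of the \<open>H\<^sup>1\<close> norm.\<close>

lemma error_allen_cahn:
  "\<exists>C>0. \<forall>N \<tau> \<rho> T D \<mu> x. 0 < \<tau> \<longrightarrow> \<tau> \<le> 1 \<longrightarrow> real N * \<tau> \<le> T \<longrightarrow> (\<forall>r\<in>D. 0 \<le> \<mu> r) \<longrightarrow>
    modal_error_run A Ah \<alpha> \<beta> L N \<tau> (\<tau> * \<rho>) D (\<lambda>_. 1) \<mu> x \<longrightarrow>
    (\<Sum>r\<in>D. (1 + \<mu> r) * (x N r)\<^sup>2) \<le> C * exp (C * T) * \<rho>\<^sup>2"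
proof -
  obtain \<kappa> C where \<kappa>: "\<kappa> > 0" and C: "C > 0" and step: "\<And>\<tau> \<mu> g e. 0 < \<tau> \<Longrightarrow> \<tau> \<le> 1 \<Longrightarrow> 0 \<le> \<mu> \<Longrightarrow>
    modal_stages A Ah \<alpha> \<beta> \<tau> 1 \<mu> g e \<Longrightarrow>
    (\<mu> + \<kappa>) * (e s)\<^sup>2 \<le> (1 + \<tau>) * ((\<mu> + \<kappa>) * (e 0)\<^sup>2) + C * \<tau> * (\<Sum>k<s. (g (Suc k))\<^sup>2)"
    using allen_cahn_step by blast
  obtain Cs where Cs: "Cs > 0" and src: "\<And>(D :: nat set) \<tau> \<gamma> \<mu> e g. finite D \<Longrightarrow> 0 \<le> \<tau> \<Longrightarrow> (\<forall>r\<in>D. 0 \<le> \<gamma> r \<and> 0 \<le> \<mu> r) \<Longrightarrow>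
    (\<forall>r\<in>D. modal_stages A Ah \<alpha> \<beta> \<tau> (\<gamma> r) (\<mu> r) (\<lambda>j. g j r) (\<lambda>i. e i r)) \<Longrightarrow>
    (\<forall>j\<in>{1..s}. (\<Sum>r\<in>D. (g j r)\<^sup>2) \<le> L\<^sup>2 * (\<Sum>r\<in>D. (e (j - 1) r)\<^sup>2)) \<Longrightarrow>
    (\<Sum>r\<in>D. \<Sum>k<s. (g (Suc k) r)\<^sup>2) \<le> Cs * (\<Sum>r\<in>D. (e 0 r)\<^sup>2)"
    using source_bound by blast
  define K where "K = 1 + \<kappa>"
  define c where "c = 3 + 2 * C * Cs / \<kappa>"
  define b where "b = 1 + 1 / \<kappa>"
  define C' where "C' = 2 * K * b + c + 1"
  have pos: "K > 0" "c > 0" "b > 0" using \<kappa> C Cs by (auto simp: K_def c_def b_def add_pos_pos)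
  have "(\<Sum>r\<in>D. (1 + \<mu> r) * (x N r)\<^sup>2) \<le> C' * exp (C' * T) * \<rho>\<^sup>2"
    if \<tau>: "0 < \<tau>" "\<tau> \<le> 1" and T: "real N * \<tau> \<le> T" and nn: "\<forall>r\<in>D. 0 \<le> \<mu> r"
      and run: "modal_error_run A Ah \<alpha> \<beta> L N \<tau> (\<tau> * \<rho>) D (\<lambda>_. 1) \<mu> x" for N \<tau> \<rho> T D \<mu> x
  proof -
    have "(\<Sum>r\<in>D. (1 + \<mu> r) * (x N r)\<^sup>2) \<le> b * (\<Sum>r\<in>D. (\<mu> r + \<kappa>) * (x N r)\<^sup>2)"
      unfolding sum_distrib_left mult.assoc[symmetric]
    proof (intro sum_mono mult_right_mono)
      fix r assume "r \<in> D"
      then have "0 \<le> \<mu> r / \<kappa>" using nn \<kappa> by auto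
      then show "1 + \<mu> r \<le> b * (\<mu> r + \<kappa>)" using \<kappa> by (simp add: b_def field_simps)
    qed auto
    also have "\<dots> \<le> b * (2 * K * \<rho>\<^sup>2 * (N * \<tau>) * exp (c * (N * \<tau>)))"
      unfolding c_def
    proof (intro mult_left_mono weighted_error_gronwall[where N = N and \<gamma> = "\<lambda>_. 1" and \<mu> = \<mu>])
      show "modal_error_run A Ah \<alpha> \<beta> L N \<tau> (\<tau> * \<rho>) D (\<lambda>_. 1) \<mu> x" by (rule run)
      show "\<mu> r + \<kappa> \<le> K * (1 + \<mu> r)" if "r \<in> D" for r
        using nn that \<kappa> by (simp add: K_def algebra_simps)
      show "(\<Sum>r\<in>D. \<Sum>k<s. (g (Suc k) r)\<^sup>2) \<le> Cs * (\<Sum>r\<in>D. (e 0 r)\<^sup>2)"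
        if "\<forall>r\<in>D. modal_stages A Ah \<alpha> \<beta> \<tau> 1 (\<mu> r) (\<lambda>j. g j r) (\<lambda>i. e i r)"
          "\<forall>j\<in>{1..s}. (\<Sum>r\<in>D. (g j r)\<^sup>2) \<le> L\<^sup>2 * (\<Sum>r\<in>D. (e (j - 1) r)\<^sup>2)" for e g
        using src[of D \<tau> "\<lambda>_. 1" \<mu> g e] that nn \<tau> run by (simp add: modal_error_run_def)
    qed (use nn \<kappa> pos C Cs \<tau> step in auto)
    also have "\<dots> \<le> b * (2 * K * \<rho>\<^sup>2 * exp T * exp (c * T))"
    proof -
      have "T \<le> exp T" by (rule self_le_exp)
      then show ?thesis using pos T \<tau> by (intro mult_left_mono mult_mono) auto
    qed
    also have "\<dots> = (2 * K * b) * exp ((c + 1) * T) * \<rho>\<^sup>2"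
      by (simp add: distrib_right exp_add)
    also have "\<dots> \<le> C' * exp (C' * T) * \<rho>\<^sup>2"
    proof (intro mult_right_mono mult_mono)
      have "0 \<le> T" using T \<tau> by (smt (verit) mult_nonneg_nonneg of_nat_0_le_iff)
      then show "exp ((c + 1) * T) \<le> exp (C' * T)"
        using pos by (simp add: C'_def mult_right_mono)
    qed (use pos in \<open>auto simp: C'_def\<close>)
    finally show ?thesis .
  qed
  moreover have "C' > 0" using pos by (simp add: C'_def add_pos_pos)
  ultimately show ?thesis by blast
qed

text \<open>For the Cahn--Hilliard equation the source is only controlled in \<open>L\<^sup>2\<close>, while the energy of one
  step would need its gradient. The \<open>L\<^sup>2\<close> error is therefore estimated first. In a second pass the
  recursion of every mode is unrolled and the damping accumulated since each source acted is
  converted into one derivative; the resulting kernel has a square root singularity, which is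
  summable.\<close>

lemma error_cahn_hilliard:
  "\<exists>C>0. \<forall>N \<tau> \<rho> T D \<mu> x. 0 < \<tau> \<longrightarrow> \<tau> \<le> 1 \<longrightarrow> real N * \<tau> \<le> T \<longrightarrow> (\<forall>r\<in>D. 0 \<le> \<mu> r) \<longrightarrow>
    modal_error_run A Ah \<alpha> \<beta> L N \<tau> (\<tau> * \<rho>) D \<mu> \<mu> x \<longrightarrow>
    (\<Sum>r\<in>D. (1 + \<mu> r) * (x N r)\<^sup>2) \<le> C * exp (C * T) * \<rho>\<^sup>2"
proof -
  obtain c C where c: "c > 0" "c \<le> 1 / 2" and C: "C > 0"
    and step: "\<And>\<tau> \<mu> g e. 0 < \<tau> \<Longrightarrow> \<tau> \<le> 1 \<Longrightarrow> 0 \<le> \<mu> \<Longrightarrow> modal_stages A Ah \<alpha> \<beta> \<tau> \<mu> \<mu> g e \<Longrightarrow>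
    (e s)\<^sup>2 \<le> (1 - c * (\<tau> * \<mu>\<^sup>2 / (1 + \<tau> * \<mu>\<^sup>2))) * (e 0)\<^sup>2
      + C * \<tau> * (\<Sum>k<s. (g (Suc k))\<^sup>2) / (1 + \<tau> * \<mu>\<^sup>2)"
    using cahn_hilliard_step by blast
  obtain Cs where Cs: "Cs > 0" and src: "\<And>(D :: nat set) \<tau> \<gamma> \<mu> e g. finite D \<Longrightarrow> 0 \<le> \<tau> \<Longrightarrow> (\<forall>r\<in>D. 0 \<le> \<gamma> r \<and> 0 \<le> \<mu> r) \<Longrightarrow>
    (\<forall>r\<in>D. modal_stages A Ah \<alpha> \<beta> \<tau> (\<gamma> r) (\<mu> r) (\<lambda>j. g j r) (\<lambda>i. e i r)) \<Longrightarrow>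
    (\<forall>j\<in>{1..s}. (\<Sum>r\<in>D. (g j r)\<^sup>2) \<le> L\<^sup>2 * (\<Sum>r\<in>D. (e (j - 1) r)\<^sup>2)) \<Longrightarrow>
    (\<Sum>r\<in>D. \<Sum>k<s. (g (Suc k) r)\<^sup>2) \<le> Cs * (\<Sum>r\<in>D. (e 0 r)\<^sup>2)"
    using source_bound by blast
  define c1 where "c1 = 3 + 2 * C * Cs / 1"
  define Ck where "Ck = sqrt (1 + 1 / c)"
  define C2 where "C2 = 4 * (C * Ck * Cs) + 4"
  define C' where "C' = C2 + c1 + 3"
  have pos: "c1 > 0" "Ck > 0" "C2 > 0" using C Cs c by (auto simp: c1_def Ck_def C2_def add_pos_pos)
  have "(\<Sum>r\<in>D. (1 + \<mu> r) * (x N r)\<^sup>2) \<le> C' * exp (C' * T) * \<rho>\<^sup>2"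
    if \<tau>: "0 < \<tau>" "\<tau> \<le> 1" and T: "real N * \<tau> \<le> T" and nn: "\<forall>r\<in>D. 0 \<le> \<mu> r"
      and run: "modal_error_run A Ah \<alpha> \<beta> L N \<tau> (\<tau> * \<rho>) D \<mu> \<mu> x" for N \<tau> \<rho> T D \<mu> x
  proof -
    have fD: "finite D" and x0: "\<And>r. r \<in> D \<Longrightarrow> x 0 r = 0" using run by (auto simp: modal_error_run_def)
    have T0: "0 \<le> T" using T \<tau> by (smt (verit) mult_nonneg_nonneg of_nat_0_le_iff)
    define z where "z r = \<tau> * (\<mu> r)\<^sup>2" for r
    define \<theta> where "\<theta> r = 1 - c * (z r / (1 + z r))" for r
    have z: "0 \<le> z r" for r using \<tau> by (simp add: z_def)
    have \<theta>: "0 \<le> \<theta> r" "\<theta> r \<le> 1" for r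
    proof -
      have "c * (z r / (1 + z r)) \<le> 1 / 2 * 1" using c z[of r] by (intro mult_mono) auto
      moreover have "0 \<le> c * (z r / (1 + z r))" using c z[of r] by simp
      ultimately show "0 \<le> \<theta> r" "\<theta> r \<le> 1" unfolding \<theta>_def by linarith+
    qed
    have step': "(e s)\<^sup>2 \<le> \<theta> r * (e 0)\<^sup>2 + C * (\<tau> * (\<Sum>k<s. (g (Suc k))\<^sup>2) / (1 + z r))"
      if "r \<in> D" "modal_stages A Ah \<alpha> \<beta> \<tau> (\<mu> r) (\<mu> r) g e" for r g e
      using step[OF \<tau> _ that(2)] nn that(1) by (simp add: \<theta>_def z_def mult.assoc)
    \<comment> \<open>First pass: the error in \<open>L\<^sup>2\<close>.\<close>
    have L2: "(\<Sum>r\<in>D. (x n r)\<^sup>2) \<le> 2 * \<rho>\<^sup>2 * T * exp (c1 * T)" if n: "n \<le> N" for n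
    proof -
      have "(\<Sum>r\<in>D. 1 * (x n r)\<^sup>2) \<le> 2 * 1 * \<rho>\<^sup>2 * (n * \<tau>) * exp (c1 * (n * \<tau>))"
        unfolding c1_def
      proof (rule weighted_error_gronwall[where N = N and \<gamma> = \<mu> and \<mu> = \<mu>])
        show "modal_error_run A Ah \<alpha> \<beta> L N \<tau> (\<tau> * \<rho>) D \<mu> \<mu> x" by (rule run)
        show "(\<Sum>r\<in>D. \<Sum>k<s. (g (Suc k) r)\<^sup>2) \<le> Cs * (\<Sum>r\<in>D. (e 0 r)\<^sup>2)"
          if "\<forall>r\<in>D. modal_stages A Ah \<alpha> \<beta> \<tau> (\<mu> r) (\<mu> r) (\<lambda>j. g j r) (\<lambda>i. e i r)"
            "\<forall>j\<in>{1..s}. (\<Sum>r\<in>D. (g j r)\<^sup>2) \<le> L\<^sup>2 * (\<Sum>r\<in>D. (e (j - 1) r)\<^sup>2)" for e g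
          using src[of D \<tau> \<mu> \<mu> g e] that nn \<tau> fD by simp
        fix r g e assume r: "r \<in> D" and st: "modal_stages A Ah \<alpha> \<beta> \<tau> (\<mu> r) (\<mu> r) g e"
        have G: "0 \<le> \<tau> * (\<Sum>k<s. (g (Suc k))\<^sup>2)" using \<tau> by (intro mult_nonneg_nonneg sum_nonneg) auto
        have "\<theta> r * (e 0)\<^sup>2 \<le> (1 + \<tau>) * (e 0)\<^sup>2" using \<theta>[of r] \<tau> by (intro mult_right_mono) auto
        moreover have "C * (\<tau> * (\<Sum>k<s. (g (Suc k))\<^sup>2) / (1 + z r)) \<le> C * (\<tau> * (\<Sum>k<s. (g (Suc k))\<^sup>2) / 1)"
          using C G z[of r] by (intro mult_left_mono divide_left_mono) auto
        ultimately show "1 * (e s)\<^sup>2 \<le> (1 + \<tau>) * (1 * (e 0)\<^sup>2) + C * \<tau> * (\<Sum>k<s. (g (Suc k))\<^sup>2)"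
          using step'[OF r st] by (simp add: mult.assoc)
      qed (use nn C Cs \<tau> n in auto)
      also have "\<dots> \<le> 2 * 1 * \<rho>\<^sup>2 * T * exp (c1 * T)"
      proof -
        have "n * \<tau> \<le> N * \<tau>" using n \<tau> by (intro mult_right_mono) auto
        then have "n * \<tau> \<le> T" using T by simp
        then show ?thesis using pos \<tau> T0 by (intro mult_mono) auto
      qed
      finally show ?thesis by simp
    qed
    define Y where "Y = Cs * (2 * \<rho>\<^sup>2 * T * exp (c1 * T))"
    have Y: "0 \<le> Y" using Cs T0 by (simp add: Y_def)
    define good where "good n G h \<longleftrightarrow> (\<forall>r\<in>D. 0 \<le> G r \<and> 0 \<le> h r \<and>
        (x (Suc n) r)\<^sup>2 \<le> (1 + \<tau>) * (\<theta> r * (x n r)\<^sup>2 + C * (\<tau> * G r / (1 + z r))) + 2 / \<tau> * h r) \<and>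
        (\<Sum>r\<in>D. G r) \<le> Y \<and> (\<Sum>r\<in>D. (1 + \<mu> r) * h r) \<le> (\<tau> * \<rho>)\<^sup>2" for n and G h :: "nat \<Rightarrow> real"
    have "\<forall>n. \<exists>G h. n < N \<longrightarrow> good n G h"
    proof
      fix n
      show "\<exists>G h. n < N \<longrightarrow> good n G h"
      proof (cases "n < N")
        case True
        from run True show ?thesis
        proof (rule error_run_step)
          fix e g assume e0: "\<And>r. r \<in> D \<Longrightarrow> e 0 r = x n r"
            and st: "\<forall>r\<in>D. modal_stages A Ah \<alpha> \<beta> \<tau> (\<mu> r) (\<mu> r) (\<lambda>j. g j r) (\<lambda>i. e i r)"
            and lip: "\<forall>j\<in>{1..s}. (\<Sum>r\<in>D. (g j r)\<^sup>2) \<le> L\<^sup>2 * (\<Sum>r\<in>D. (e (j - 1) r)\<^sup>2)"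
            and res: "(\<Sum>r\<in>D. (1 + \<mu> r) * (x (Suc n) r - e s r)\<^sup>2) \<le> (\<tau> * \<rho>)\<^sup>2"
          define G where "G r = (\<Sum>k<s. (g (Suc k) r)\<^sup>2)" for r
          have "(\<Sum>r\<in>D. G r) \<le> Cs * (\<Sum>r\<in>D. (e 0 r)\<^sup>2)"
            unfolding G_def using \<tau> nn by (intro src[OF fD _ _ st lip]) auto
          also have "\<dots> = Cs * (\<Sum>r\<in>D. (x n r)\<^sup>2)" by (simp add: e0 cong: sum.cong)
          also have "\<dots> \<le> Y" unfolding Y_def using Cs L2[of n] True by (intro mult_left_mono) auto
          finally have "(\<Sum>r\<in>D. G r) \<le> Y" .
          moreover have "0 \<le> G r" for r unfolding G_def by (intro sum_nonneg) auto
          moreover have "(x (Suc n) r)\<^sup>2 \<le> (1 + \<tau>) * (\<theta> r * (x n r)\<^sup>2 + C * (\<tau> * G r / (1 + z r)))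
              + 2 / \<tau> * (x (Suc n) r - e s r)\<^sup>2" if r: "r \<in> D" for r
          proof -
            have "(x (Suc n) r)\<^sup>2 \<le> (1 + \<tau>) * (e s r)\<^sup>2 + 2 / \<tau> * (x (Suc n) r - e s r)\<^sup>2"
              using square_add_le[OF \<tau>, of "e s r" "x (Suc n) r - e s r"] by simp
            also have "(1 + \<tau>) * (e s r)\<^sup>2 \<le> (1 + \<tau>) * (\<theta> r * (x n r)\<^sup>2 + C * (\<tau> * G r / (1 + z r)))"
              using step'[OF r, of "\<lambda>j. g j r" "\<lambda>i. e i r"] st r \<tau>
              by (intro mult_left_mono) (auto simp: e0 G_def)
            finally show ?thesis by simp
          qed
          ultimately show ?thesis using res unfolding good_def
            by (intro exI[of _ G] exI[of _ "\<lambda>r. (x (Suc n) r - e s r)\<^sup>2"]) simp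
        qed
      qed auto
    qed
    then obtain G h where "\<And>n. n < N \<Longrightarrow> good n (G n) (h n)" by metis
    note GH = this[unfolded good_def]
    have G0: "0 \<le> G n r" and h0: "0 \<le> h n r" if "n < N" "r \<in> D" for n r using GH that by auto
    \<comment> \<open>Second pass: the gradient of the error.\<close>
    have "(\<Sum>r\<in>D. \<mu> r * (x N r)\<^sup>2) \<le> (\<Sum>r\<in>D. (1 + \<tau>) ^ N *
        (\<Sum>m<N. C * (Ck * (sqrt \<tau> * (1 / sqrt (N - m)))) * G m r + 2 / \<tau> * ((1 + \<mu> r) * h m r)))"
    proof (rule sum_mono)
      fix r assume r: "r \<in> D"
      have "(x N r)\<^sup>2 \<le> (1 + \<tau>) ^ N *
          (\<Sum>m<N. \<theta> r ^ (N - Suc m) * (C * (\<tau> * G m r / (1 + z r))) + 2 / \<tau> * h m r)"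
      proof (rule damped_recursion[where N = N and b = "\<lambda>n. (x n r)\<^sup>2"])
        show "0 \<le> C * (\<tau> * G n r / (1 + z r))" if "n < N" for n
          using C \<tau> G0[OF that r] z[of r] by simp
      qed (use GH r x0 \<tau> \<theta> h0 in auto)
      then have "\<mu> r * (x N r)\<^sup>2 \<le> \<mu> r * ((1 + \<tau>) ^ N *
          (\<Sum>m<N. \<theta> r ^ (N - Suc m) * (C * (\<tau> * G m r / (1 + z r))) + 2 / \<tau> * h m r))"
        using nn r by (intro mult_left_mono) auto
      also have "\<dots> = (1 + \<tau>) ^ N * (\<Sum>m<N. C * (\<mu> r * (\<tau> * \<theta> r ^ (N - Suc m) / (1 + z r))) * G m r
          + 2 / \<tau> * (\<mu> r * h m r))"
      proof -
        have "\<mu> r * (\<theta> r ^ (N - Suc m) * (C * (\<tau> * G m r / (1 + z r))) + 2 / \<tau> * h m r)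
            = C * (\<mu> r * (\<tau> * \<theta> r ^ (N - Suc m) / (1 + z r))) * G m r + 2 / \<tau> * (\<mu> r * h m r)" for m
          by (simp add: distrib_left mult_ac)
        then show ?thesis by (simp only: mult.left_commute[of "\<mu> r" "(1 + \<tau>) ^ N"] sum_distrib_left[of "\<mu> r"])
      qed
      also have "\<dots> \<le> (1 + \<tau>) ^ N *
        (\<Sum>m<N. C * (Ck * (sqrt \<tau> * (1 / sqrt (N - m)))) * G m r + 2 / \<tau> * ((1 + \<mu> r) * h m r))"
      proof (intro mult_left_mono sum_mono add_mono mult_right_mono)
        fix m assume m: "m \<in> {..<N}"
        have "\<mu> r * (\<tau> * \<theta> r ^ (N - Suc m) / (1 + z r)) \<le> Ck * (sqrt \<tau> * (1 / sqrt (Suc (N - Suc m))))"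
          unfolding \<theta>_def z_def Ck_def using nn r \<tau> c by (intro smoothing_kernel_bound) auto
        moreover have "Suc (N - Suc m) = N - m" using m by auto
        ultimately show "\<mu> r * (\<tau> * \<theta> r ^ (N - Suc m) / (1 + z r)) \<le> Ck * (sqrt \<tau> * (1 / sqrt (N - m)))"
          by simp
      qed (use C \<tau> G0 h0 r in auto)
      finally show "\<mu> r * (x N r)\<^sup>2 \<le> (1 + \<tau>) ^ N *
        (\<Sum>m<N. C * (Ck * (sqrt \<tau> * (1 / sqrt (N - m)))) * G m r + 2 / \<tau> * ((1 + \<mu> r) * h m r))" .
    qed
    also have "\<dots> = (1 + \<tau>) ^ N * (\<Sum>m<N. C * (Ck * (sqrt \<tau> * (1 / sqrt (N - m)))) * (\<Sum>r\<in>D. G m r)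
        + 2 / \<tau> * (\<Sum>r\<in>D. (1 + \<mu> r) * h m r))"
      unfolding sum_distrib_left[symmetric] by (subst sum.swap) (simp only: sum.distrib sum_distrib_left)
    also have "\<dots> \<le> (1 + \<tau>) ^ N * (\<Sum>m<N. C * (Ck * (sqrt \<tau> * (1 / sqrt (N - m)))) * Y
        + 2 / \<tau> * (\<tau> * \<rho>)\<^sup>2)"
      using GH C pos \<tau> by (intro mult_left_mono sum_mono add_mono) auto
    also have "\<dots> = (1 + \<tau>) ^ N * (C * Ck * Y * (sqrt \<tau> * (\<Sum>m<N. 1 / sqrt (N - m))) + 2 * (N * \<tau>) * \<rho>\<^sup>2)"
    proof -
      have "2 / \<tau> * (\<tau> * \<rho>)\<^sup>2 = 2 * \<tau> * \<rho>\<^sup>2" using \<tau> by (simp add: power2_eq_square)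
      then show ?thesis by (simp add: sum.distrib sum_distrib_left sum_distrib_right mult_ac)
    qed
    also have "\<dots> \<le> exp T * (C * Ck * Y * (2 * exp T) + 2 * exp T * \<rho>\<^sup>2)"
    proof -
      have "(1 + \<tau>) ^ N \<le> exp \<tau> ^ N" using \<tau> exp_ge_add_one_self[of \<tau>] by (intro power_mono) auto
      also have "\<dots> = exp (N * \<tau>)" by (simp add: exp_of_nat_mult)
      also have "\<dots> \<le> exp T" using T by simp
      finally have f1: "(1 + \<tau>) ^ N \<le> exp T" .
      have eT: "1 \<le> exp T" "T \<le> exp T" using T0 self_le_exp[of T] by auto
      have "sqrt \<tau> * (\<Sum>m<N. 1 / sqrt (N - m)) \<le> sqrt \<tau> * (2 * sqrt N)"
        using \<tau> sum_inverse_sqrt_le[of N] by (intro mult_left_mono) auto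
      also have "\<dots> = 2 * sqrt (N * \<tau>)" by (simp add: real_sqrt_mult mult_ac)
      also have "\<dots> \<le> 2 * exp T"
      proof -
        have "sqrt (N * \<tau>) \<le> sqrt ((exp T)\<^sup>2)"
        proof (rule real_sqrt_le_mono)
          have "N * \<tau> \<le> exp T * 1" using T eT by simp
          also have "\<dots> \<le> exp T * exp T" using eT by (intro mult_left_mono) auto
          finally show "N * \<tau> \<le> (exp T)\<^sup>2" by (simp add: power2_eq_square)
        qed
        then show ?thesis by simp
      qed
      finally have "C * Ck * Y * (sqrt \<tau> * (\<Sum>m<N. 1 / sqrt (N - m))) \<le> C * Ck * Y * (2 * exp T)"
        using C pos Y by (intro mult_left_mono) auto
      moreover have "2 * (real N * \<tau>) * \<rho>\<^sup>2 \<le> 2 * exp T * \<rho>\<^sup>2"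
        using T eT by (intro mult_right_mono) auto
      ultimately show ?thesis
        using C pos Y \<tau> by (intro mult_mono[OF f1] add_mono)
          (auto intro!: add_nonneg_nonneg mult_nonneg_nonneg sum_nonneg)
    qed
    finally have grad: "(\<Sum>r\<in>D. \<mu> r * (x N r)\<^sup>2) \<le> exp T * (C * Ck * Y * (2 * exp T) + 2 * exp T * \<rho>\<^sup>2)" .
    define w where "w = exp ((c1 + 3) * T)"
    have eT: "1 \<le> exp T" "T \<le> exp T" using T0 self_le_exp[of T] by auto
    have w3: "exp T * exp T * exp T * exp (c1 * T) = w" by (simp add: w_def distrib_right flip: exp_add)
    have ec: "1 \<le> exp (c1 * T)" using pos T0 by simp
    have "T * exp (c1 * T) \<le> (exp T * exp T * exp T) * exp (c1 * T)"
    proof (intro mult_right_mono)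
      have "exp T * 1 * 1 \<le> exp T * exp T * exp T" using eT by (intro mult_mono) auto
      then show "T \<le> exp T * exp T * exp T" using eT(2) by linarith
    qed auto
    then have w1: "T * exp (c1 * T) \<le> w" by (simp only: w3)
    have "exp T * exp T * 1 * 1 \<le> exp T * exp T * exp T * exp (c1 * T)"
      using eT ec by (intro mult_mono) auto
    then have w2: "exp T * exp T \<le> w" by (simp only: w3 mult_1_right)
    have w4: "exp T * exp T * (T * exp (c1 * T)) \<le> w"
    proof -
      have "exp T * exp T * (T * exp (c1 * T)) \<le> exp T * exp T * (exp T * exp (c1 * T))"
        using eT by (intro mult_left_mono mult_right_mono) auto
      also have "\<dots> = w" using w3 by (simp only: mult.assoc)
      finally show ?thesis .
    qed
    have "(\<Sum>r\<in>D. (1 + \<mu> r) * (x N r)\<^sup>2) = (\<Sum>r\<in>D. (x N r)\<^sup>2) + (\<Sum>r\<in>D. \<mu> r * (x N r)\<^sup>2)"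
      by (simp add: distrib_right sum.distrib)
    also have "\<dots> \<le> 2 * \<rho>\<^sup>2 * T * exp (c1 * T) + exp T * (C * Ck * Y * (2 * exp T) + 2 * exp T * \<rho>\<^sup>2)"
      using grad L2[of N] by simp
    also have "\<dots> = \<rho>\<^sup>2 * (2 * (T * exp (c1 * T)) + 4 * (C * Ck * Cs) * (exp T * exp T * (T * exp (c1 * T)))
        + 2 * (exp T * exp T))"
      by (simp add: Y_def algebra_simps)
    also have "\<dots> \<le> \<rho>\<^sup>2 * (2 * w + 4 * (C * Ck * Cs) * w + 2 * w)"
      using w1 w2 w4 C pos Cs by (intro mult_left_mono add_mono) auto
    also have "\<dots> = C2 * w * \<rho>\<^sup>2" by (simp add: C2_def algebra_simps)
    also have "\<dots> \<le> C' * exp (C' * T) * \<rho>\<^sup>2"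
      unfolding w_def using pos T0 by (intro mult_right_mono mult_mono) (auto simp: C'_def mult_right_mono)
    finally show ?thesis .
  qed
  moreover have "C' > 0" using pos by (simp add: C'_def add_pos_pos)
  ultimately show ?thesis by blast
qed

theorem modal_error_bound:
  "\<exists>C>0. \<forall>N \<tau> \<rho> T D \<mu> x. 0 < \<tau> \<longrightarrow> real N * \<tau> \<le> T \<longrightarrow> (\<forall>r\<in>D. 0 \<le> \<mu> r) \<longrightarrow>
    modal_error_run A Ah \<alpha> \<beta> L N \<tau> (\<tau> * \<rho>) D (if eqn = AllenCahn then \<lambda>_. 1 else \<mu>) \<mu> x \<longrightarrow>
    (\<Sum>r\<in>D. (1 + \<mu> r) * (x N r)\<^sup>2) \<le> C * exp (C * T) * \<rho>\<^sup>2"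
proof -
  define \<gamma> where "\<gamma> \<mu> = (if eqn = AllenCahn then \<lambda>_. 1 else \<mu>)" for \<mu> :: "nat \<Rightarrow> real"
  obtain C1 where C1: "C1 > 0" and large: "\<And>N \<tau> \<rho> T D \<gamma> \<mu> x. 1 \<le> \<tau> \<Longrightarrow> real N * \<tau> \<le> T \<Longrightarrow> (\<forall>r\<in>D. 0 \<le> \<gamma> r \<and> 0 \<le> \<mu> r) \<Longrightarrow>
    modal_error_run A Ah \<alpha> \<beta> L N \<tau> (\<tau> * \<rho>) D \<gamma> \<mu> x \<Longrightarrow>
    (\<Sum>r\<in>D. (1 + \<mu> r) * (x N r)\<^sup>2) \<le> C1 * exp (C1 * T) * \<rho>\<^sup>2"
    using error_large_steps by blast
  obtain C2 where C2: "C2 > 0" and small: "\<And>N \<tau> \<rho> T D \<mu> x. 0 < \<tau> \<Longrightarrow> \<tau> \<le> 1 \<Longrightarrow> real N * \<tau> \<le> T \<Longrightarrow> (\<forall>r\<in>D. 0 \<le> \<mu> r) \<Longrightarrow>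
    modal_error_run A Ah \<alpha> \<beta> L N \<tau> (\<tau> * \<rho>) D (\<gamma> \<mu>) \<mu> x \<Longrightarrow>
    (\<Sum>r\<in>D. (1 + \<mu> r) * (x N r)\<^sup>2) \<le> C2 * exp (C2 * T) * \<rho>\<^sup>2"
  proof (cases "eqn = AllenCahn")
    case True
    then have "\<gamma> = (\<lambda>_ _. 1)" by (simp add: \<gamma>_def fun_eq_iff)
    then show ?thesis using error_allen_cahn that by blast
  next
    case False
    then have "\<gamma> = (\<lambda>\<mu>. \<mu>)" by (simp add: \<gamma>_def fun_eq_iff)
    then show ?thesis using error_cahn_hilliard that by blast
  qed
  have "(\<Sum>r\<in>D. (1 + \<mu> r) * (x N r)\<^sup>2) \<le> max C1 C2 * exp (max C1 C2 * T) * \<rho>\<^sup>2"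
    if \<tau>: "0 < \<tau>" and T: "real N * \<tau> \<le> T" and nn: "\<forall>r\<in>D. 0 \<le> \<mu> r"
      and run: "modal_error_run A Ah \<alpha> \<beta> L N \<tau> (\<tau> * \<rho>) D (\<gamma> \<mu>) \<mu> x" for N \<tau> \<rho> T D \<mu> x
  proof -
    have T0: "0 \<le> T" using T \<tau> by (smt (verit) mult_nonneg_nonneg of_nat_0_le_iff)
    have grow: "C * exp (C * T) * \<rho>\<^sup>2 \<le> max C1 C2 * exp (max C1 C2 * T) * \<rho>\<^sup>2" if "0 < C" "C \<le> max C1 C2" for C
      using that T0 by (intro mult_right_mono mult_mono) (auto simp: mult_right_mono)
    show ?thesis
    proof (cases "\<tau> \<le> 1")
      case True
      then show ?thesis using small[OF \<tau> True T nn run] grow[of C2] C2 by linarith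
    next
      case False
      then have "(\<Sum>r\<in>D. (1 + \<mu> r) * (x N r)\<^sup>2) \<le> C1 * exp (C1 * T) * \<rho>\<^sup>2"
        using nn by (intro large[OF _ T _ run]) (auto simp: \<gamma>_def)
      then show ?thesis using grow[of C1] C1 by linarith
    qed
  qed
  moreover have "max C1 C2 > 0" using C1 by simp
  ultimately show ?thesis unfolding \<gamma>_def by blast
qed

end

section \<open>Smooth test functions\<close>

text \<open>Smooth functions that vanish for \<open>y \<le> 0\<close>; \<open>flat 1\<close> is the usual \<open>exp (- 1 / y)\<close>. The polynomial
  makes the family closed under differentiation.\<close>

definition flat :: "real poly \<Rightarrow> real \<Rightarrow> real" where
  "flat p y = (if 0 < y then poly p (1 / y) * exp (- (1 / y)) else 0)"

lemma poly_times_exp_tendsto_0: "((\<lambda>x. poly p x * exp (- x)) \<longlongrightarrow> 0) at_top" for p :: "real poly"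
proof -
  have "((\<lambda>x. coeff p i * (x ^ i / exp x)) \<longlongrightarrow> coeff p i * 0) at_top" for i
    by (intro tendsto_mult_left tendsto_power_div_exp_0)
  then have "((\<lambda>x. \<Sum>i\<le>degree p. coeff p i * (x ^ i / exp x)) \<longlongrightarrow> 0) at_top"
    by (intro tendsto_null_sum) simp
  moreover have "(\<Sum>i\<le>degree p. coeff p i * (x ^ i / exp x)) = poly p x * exp (- x)" for x
    by (simp add: poly_altdef sum_distrib_right exp_minus divide_inverse mult.assoc)
  ultimately show ?thesis by simp
qed

lemma flat_tendsto_0: "(flat p \<longlongrightarrow> 0) (at 0)"
proof (rule filterlim_split_at)
  have "((\<lambda>y. poly p (inverse y) * exp (- inverse y)) \<longlongrightarrow> 0) (at_right 0)"
    by (rule filterlim_compose[OF poly_times_exp_tendsto_0 filterlim_inverse_at_top_right])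
  then show "(flat p \<longlongrightarrow> 0) (at_right 0)"
    by (rule Lim_transform_eventually)
       (auto simp: eventually_at_right_field flat_def inverse_eq_divide intro!: exI[of _ 1])
  show "(flat p \<longlongrightarrow> 0) (at_left 0)"
    by (rule Lim_transform_eventually[OF tendsto_const])
       (auto simp: eventually_at_left_field flat_def intro!: exI[of _ "-1"])
qed

lemma flat_has_derivative:
  "(flat p has_real_derivative flat (monom 1 2 * (p - pderiv p)) y) (at y)"
proof -
  consider "y > 0" | "y < 0" | "y = 0" by linarith
  then show ?thesis
  proof cases
    case 1
    have "((\<lambda>y. poly p (1 / y) * exp (- (1 / y))) has_real_derivative
        flat (monom 1 2 * (p - pderiv p)) y) (at y)"
      using 1
      by (auto intro!: derivative_eq_intros DERIV_chain2[OF poly_DERIV]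
          simp: flat_def poly_monom field_simps power2_eq_square)
    then show ?thesis
      by (rule has_field_derivative_transform_within_open[where S = "{0<..}"])
         (use 1 in \<open>auto simp: flat_def\<close>)
  next
    case 2
    have "((\<lambda>y. 0) has_real_derivative flat (monom 1 2 * (p - pderiv p)) y) (at y)"
      using 2 by (simp add: flat_def)
    then show ?thesis
      by (rule has_field_derivative_transform_within_open[where S = "{..<0}"])
         (use 2 in \<open>auto simp: flat_def\<close>)
  next
    case 3
    have "((\<lambda>h. (flat p (0 + h) - flat p 0) / h) \<longlongrightarrow> 0) (at 0)"
    proof (rule Lim_transform_eventually[OF flat_tendsto_0[of "pCons 0 p"]])
      show "\<forall>\<^sub>F h in at 0. flat (pCons 0 p) h = (flat p (0 + h) - flat p 0) / h"
        by (auto simp: eventually_at_filter flat_def)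
    qed
    then show ?thesis using 3 by (simp add: DERIV_def flat_def)
  qed
qed

text \<open>A class of functions that contains all test functions used below and is closed under partial
  derivatives. Membership is therefore inherited by derivatives of every order.\<close>

inductive smooth_expr :: "('a::euclidean_space \<Rightarrow> real) \<Rightarrow> bool" where
  smooth_const: "smooth_expr (\<lambda>_. c)"
| smooth_inner: "smooth_expr (\<lambda>x. inner x e)"
| smooth_add: "smooth_expr \<phi> \<Longrightarrow> smooth_expr \<psi> \<Longrightarrow> smooth_expr (\<lambda>x. \<phi> x + \<psi> x)"
| smooth_mult: "smooth_expr \<phi> \<Longrightarrow> smooth_expr \<psi> \<Longrightarrow> smooth_expr (\<lambda>x. \<phi> x * \<psi> x)"
| smooth_cos: "smooth_expr \<phi> \<Longrightarrow> smooth_expr (\<lambda>x. cos (\<phi> x))"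
| smooth_flat: "smooth_expr \<phi> \<Longrightarrow> smooth_expr (\<lambda>x. flat p (\<phi> x))"

lemma smooth_expr_derivative:
  "smooth_expr \<phi> \<Longrightarrow> \<exists>\<phi>'. (\<forall>x. (\<phi> has_derivative \<phi>' x) (at x)) \<and> (\<forall>e. smooth_expr (\<lambda>x. \<phi>' x e))"
proof (induction rule: smooth_expr.induct)
  case (smooth_const c)
  show ?case
    by (rule exI[of _ "\<lambda>_ _. 0"]) (simp add: smooth_expr.smooth_const)
next
  case (smooth_inner e)
  show ?case
    by (rule exI[of _ "\<lambda>_ v. inner v e"])
       (auto intro!: smooth_expr.smooth_const derivative_eq_intros)
next
  case (smooth_add \<phi> \<psi>)
  then obtain \<phi>' \<psi>' where d: "\<And>x. (\<phi> has_derivative \<phi>' x) (at x)" "\<And>x. (\<psi> has_derivative \<psi>' x) (at x)"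
    and s: "\<And>e. smooth_expr (\<lambda>x. \<phi>' x e)" "\<And>e. smooth_expr (\<lambda>x. \<psi>' x e)" by blast
  show ?case
    by (rule exI[of _ "\<lambda>x v. \<phi>' x v + \<psi>' x v"])
       (auto intro!: smooth_expr.smooth_add s has_derivative_add d)
next
  case (smooth_mult \<phi> \<psi>)
  then obtain \<phi>' \<psi>' where d: "\<And>x. (\<phi> has_derivative \<phi>' x) (at x)" "\<And>x. (\<psi> has_derivative \<psi>' x) (at x)"
    and s: "\<And>e. smooth_expr (\<lambda>x. \<phi>' x e)" "\<And>e. smooth_expr (\<lambda>x. \<psi>' x e)" by blast
  show ?case
    by (rule exI[of _ "\<lambda>x v. \<phi> x * \<psi>' x v + \<phi>' x v * \<psi> x"])
       (auto intro!: smooth_expr.smooth_add smooth_expr.smooth_mult smooth_mult.hyps s has_derivative_mult d)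
next
  case (smooth_cos \<phi>)
  then obtain \<phi>' where d: "\<And>x. (\<phi> has_derivative \<phi>' x) (at x)"
    and s: "\<And>e. smooth_expr (\<lambda>x. \<phi>' x e)" by blast
  have "((\<lambda>x. cos (\<phi> x)) has_derivative (\<lambda>v. cos (\<phi> x + pi / 2) * \<phi>' x v)) (at x)" for x
    by (rule has_derivative_eq_rhs[OF has_derivative_cos[OF d]])
       (simp add: cos_add mult.commute)
  moreover have "smooth_expr (\<lambda>x. cos (\<phi> x + pi / 2) * \<phi>' x e)" for e
    by (intro smooth_expr.intros smooth_cos.hyps s)
  ultimately show ?case by (intro exI[of _ "\<lambda>x v. cos (\<phi> x + pi / 2) * \<phi>' x v"]) simp
next
  case (smooth_flat \<phi> p)
  then obtain \<phi>' where d: "\<And>x. (\<phi> has_derivative \<phi>' x) (at x)"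
    and s: "\<And>e. smooth_expr (\<lambda>x. \<phi>' x e)" by blast
  let ?p = "monom 1 2 * (p - pderiv p)"
  have "((\<lambda>x. flat p (\<phi> x)) has_derivative (\<lambda>v. flat ?p (\<phi> x) * \<phi>' x v)) (at x)" for x
    using has_derivative_compose[OF d flat_has_derivative[unfolded has_field_derivative_def]] .
  moreover have "smooth_expr (\<lambda>x. flat ?p (\<phi> x) * \<phi>' x e)" for e
    by (intro smooth_expr.intros smooth_flat.hyps s)
  ultimately show ?case by (intro exI[of _ "\<lambda>x v. flat ?p (\<phi> x) * \<phi>' x v"]) simp
qed

lemma smooth_expr_Ck: "smooth_expr \<phi> \<Longrightarrow> Ck_on k UNIV \<phi>"
proof (induction k arbitrary: \<phi>)
  case 0
  then obtain \<phi>' where "\<And>x. (\<phi> has_derivative \<phi>' x) (at x)"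
    using smooth_expr_derivative by blast
  then show ?case
    by (auto intro!: continuous_at_imp_continuous_on has_derivative_continuous)
next
  case (Suc k)
  obtain \<phi>' where "\<And>x. (\<phi> has_derivative \<phi>' x) (at x)" "\<And>e. smooth_expr (\<lambda>x. \<phi>' x e)"
    using smooth_expr_derivative[OF Suc.prems] by blast
  then show ?case using Suc.IH by (auto intro!: exI[of _ \<phi>'])
qed

lemma smooth_prod: "finite I \<Longrightarrow> (\<And>i. i \<in> I \<Longrightarrow> smooth_expr (\<phi> i)) \<Longrightarrow> smooth_expr (\<lambda>x. \<Prod>i\<in>I. \<phi> i x)"
  by (induction I rule: finite_induct) (auto intro: smooth_expr.intros)

lemma smooth_sin:
  assumes "smooth_expr \<phi>"
  shows "smooth_expr (\<lambda>x. sin (\<phi> x))"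
proof -
  have "smooth_expr (\<lambda>x. cos (\<phi> x + (- pi / 2)))"
    by (intro smooth_expr.intros assms)
  moreover have "cos (y + (- pi / 2)) = sin y" for y :: real
    by (simp add: cos_diff)
  ultimately show ?thesis by simp
qed

lemma smooth_affine: "smooth_expr (\<lambda>x. c * (inner x e) + d)"
  by (intro smooth_expr.intros)

lemma flat_one: "flat 1 y = (if 0 < y then exp (- (1 / y)) else 0)"
  by (simp add: flat_def)

lemma flat_one_bounds: "0 \<le> flat 1 y" "flat 1 y \<le> 1"
  by (auto simp: flat_one)

lemma flat_one_tendsto_indicator: "(\<lambda>n. flat 1 (real n * y)) \<longlonglongrightarrow> (if 0 < y then 1 else 0)"
proof (cases "0 < y")
  case True
  have "(\<lambda>n. exp (- (1 / (real n * y)))) \<longlonglongrightarrow> exp 0"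
  proof (intro tendsto_exp)
    have "(\<lambda>n. - (1 / y) * (1 / real n)) \<longlonglongrightarrow> - (1 / y) * 0"
      by (intro tendsto_mult_left lim_1_over_n)
    then show "(\<lambda>n. - (1 / (real n * y))) \<longlonglongrightarrow> 0" by (simp add: mult.commute)
  qed
  then have "(\<lambda>n. flat 1 (real n * y)) \<longlonglongrightarrow> exp 0"
    by (rule Lim_transform_eventually)
       (use True in \<open>auto simp: flat_one eventually_at_top_linorder intro!: exI[of _ 1]\<close>)
  then show ?thesis using True by simp
next
  case False
  then have "flat 1 (real n * y) = 0" for n by (auto simp: flat_one zero_less_mult_iff)
  then show ?thesis using False by simp
qed

text \<open>The indicator function of a box inside the domain is a bounded pointwise limit of test functions.
  The factor for a coordinate \<open>t\<close> is positive exactly for \<open>a < t < b\<close>; in the periodic case it is the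
  product \<open>sin (\<pi> (t - a) / l) sin (\<pi> (b - t) / l)\<close>, which has period \<open>l\<close>.\<close>

lemma box_indicator_limit_of_test_functions:
  assumes dom: "admissible_domain \<Omega> bc" and ab: "cbox a b \<subseteq> \<Omega>" "box a b \<noteq> {}"
  shows "\<exists>\<phi>. (\<forall>n. test_function \<Omega> bc (\<phi> n)) \<and> (\<forall>n x. 0 \<le> \<phi> n x \<and> \<phi> n x \<le> 1) \<and>
    (\<forall>x\<in>\<Omega>. (\<lambda>n. \<phi> n x) \<longlonglongrightarrow> (indicator (box a b) x :: real))"
proof -
  define \<rho> where "\<rho> = (\<lambda>e x. case bc of
      Neumann \<Rightarrow> (inner x e - inner a e) * (inner b e - inner x e)
    | Periodic l \<Rightarrow> sin (pi / inner l e * inner x e + - (pi / inner l e * inner a e))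
        * sin (- (pi / inner l e) * inner x e + pi / inner l e * inner b e))"
  define \<phi> where "\<phi> n x = (\<Prod>e\<in>Basis. flat 1 (real n * \<rho> e x))" for n x
  have less: "inner a e < inner b e" if "e \<in> Basis" for e
    using ab(2) that by (simp add: box_ne_empty)
  have pos: "0 < (t - a') * (b' - t) \<longleftrightarrow> a' < t \<and> t < b'" if "a' < b'" for t a' b' :: real
    using that by (auto simp: zero_less_mult_iff)
  have pos_iff: "0 < \<rho> e x \<longleftrightarrow> inner a e < inner x e \<and> inner x e < inner b e"
    if e: "e \<in> Basis" and x: "bc = Neumann \<or> x \<in> \<Omega>" for e x
  proof (cases bc)
    case Neumann
    then show ?thesis using pos[OF less[OF e]] by (simp add: \<rho>_def)
  next
    case (Periodic l)
    then obtain q where l: "0 < inner l e" and q: "\<Omega> = box q (q + l)" using dom e by auto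
    have "a \<in> cbox a b" "b \<in> cbox a b" using ab(2) box_ne_empty[of a b] by (auto simp: mem_box less_imp_le)
    then have in\<Omega>: "y \<in> {a, b, x} \<Longrightarrow> inner q e < inner y e \<and> inner y e < inner q e + inner l e" for y
    proof -
      assume "y \<in> {a, b, x}"
      then have "y \<in> \<Omega>" using ab(1) x Periodic \<open>a \<in> cbox a b\<close> \<open>b \<in> cbox a b\<close> by auto
      then show ?thesis using e unfolding q by (auto simp: mem_box inner_add_left)
    qed
    have sgn: "0 < sin (pi / inner l e * t) \<longleftrightarrow> 0 < t" "sin (pi / inner l e * t) < 0 \<longleftrightarrow> t < 0"
      if t: "- inner l e < t" "t < inner l e" for t
    proof -
      have p: "0 < sin (pi / inner l e * t)" if "0 < t" "t < inner l e" for t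
        using that l by (intro sin_gt_zero) (auto simp: field_simps)
      have m: "sin (pi / inner l e * t) < 0" if "t < 0" "- inner l e < t" for t
        using p[of "- t"] that by simp
      show "0 < sin (pi / inner l e * t) \<longleftrightarrow> 0 < t" "sin (pi / inner l e * t) < 0 \<longleftrightarrow> t < 0"
        using p[of t] m[of t] t by (cases t "0 :: real" rule: linorder_cases; auto)+
    qed
    have "\<rho> e x = sin (pi / inner l e * (inner x e - inner a e)) * sin (pi / inner l e * (inner b e - inner x e))"
      using Periodic by (simp add: \<rho>_def right_diff_distrib)
    then have "0 < \<rho> e x \<longleftrightarrow> 0 < (inner x e - inner a e) * (inner b e - inner x e)"
      using in\<Omega>[of a] in\<Omega>[of b] in\<Omega>[of x] sgn[of "inner x e - inner a e"] sgn[of "inner b e - inner x e"]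
      by (simp add: zero_less_mult_iff)
    then show ?thesis using pos[OF less[OF e]] by simp
  qed
  have smooth: "smooth_expr (\<phi> n)" for n
  proof -
    have "smooth_expr (\<rho> e)" for e
    proof (cases bc)
      case Neumann
      have "smooth_expr (\<lambda>x. (1 * inner x e + - inner a e) * (- 1 * inner x e + inner b e))"
        by (intro smooth_mult smooth_affine)
      then show ?thesis using Neumann by (simp add: \<rho>_def algebra_simps)
    next
      case (Periodic l)
      have "smooth_expr (\<lambda>x. sin (pi / inner l e * inner x e + - (pi / inner l e * inner a e))
        * sin (- (pi / inner l e) * inner x e + pi / inner l e * inner b e))"
        by (intro smooth_mult smooth_sin smooth_affine)
      then show ?thesis using Periodic by (simp only: \<rho>_def boundary.case)
    qed
    then show ?thesis unfolding \<phi>_def by (intro smooth_prod smooth_flat smooth_mult smooth_const) auto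
  qed
  have test: "test_function \<Omega> bc (\<phi> n)" for n
  proof (cases bc)
    case Neumann
    have "{x. \<phi> n x \<noteq> 0} \<subseteq> box a b"
    proof
      fix x assume "x \<in> {x. \<phi> n x \<noteq> 0}"
      then have "\<forall>e\<in>Basis. 0 < \<rho> e x"
        by (auto simp: \<phi>_def flat_one zero_less_mult_iff split: if_splits)
      then show "x \<in> box a b" using pos_iff Neumann by (auto simp: mem_box)
    qed
    then have "{x. \<phi> n x \<noteq> 0} \<subseteq> cbox a b" using box_subset_cbox by blast
    then have "closure {x. \<phi> n x \<noteq> 0} \<subseteq> cbox a b" by (rule closure_minimal) (rule closed_cbox)
    moreover from \<open>{x. \<phi> n x \<noteq> 0} \<subseteq> cbox a b\<close> have "compact (closure {x. \<phi> n x \<noteq> 0})"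
      by (metis bounded_cbox bounded_subset compact_closure)
    ultimately have "compact (closure {x. \<phi> n x \<noteq> 0})" "closure {x. \<phi> n x \<noteq> 0} \<subseteq> \<Omega>"
      using ab(1) by auto
    then show ?thesis using Neumann smooth_expr_Ck[OF smooth] by simp
  next
    case (Periodic l)
    have per: "\<rho> e' (x + inner l e *\<^sub>R e) = \<rho> e' x" if e: "e \<in> Basis" "e' \<in> Basis" for x e e'
    proof (cases "e = e'")
      case False
      then have "inner (x + inner l e *\<^sub>R e) e' = inner x e'"
        using e by (simp add: inner_add_left inner_Basis)
      then show ?thesis by (simp only: \<rho>_def)
    next
      case True
      have l: "0 < inner l e" using Periodic dom e by auto
      have "inner (x + inner l e *\<^sub>R e) e' = inner x e' + inner l e'"
        using True e by (simp add: inner_add_left)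
      moreover have "pi / inner l e' * (t + inner l e') + c = (pi / inner l e' * t + c) + pi"
        "- (pi / inner l e') * (t + inner l e') + c = (- (pi / inner l e') * t + c) - pi" for t c
        using l True by (simp_all add: field_simps)
      ultimately show ?thesis
        using Periodic by (simp only: \<rho>_def boundary.case sin_periodic_pi sin_minus_pi)
    qed
    have "\<phi> n (x + inner l e *\<^sub>R e) = \<phi> n x" if "e \<in> Basis" for x e
      unfolding \<phi>_def using per[OF that] by (intro prod.cong) auto
    then show ?thesis using Periodic smooth_expr_Ck[OF smooth] by simp
  qed
  have "(\<lambda>n. \<phi> n x) \<longlonglongrightarrow> indicator (box a b) x" if x: "x \<in> \<Omega>" for x
  proof -
    have "(\<lambda>n. \<phi> n x) \<longlonglongrightarrow> (\<Prod>e\<in>Basis. if 0 < \<rho> e x then 1 else 0)"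
      unfolding \<phi>_def by (intro tendsto_prod flat_one_tendsto_indicator)
    also have "(\<Prod>e\<in>Basis. if 0 < \<rho> e x then 1 else 0) = (indicator (box a b) x :: real)"
      using pos_iff x by (auto simp: indicator_def mem_box intro!: prod.neutral prod_zero)
    finally show ?thesis .
  qed
  moreover have "0 \<le> \<phi> n x \<and> \<phi> n x \<le> 1" for n x
    unfolding \<phi>_def by (auto intro!: prod_nonneg prod_le_1 flat_one_bounds)
  ultimately show ?thesis using test by blast
qed

section \<open>The fundamental lemma of the calculus of variations\<close>

text \<open>Boxes form an intersection-stable generator of the Borel sets.\<close>

lemma AE_zero_if_box_integrals_zero:
  fixes k :: "'a::euclidean_space \<Rightarrow> real"
  assumes k: "integrable lborel k" and total: "integral\<^sup>L lborel k = 0"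
    and box: "\<And>a b. (LINT x:box a b|lborel. k x) = 0"
  shows "AE x in lborel. k x = 0"
proof (rule density_unique_real[OF k integrable_zero])
  fix A :: "'a set" assume "A \<in> sets lborel"
  then have A: "A \<in> sigma_sets UNIV (range (\<lambda>(a, b). box a b))"
    by (simp add: borel_eq_box)
  have "Int_stable (range (\<lambda>(a, b). box a b :: 'a set))"
    by (auto simp: Int_stable_def box_Int_box)
  moreover have "range (\<lambda>(a, b). box a b :: 'a set) \<subseteq> Pow UNIV" by simp
  ultimately have "(LINT x:A|lborel. k x) = 0" using A
  proof (induction rule: sigma_sets_induct_disjoint)
    case (basic A)
    then show ?case using box by auto
  next
    case empty
    then show ?case by (simp add: set_lebesgue_integral_def)
  next
    case (compl A)
    then have A: "A \<in> sets lborel" by (simp add: borel_eq_box)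
    have "(LINT x:UNIV - A|lborel. k x) = (LINT x|lborel. k x - indicator A x *\<^sub>R k x)"
      unfolding set_lebesgue_integral_def
      by (intro Bochner_Integration.integral_cong) (auto simp: indicator_def)
    also have "\<dots> = (LINT x|lborel. k x) - (LINT x:A|lborel. k x)"
      unfolding set_lebesgue_integral_def using k A
      by (intro Bochner_Integration.integral_diff integrable_mult_indicator)
    finally have "(LINT x:UNIV - A|lborel. k x) = (LINT x|lborel. k x) - (LINT x:A|lborel. k x)" .
    then show ?case using compl total by simp
  next
    case (union A)
    then have A: "A i \<in> sets lborel" for i by (auto simp: borel_eq_box)
    have "set_integrable lborel (\<Union>i. A i) k"
      unfolding set_integrable_def using k A by (intro integrable_mult_indicator) auto
    then have "(LINT x:(\<Union>i. A i)|lborel. k x) = (\<Sum>i. (LINT x:A i|lborel. k x))"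
      using union(1) A
      by (intro lebesgue_integral_countable_add) (auto simp: disjoint_family_on_def)
    then show ?case using union by simp
  qed
  then show "(LINT x:A|lborel. k x) = (LINT x:A|lborel. 0)" by simp
qed

locale pde_domain =
  fixes \<Omega> :: "'a::euclidean_space set" and bc :: "'a boundary"
  assumes domain: "admissible_domain \<Omega> bc"
begin

abbreviation "M \<equiv> lebesgue_on \<Omega>"

lemma open_domain: "open \<Omega>" and bounded_domain: "bounded \<Omega>"
  using domain by (cases bc; auto)+

lemma domain_measurable [measurable]: "\<Omega> \<in> sets lebesgue"
  using open_domain by auto

lemma finite_measure_domain: "finite_measure M"
  by (rule finite_measure_lebesgue_on) (simp add: bounded_domain bounded_set_imp_lmeasurable)

text \<open>The fundamental lemma of the calculus of variations. Test functions approximate the indicators of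
  the boxes inside the domain, and countably many such boxes cover it.\<close>

lemma AE_zero_if_orthogonal_to_test_functions:
  fixes g :: "'a \<Rightarrow> real"
  assumes g: "integrable M g"
    and orth: "\<And>\<phi>. test_function \<Omega> bc \<phi> \<Longrightarrow> (LINT x|M. g x * \<phi> x) = 0"
  shows "AE x in M. g x = 0"
proof -
  have box0: "(LINT x|M. g x * indicator (box a b) x) = 0" if ab: "cbox a b \<subseteq> \<Omega>" for a b
  proof (cases "box a b = {}")
    case True
    then show ?thesis by simp
  next
    case False
    obtain \<phi> where \<phi>: "\<And>n. test_function \<Omega> bc (\<phi> n)" "\<And>n x. 0 \<le> \<phi> n x \<and> \<phi> n x \<le> 1"
      and lim: "\<And>x. x \<in> \<Omega> \<Longrightarrow> (\<lambda>n. \<phi> n x) \<longlonglongrightarrow> (indicator (box a b) x :: real)"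
      using box_indicator_limit_of_test_functions[OF domain ab False] by blast
    have "continuous_on UNIV (\<phi> n)" for n
      using \<phi>(1)[of n] Ck_on.simps(1)[of UNIV "\<phi> n"] by (cases bc) (auto simp del: Ck_on.simps)
    then have [measurable]: "\<phi> n \<in> borel_measurable M" for n
      by (intro measurable_restrict_space1 measurable_completion) (simp add: borel_measurable_continuous_onI)
    have [measurable]: "g \<in> borel_measurable M" using g by simp
    have [measurable]: "(indicator (box a b) :: 'a \<Rightarrow> real) \<in> borel_measurable M"
      by (intro measurable_restrict_space1 borel_measurable_indicator) simp
    have "(\<lambda>n. LINT x|M. g x * \<phi> n x) \<longlonglongrightarrow> (LINT x|M. g x * indicator (box a b) x)"
    proof (rule integral_dominated_convergence[where w = "\<lambda>x. \<bar>g x\<bar>"])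
      show "AE x in M. (\<lambda>n. g x * \<phi> n x) \<longlonglongrightarrow> g x * indicator (box a b) x"
        by (rule AE_I2) (intro tendsto_mult_left lim, simp)
      show "AE x in M. norm (g x * \<phi> n x) \<le> \<bar>g x\<bar>" for n
        using \<phi>(2)[of n] by (auto simp: abs_mult intro!: AE_I2 mult_left_le)
    qed (use g in auto)
    then show ?thesis using orth[OF \<phi>(1)] by (simp add: LIMSEQ_const_iff)
  qed
  have zero_in_box: "AE x in lebesgue. x \<in> cbox c d \<longrightarrow> g x = 0" if cd: "cbox c d \<subseteq> \<Omega>" for c d
  proof -
    define k where "k x = indicator (box c d) x * g x" for x
    have sub: "box c d \<subseteq> \<Omega>" using cd box_subset_cbox by blast
    have k_eq: "indicator \<Omega> x *\<^sub>R (indicator (box c d) x * g x) = k x" for x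
      using sub by (auto simp: k_def indicator_def)
    have box_meas: "box c d \<inter> \<Omega> \<in> sets M"
      using sub by (simp add: sets_restrict_space_iff Int_absorb2 inf.absorb1)
    have k_int: "integrable lebesgue k"
    proof -
      have "integrable M (\<lambda>x. indicator (box c d \<inter> \<Omega>) x *\<^sub>R g x)"
        by (rule integrable_mult_indicator[OF box_meas g])
      then have "integrable lebesgue (\<lambda>x. indicator \<Omega> x *\<^sub>R (indicator (box c d \<inter> \<Omega>) x *\<^sub>R g x))"
        by (subst (asm) integrable_restrict_space) auto
      moreover have "indicator \<Omega> x *\<^sub>R (indicator (box c d \<inter> \<Omega>) x *\<^sub>R g x) = k x" for x
        using sub by (auto simp: k_def indicator_def)
      ultimately show ?thesis by simp
    qed
    have k_box: "(LINT x|lebesgue. indicator (box a b) x * k x) = 0" for a b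
    proof -
      obtain a' b' where ab': "box a b \<inter> box c d = box a' b'" using box_Int_box[of a b c d] by blast
      have "(LINT x|lebesgue. indicator (box a b) x * k x)
          = (LINT x|lebesgue. indicator \<Omega> x *\<^sub>R (g x * indicator (box a' b') x))"
        using sub ab' by (intro Bochner_Integration.integral_cong) (auto simp: k_def indicator_def)
      also have "\<dots> = (LINT x|M. g x * indicator (box a' b') x)"
        by (rule integral_restrict_space[symmetric]) simp
      also have "\<dots> = 0"
      proof (cases "box a' b' = {}")
        case False
        then have "cbox a' b' = closure (box a' b')" by (simp add: closure_box)
        also have "\<dots> \<subseteq> closure (box c d)" using ab' by (intro closure_mono) auto
        also have "\<dots> \<subseteq> cbox c d" by (intro closure_minimal box_subset_cbox closed_cbox)
        finally show ?thesis using cd by (intro box0) auto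
      qed simp
      finally show ?thesis .
    qed
    \<comment> \<open>The generator argument needs a Borel function; a Lebesgue measurable one agrees with it almost
      everywhere.\<close>
    obtain k' where k': "k' \<in> borel_measurable lborel" and kk: "AE x in lborel. k x = k' x"
      using completion_ex_borel_measurable_real[of k lborel] k_int by auto
    have kk': "AE x in lebesgue. k x = k' x" using kk by (rule AE_completion)
    have km: "k \<in> borel_measurable lebesgue" using k_int by simp
    have k'm: "k' \<in> borel_measurable lebesgue" using k' by (rule measurable_completion)
    have "integrable lebesgue k'" using k_int kk' km k'm by (subst integrable_cong_AE[symmetric]) auto
    then have k'_int: "integrable lborel k'" using k' by (simp add: integrable_completion)
    have box': "(LINT x:box a b|lborel. k' x) = 0" for a b
    proof -
      have "(LINT x:box a b|lborel. k' x) = (LINT x|lebesgue. indicator (box a b) x * k' x)"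
        unfolding set_lebesgue_integral_def using k' by (subst integral_completion) auto
      also have "\<dots> = (LINT x|lebesgue. indicator (box a b) x * k x)"
      proof (rule integral_cong_AE)
        show "(\<lambda>x. indicator (box a b) x * k' x) \<in> borel_measurable lebesgue"
          "(\<lambda>x. indicator (box a b) x * k x) \<in> borel_measurable lebesgue"
          using km k'm by (intro borel_measurable_times borel_measurable_indicator; simp)+
        show "AE x in lebesgue. indicator (box a b) x * k' x = indicator (box a b) x * k x"
          using kk' by eventually_elim simp
      qed
      finally show ?thesis by (simp add: k_box)
    qed
    have "integral\<^sup>L lborel k' = (LINT x|lebesgue. k' x)"
      using k' by (subst integral_completion) auto
    also have "\<dots> = (LINT x|lebesgue. indicator (box c d) x * k x)"
    proof -
      have "(\<lambda>x. indicator (box c d) x * k x) = k" by (auto simp: k_def indicator_def)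
      then show ?thesis using kk' km k'm by (simp only:) (intro integral_cong_AE, auto)
    qed
    also have "\<dots> = 0" by (rule k_box)
    finally have "AE x in lborel. k' x = 0"
      using k'_int box' by (intro AE_zero_if_box_integrals_zero) auto
    then have "AE x in lebesgue. k x = 0" using kk by (intro AE_completion) auto
    moreover have "AE x in lebesgue. x \<notin> cbox c d - box c d"
      by (rule AE_not_in) (simp add: negligible_frontier_interval flip: negligible_iff_null_sets)
    ultimately show ?thesis by eventually_elim (auto simp: k_def indicator_def split: if_splits)
  qed
  obtain \<D> where D: "countable \<D>" "\<D> \<subseteq> Pow \<Omega>" "\<And>X. X \<in> \<D> \<Longrightarrow> \<exists>a b. X = cbox a b" "\<Union>\<D> = \<Omega>"
    using open_countable_Union_open_cbox[OF open_domain] by metis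
  have "AE x in lebesgue. \<forall>X\<in>\<D>. x \<in> X \<longrightarrow> g x = 0"
  proof (subst AE_ball_countable[OF D(1)], intro ballI)
    fix X assume X: "X \<in> \<D>"
    then obtain a b where "X = cbox a b" using D(3) by blast
    then show "AE x in lebesgue. x \<in> X \<longrightarrow> g x = 0" using zero_in_box[of a b] X D(2) by blast
  qed
  then have "AE x in lebesgue. x \<in> \<Omega> \<longrightarrow> g x = 0"
    by eventually_elim (use D(4) in blast)
  then show ?thesis by (simp add: AE_restrict_space_iff)
qed

end

section \<open>Weak gradients and Galerkin eigenbases\<close>

context pde_domain
begin

lemma L2_fun_measurable: "L2_fun \<Omega> v \<Longrightarrow> v \<in> borel_measurable M"
  by (simp add: L2_fun_def)

lemma L2_inner_integrable:
  fixes u v :: "'a \<Rightarrow> 'b::euclidean_space"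
  assumes u: "L2_fun \<Omega> u" and v: "L2_fun \<Omega> v"
  shows "integrable M (\<lambda>x. inner (u x) (v x))"
proof (rule Bochner_Integration.integrable_bound)
  show "integrable M (\<lambda>x. (norm (u x))\<^sup>2 + (norm (v x))\<^sup>2)"
    using u v by (intro Bochner_Integration.integrable_add) (auto simp: L2_fun_def)
  show "(\<lambda>x. inner (u x) (v x)) \<in> borel_measurable M"
    using u v by (intro borel_measurable_inner L2_fun_measurable)
  show "AE x in M. norm (inner (u x) (v x)) \<le> norm ((norm (u x))\<^sup>2 + (norm (v x))\<^sup>2)"
  proof (rule AE_I2)
    fix x
    have "2 * norm (u x) * norm (v x) \<le> (norm (u x))\<^sup>2 + (norm (v x))\<^sup>2"
      by (rule sum_squares_bound)
    moreover have "0 \<le> norm (u x) * norm (v x)" by simp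
    ultimately show "norm (inner (u x) (v x)) \<le> norm ((norm (u x))\<^sup>2 + (norm (v x))\<^sup>2)"
      using Cauchy_Schwarz_ineq2[of "u x" "v x"] by simp
  qed
qed

lemma L2_mult_integrable:
  fixes u v :: "'a \<Rightarrow> real"
  shows "L2_fun \<Omega> u \<Longrightarrow> L2_fun \<Omega> v \<Longrightarrow> integrable M (\<lambda>x. u x * v x)"
  using L2_inner_integrable[of u v] by simp

lemma L2_add:
  fixes u v :: "'a \<Rightarrow> 'b::euclidean_space"
  assumes u: "L2_fun \<Omega> u" and v: "L2_fun \<Omega> v"
  shows "L2_fun \<Omega> (\<lambda>x. u x + v x)"
proof -
  have "integrable M (\<lambda>x. (norm (u x))\<^sup>2 + 2 * inner (u x) (v x) + (norm (v x))\<^sup>2)"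
    using u v L2_inner_integrable[OF u v]
    by (intro Bochner_Integration.integrable_add integrable_mult_right) (auto simp: L2_fun_def)
  moreover have "(norm (u x + v x))\<^sup>2 = (norm (u x))\<^sup>2 + 2 * inner (u x) (v x) + (norm (v x))\<^sup>2" for x
    by (simp add: power2_norm_eq_inner inner_add_left inner_add_right inner_commute)
  ultimately show ?thesis
    using u v by (simp add: L2_fun_def borel_measurable_add)
qed

lemma L2_scale:
  fixes u :: "'a \<Rightarrow> 'b::euclidean_space"
  assumes u: "L2_fun \<Omega> u"
  shows "L2_fun \<Omega> (\<lambda>x. c *\<^sub>R u x)"
  using u by (auto simp: L2_fun_def power_mult_distrib borel_measurable_scaleR)

lemma L2_zero: "L2_fun \<Omega> (\<lambda>_. 0 :: 'b::euclidean_space)"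
  by (simp add: L2_fun_def)

lemma L2_sum:
  fixes u :: "'i \<Rightarrow> 'a \<Rightarrow> 'b::euclidean_space"
  assumes "finite I" "\<And>i. i \<in> I \<Longrightarrow> L2_fun \<Omega> (u i)"
  shows "L2_fun \<Omega> (\<lambda>x. \<Sum>i\<in>I. u i x)"
  using assms by (induction I rule: finite_induct) (auto simp: L2_zero L2_add)

lemma L2_diff:
  fixes u v :: "'a \<Rightarrow> 'b::euclidean_space"
  assumes u: "L2_fun \<Omega> u" and v: "L2_fun \<Omega> v"
  shows "L2_fun \<Omega> (\<lambda>x. u x - v x)"
  using L2_add[OF u L2_scale[OF v, of "- 1"]] by simp

lemma L2_mult_const:
  fixes u :: "'a \<Rightarrow> real"
  assumes u: "L2_fun \<Omega> u"
  shows "L2_fun \<Omega> (\<lambda>x. c * u x)"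
  using L2_scale[OF u, of c] by simp

lemma L2_dominated:
  fixes u :: "'a \<Rightarrow> 'b::euclidean_space" and v :: "'a \<Rightarrow> 'c::euclidean_space"
  assumes v: "L2_fun \<Omega> v" and u: "u \<in> borel_measurable M"
    and le: "AE x in M. norm (u x) \<le> B * norm (v x)"
  shows "L2_fun \<Omega> u"
proof -
  have "integrable M (\<lambda>x. (norm (u x))\<^sup>2)"
  proof (rule Bochner_Integration.integrable_bound)
    show "integrable M (\<lambda>x. B\<^sup>2 * (norm (v x))\<^sup>2)" using v by (simp add: L2_fun_def)
    show "(\<lambda>x. (norm (u x))\<^sup>2) \<in> borel_measurable M"
      using u by simp
    show "AE x in M. norm ((norm (u x))\<^sup>2) \<le> norm (B\<^sup>2 * (norm (v x))\<^sup>2)"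
      using le
    proof eventually_elim
      fix x assume "norm (u x) \<le> B * norm (v x)"
      then have "(norm (u x))\<^sup>2 \<le> (B * norm (v x))\<^sup>2" by (intro power_mono) auto
      then show "norm ((norm (u x))\<^sup>2) \<le> norm (B\<^sup>2 * (norm (v x))\<^sup>2)"
        by (simp add: power_mult_distrib)
    qed
  qed
  then show ?thesis using u by (simp add: L2_fun_def)
qed

lemma L2_continuous:
  fixes \<psi> :: "'a \<Rightarrow> real"
  assumes "continuous_on UNIV \<psi>"
  shows "L2_fun \<Omega> \<psi>"
proof -
  interpret finite_measure M by (rule finite_measure_domain)
  have "compact (closure \<Omega>)" using bounded_domain by simp
  then have "bounded (\<psi> ` closure \<Omega>)"
    using assms by (intro compact_imp_bounded compact_continuous_image) (auto intro: continuous_on_subset)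
  then obtain B where B: "\<And>x. x \<in> \<Omega> \<Longrightarrow> norm (\<psi> x) \<le> B"
    using closure_subset[of \<Omega>] unfolding bounded_iff by blast
  have m: "\<psi> \<in> borel_measurable M"
    by (intro measurable_restrict_space1 measurable_completion) (simp add: borel_measurable_continuous_onI assms)
  have "L2_fun \<Omega> (\<lambda>_. 1 :: real)" by (simp add: L2_fun_def)
  then show ?thesis
    using m B by (rule_tac L2_dominated[where B = B]) (auto intro!: AE_I2)
qed

lemma L2_component:
  assumes "L2_fun \<Omega> (g :: 'a \<Rightarrow> 'a)"
  shows "L2_fun \<Omega> (\<lambda>x. inner (g x) e)"
proof (rule L2_dominated[OF assms, where B = "norm e"])
  show "(\<lambda>x. inner (g x) e) \<in> borel_measurable M"
    using L2_fun_measurable[OF assms] by (intro borel_measurable_inner) auto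
  show "AE x in M. norm (inner (g x) e) \<le> norm e * norm (g x)"
  proof (rule AE_I2)
    fix x show "norm (inner (g x) e) \<le> norm e * norm (g x)"
      using Cauchy_Schwarz_ineq2[of "g x" e] by (simp add: mult.commute)
  qed
qed

lemma L2_null:
  fixes v :: "'a \<Rightarrow> 'b::euclidean_space"
  assumes "L2_fun \<Omega> v" "(LINT x|M. inner (v x) (v x)) = 0"
  shows "AE x in M. v x = 0"
proof -
  have "AE x in M. inner (v x) (v x) = 0"
    using assms L2_inner_integrable[OF assms(1) assms(1)]
    by (subst integral_nonneg_eq_0_iff_AE[symmetric]) auto
  then show ?thesis by simp
qed

lemma test_function_L2:
  assumes "test_function \<Omega> bc \<phi>"
  shows "L2_fun \<Omega> \<phi>" and "e \<in> Basis \<Longrightarrow> L2_fun \<Omega> (\<lambda>x. frechet_derivative \<phi> (at x) e)"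
proof -
  have Ck: "Ck_on k UNIV \<phi>" for k using assms by (cases bc) auto
  from Ck[of 0] show "L2_fun \<Omega> \<phi>" by (intro L2_continuous) simp
  from Ck[of 1] obtain g' where g': "\<And>x. (\<phi> has_derivative g' x) (at x)"
    and c: "\<And>e. e \<in> Basis \<Longrightarrow> continuous_on UNIV (\<lambda>x. g' x e)" by auto
  have "frechet_derivative \<phi> (at x) = g' x" for x
    using frechet_derivative_at[OF g'] by simp
  then show "e \<in> Basis \<Longrightarrow> L2_fun \<Omega> (\<lambda>x. frechet_derivative \<phi> (at x) e)"
    using c by (auto intro: L2_continuous)
qed

lemma weak_grad_unique:
  assumes g: "is_weak_grad \<Omega> bc v g" and h: "is_weak_grad \<Omega> bc v h"
  shows "AE x in M. g x = h x"
proof -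
  interpret finite_measure M by (rule finite_measure_domain)
  have d: "L2_fun \<Omega> (\<lambda>x. g x - h x)" using g h by (intro L2_diff) (auto simp: is_weak_grad_def)
  have "AE x in M. inner (g x - h x) e = 0" if e: "e \<in> Basis" for e
  proof (rule AE_zero_if_orthogonal_to_test_functions)
    have "integrable M (\<lambda>x. inner (g x - h x) e * 1)"
      by (intro L2_mult_integrable L2_component d L2_continuous) auto
    then show "integrable M (\<lambda>x. inner (g x - h x) e)" by simp
    fix \<phi> assume \<phi>: "test_function \<Omega> bc \<phi>"
    have "(LINT x|M. inner (g x) e * \<phi> x) = (LINT x|M. inner (h x) e * \<phi> x)"
    proof -
      have "- (LINT x|M. inner (g x) e * \<phi> x) = - (LINT x|M. inner (h x) e * \<phi> x)"
        using g h \<phi> e by (simp add: is_weak_grad_def)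
      then show ?thesis by simp
    qed
    moreover have "integrable M (\<lambda>x. inner (g x) e * \<phi> x)" "integrable M (\<lambda>x. inner (h x) e * \<phi> x)"
    proof -
      have "L2_fun \<Omega> g" "L2_fun \<Omega> h" using g h by (auto simp: is_weak_grad_def)
      then show "integrable M (\<lambda>x. inner (g x) e * \<phi> x)" "integrable M (\<lambda>x. inner (h x) e * \<phi> x)"
        using test_function_L2(1)[OF \<phi>] by (intro L2_mult_integrable L2_component; simp)+
    qed
    ultimately show "(LINT x|M. inner (g x - h x) e * \<phi> x) = 0"
      by (simp add: inner_diff_left left_diff_distrib)
  qed
  then have "AE x in M. \<forall>e\<in>Basis. inner (g x - h x) e = 0"
    by (intro AE_finite_allI) auto
  then show ?thesis
    by eventually_elim (metis euclidean_all_zero_iff right_minus_eq)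
qed

lemma weak_grad_exists: "H1_fun \<Omega> bc v \<Longrightarrow> is_weak_grad \<Omega> bc v (weak_grad \<Omega> bc v)"
  unfolding H1_fun_def weak_grad_def by (erule exE) (rule someI[of "is_weak_grad \<Omega> bc v"])

lemma H1_L2: "H1_fun \<Omega> bc v \<Longrightarrow> L2_fun \<Omega> v" and weak_grad_L2: "H1_fun \<Omega> bc v \<Longrightarrow> L2_fun \<Omega> (weak_grad \<Omega> bc v)"
  using weak_grad_exists[of v] by (auto simp: is_weak_grad_def)

lemma is_weak_grad_lincomb:
  assumes v: "is_weak_grad \<Omega> bc v g" and w: "is_weak_grad \<Omega> bc w h"
  shows "is_weak_grad \<Omega> bc (\<lambda>x. v x + c * w x) (\<lambda>x. g x + c *\<^sub>R h x)"
  unfolding is_weak_grad_def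
proof (intro conjI allI impI ballI)
  have L2: "L2_fun \<Omega> v" "L2_fun \<Omega> w" "L2_fun \<Omega> g" "L2_fun \<Omega> h"
    using v w by (auto simp: is_weak_grad_def)
  show "L2_fun \<Omega> (\<lambda>x. v x + c * w x)" using L2 by (intro L2_add L2_mult_const)
  show "L2_fun \<Omega> (\<lambda>x. g x + c *\<^sub>R h x)" using L2 by (intro L2_add L2_scale)
  fix \<phi> and e :: 'a assume \<phi>: "test_function \<Omega> bc \<phi>" and e: "e \<in> Basis"
  let ?d = "\<lambda>x. frechet_derivative \<phi> (at x) e"
  have int: "integrable M (\<lambda>x. v x * ?d x)" "integrable M (\<lambda>x. w x * ?d x)"
      "integrable M (\<lambda>x. inner (g x) e * \<phi> x)" "integrable M (\<lambda>x. inner (h x) e * \<phi> x)"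
    using L2 test_function_L2(1)[OF \<phi>] test_function_L2(2)[OF \<phi> e]
    by (intro L2_mult_integrable L2_component; simp)+
  have "(LINT x|M. (v x + c * w x) * ?d x) = (LINT x|M. v x * ?d x + c * (w x * ?d x))"
    by (simp add: algebra_simps)
  also have "\<dots> = (LINT x|M. v x * ?d x) + c * (LINT x|M. w x * ?d x)"
    using int by simp
  also have "\<dots> = - ((LINT x|M. inner (g x) e * \<phi> x) + c * (LINT x|M. inner (h x) e * \<phi> x))"
    using v w \<phi> e by (simp add: is_weak_grad_def)
  also have "(LINT x|M. inner (g x) e * \<phi> x) + c * (LINT x|M. inner (h x) e * \<phi> x)
      = (LINT x|M. inner (g x) e * \<phi> x + c * (inner (h x) e * \<phi> x))"
    using int by simp
  also have "\<dots> = (LINT x|M. inner (g x + c *\<^sub>R h x) e * \<phi> x)"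
    by (simp add: inner_add_left algebra_simps)
  finally show "(LINT x|M. (v x + c * w x) * ?d x) = - (LINT x|M. inner (g x + c *\<^sub>R h x) e * \<phi> x)" .
qed

lemma is_weak_grad_zero: "is_weak_grad \<Omega> bc (\<lambda>_. 0) (\<lambda>_. 0)"
  by (simp add: is_weak_grad_def L2_zero)

lemma is_weak_grad_sum:
  assumes "finite I" "\<And>i. i \<in> I \<Longrightarrow> H1_fun \<Omega> bc (b i)"
  shows "is_weak_grad \<Omega> bc (\<lambda>x. \<Sum>i\<in>I. c i * b i x) (\<lambda>x. \<Sum>i\<in>I. c i *\<^sub>R weak_grad \<Omega> bc (b i) x)"
  using assms
proof (induction I rule: finite_induct)
  case empty
  then show ?case by (simp add: is_weak_grad_zero)
next
  case (insert i I)
  then have "is_weak_grad \<Omega> bc (\<lambda>x. (\<Sum>i\<in>I. c i * b i x) + c i * b i x)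
      (\<lambda>x. (\<Sum>i\<in>I. c i *\<^sub>R weak_grad \<Omega> bc (b i) x) + c i *\<^sub>R weak_grad \<Omega> bc (b i) x)"
    by (intro is_weak_grad_lincomb weak_grad_exists) auto
  then show ?case using insert by (simp add: add.commute)
qed

lemma H1_sum: "finite I \<Longrightarrow> (\<And>i. i \<in> I \<Longrightarrow> H1_fun \<Omega> bc (b i)) \<Longrightarrow> H1_fun \<Omega> bc (\<lambda>x. \<Sum>i\<in>I. c i * b i x)"
  using is_weak_grad_sum[of I b c] by (auto simp: H1_fun_def)

lemma H1_diff: "H1_fun \<Omega> bc v \<Longrightarrow> H1_fun \<Omega> bc w \<Longrightarrow> H1_fun \<Omega> bc (\<lambda>x. v x - w x)"
  using is_weak_grad_lincomb[OF weak_grad_exists weak_grad_exists, of v w "- 1"] by (auto simp: H1_fun_def)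

text \<open>The \<open>L\<^sup>2\<close> product and the Dirichlet form. The latter is bilinear on \<open>H\<^sup>1\<close> because weak gradients are
  unique up to null sets.\<close>

definition ip :: "('a \<Rightarrow> real) \<Rightarrow> ('a \<Rightarrow> real) \<Rightarrow> real" where
  "ip v w = (LINT x|M. v x * w x)"

definition gip :: "('a \<Rightarrow> real) \<Rightarrow> ('a \<Rightarrow> real) \<Rightarrow> real" where
  "gip v w = (LINT x|M. inner (weak_grad \<Omega> bc v x) (weak_grad \<Omega> bc w x))"

lemma ip_commute: "ip v w = ip w v"
  by (simp add: ip_def mult.commute)

lemma gip_commute: "gip v w = gip w v"
  by (simp add: gip_def inner_commute)

lemma ip_self_nonneg: "0 \<le> ip v v"
  by (simp add: ip_def)

lemma gip_self_nonneg: "0 \<le> gip v v"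
  by (simp add: gip_def)

lemma ip_sum_right:
  assumes "finite I" "\<And>i. i \<in> I \<Longrightarrow> L2_fun \<Omega> (b i)" "L2_fun \<Omega> v"
  shows "ip v (\<lambda>x. \<Sum>i\<in>I. c i * b i x) = (\<Sum>i\<in>I. c i * ip v (b i))"
proof -
  have "integrable M (\<lambda>x. v x * b i x)" if "i \<in> I" for i
    using assms that by (intro L2_mult_integrable)
  then have "(LINT x|M. (\<Sum>i\<in>I. c i * (v x * b i x))) = (\<Sum>i\<in>I. c i * (LINT x|M. v x * b i x))"
    by (subst Bochner_Integration.integral_sum) auto
  then show ?thesis by (simp add: ip_def sum_distrib_left mult.left_commute)
qed

lemma gip_cong_AE:
  assumes "is_weak_grad \<Omega> bc w g" "L2_fun \<Omega> (weak_grad \<Omega> bc v)"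
  shows "gip v w = (LINT x|M. inner (weak_grad \<Omega> bc v x) (g x))"
proof -
  have H: "H1_fun \<Omega> bc w" using assms by (auto simp: H1_fun_def)
  have "AE x in M. weak_grad \<Omega> bc w x = g x"
    by (rule weak_grad_unique[OF weak_grad_exists[OF H] assms(1)])
  moreover have "g \<in> borel_measurable M" using assms by (auto simp: is_weak_grad_def L2_fun_def)
  ultimately show ?thesis
    unfolding gip_def using L2_fun_measurable[OF weak_grad_L2[OF H]] L2_fun_measurable[OF assms(2)]
    by (intro integral_cong_AE) auto
qed

lemma gip_sum_right:
  assumes I: "finite I" and b: "\<And>i. i \<in> I \<Longrightarrow> H1_fun \<Omega> bc (b i)" and v: "H1_fun \<Omega> bc v"
  shows "gip v (\<lambda>x. \<Sum>i\<in>I. c i * b i x) = (\<Sum>i\<in>I. c i * gip v (b i))"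
proof -
  have int: "integrable M (\<lambda>x. inner (weak_grad \<Omega> bc v x) (weak_grad \<Omega> bc (b i) x))" if "i \<in> I" for i
    using b v that by (intro L2_inner_integrable weak_grad_L2)
  have "gip v (\<lambda>x. \<Sum>i\<in>I. c i * b i x)
      = (LINT x|M. inner (weak_grad \<Omega> bc v x) (\<Sum>i\<in>I. c i *\<^sub>R weak_grad \<Omega> bc (b i) x))"
    by (intro gip_cong_AE is_weak_grad_sum I b weak_grad_L2 v)
  also have "\<dots> = (LINT x|M. (\<Sum>i\<in>I. c i * inner (weak_grad \<Omega> bc v x) (weak_grad \<Omega> bc (b i) x)))"
    by (simp add: inner_sum_right)
  also have "\<dots> = (\<Sum>i\<in>I. c i * gip v (b i))"
    unfolding gip_def using int by (subst Bochner_Integration.integral_sum) auto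
  finally show ?thesis .
qed

lemma H1_norm_eq: "H1_norm \<Omega> bc v = sqrt (ip v v + gip v v)"
  unfolding H1_norm_def ip_def gip_def power2_norm_eq_inner by (simp add: power2_eq_square)

text \<open>A null function has the zero function as a weak gradient.\<close>

lemma gip_null:
  assumes v: "H1_fun \<Omega> bc v" and "ip v v = 0"
  shows "gip v v = 0"
proof -
  have "AE x in M. v x = 0"
    using L2_null[OF H1_L2[OF v]] assms(2) by (simp add: ip_def)
  moreover have "v \<in> borel_measurable M" by (rule L2_fun_measurable[OF H1_L2[OF v]])
  ultimately have "(LINT x|M. v x * frechet_derivative \<phi> (at x) e) = 0" if "test_function \<Omega> bc \<phi>" "e \<in> Basis" for \<phi> e
  proof -
    have "AE x in M. v x * frechet_derivative \<phi> (at x) e = 0" using \<open>AE x in M. v x = 0\<close> by eventually_elim simp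
    then show ?thesis by (rule integral_eq_zero_AE)
  qed
  then have "is_weak_grad \<Omega> bc v (\<lambda>_. 0)"
    using H1_L2[OF v] by (simp add: is_weak_grad_def L2_zero)
  then have "gip v v = (LINT x|M. inner (weak_grad \<Omega> bc v x) (0 :: 'a))"
    by (rule gip_cong_AE[OF _ weak_grad_L2[OF v]])
  then show ?thesis by simp
qed

text \<open>A finite family of functions spans a space on which the gradient form is diagonal in an
  orthonormal basis. Testing weak equations between members of the family with this basis decouples
  them, so no spectral theory of the Laplacian is required.\<close>

theorem galerkin_eigenbasis:
  assumes S: "finite S" and H: "\<And>b. b \<in> S \<Longrightarrow> H1_fun \<Omega> bc b"
  obtains D :: "nat set" and \<psi> \<mu> where "finite D" "\<And>r. r \<in> D \<Longrightarrow> H1_fun \<Omega> bc (\<psi> r)" "\<And>r. r \<in> D \<Longrightarrow> 0 \<le> \<mu> r"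
    "\<And>r t. r \<in> D \<Longrightarrow> t \<in> D \<Longrightarrow> ip (\<psi> r) (\<psi> t) = (if r = t then 1 else 0)"
    "\<And>b r. b \<in> S \<Longrightarrow> r \<in> D \<Longrightarrow> gip b (\<psi> r) = \<mu> r * ip b (\<psi> r)"
    "\<And>b. b \<in> S \<Longrightarrow> ip b b = (\<Sum>r\<in>D. (ip b (\<psi> r))\<^sup>2)"
    "\<And>b. b \<in> S \<Longrightarrow> gip b b = (\<Sum>r\<in>D. \<mu> r * (ip b (\<psi> r))\<^sup>2)"
proof -
  define X where "X c = (\<lambda>x. \<Sum>b\<in>S. c b * b x)" for c :: "('a \<Rightarrow> real) \<Rightarrow> real"
  have XH: "H1_fun \<Omega> bc (X c)" for c unfolding X_def using S H by (rule H1_sum)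
  have ipX: "mat_app S ip c v = ip v (X c)" if "v \<in> S" for c v
    unfolding mat_app_def X_def
    using ip_sum_right[of S "\<lambda>b. b" v c] S H1_L2[OF H] that by (simp add: mult.commute)
  have gipX: "mat_app S gip c v = gip v (X c)" if "v \<in> S" for c v
    unfolding mat_app_def X_def
    using gip_sum_right[of S "\<lambda>b. b" v c] S H that by (simp add: mult.commute)
  have dipX: "dot S c (mat_app S ip d) = ip (X c) (X d)" for c d
  proof -
    have "ip (X d) (X c) = (\<Sum>b\<in>S. c b * ip (X d) b)"
      unfolding X_def[of c] using S H1_L2[OF H] H1_L2[OF XH] by (rule ip_sum_right)
    then show ?thesis
      by (simp add: dot_def ipX ip_commute[of "X d"] cong: sum.cong)
  qed
  have dgipX: "dot S c (mat_app S gip d) = gip (X c) (X d)" for c d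
  proof -
    have "gip (X d) (X c) = (\<Sum>b\<in>S. c b * gip (X d) b)"
      unfolding X_def[of c] using S H XH by (rule gip_sum_right)
    then show ?thesis
      by (simp add: dot_def gipX gip_commute[of "X d"] cong: sum.cong)
  qed
  have "\<exists>(D :: nat set) P mu. finite D \<and> (\<forall>r\<in>D. 0 \<le> mu r) \<and>
    (\<forall>r\<in>D. \<forall>t\<in>D. dot S (P r) (mat_app S ip (P t)) = (if r = t then 1 else 0)) \<and>
    (\<forall>a\<in>S. \<forall>r\<in>D. mat_app S gip (P r) a = mu r * mat_app S ip (P r) a) \<and>
    (\<forall>a\<in>S. ip a a = (\<Sum>r\<in>D. (mat_app S ip (P r) a)\<^sup>2)) \<and>
    (\<forall>a\<in>S. gip a a = (\<Sum>r\<in>D. mu r * (mat_app S ip (P r) a)\<^sup>2))"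
    by (rule gram_simultaneous_diagonalization[OF S])
       (auto simp: dipX dgipX ip_self_nonneg gip_self_nonneg ip_commute gip_commute intro: gip_null[OF XH])
  then obtain D :: "nat set" and P mu where raw: "finite D" "\<forall>r\<in>D. 0 \<le> mu r"
      "\<forall>r\<in>D. \<forall>t\<in>D. dot S (P r) (mat_app S ip (P t)) = (if r = t then 1 else 0)"
      "\<forall>a\<in>S. \<forall>r\<in>D. mat_app S gip (P r) a = mu r * mat_app S ip (P r) a"
      "\<forall>a\<in>S. ip a a = (\<Sum>r\<in>D. (mat_app S ip (P r) a)\<^sup>2)"
      "\<forall>a\<in>S. gip a a = (\<Sum>r\<in>D. mu r * (mat_app S ip (P r) a)\<^sup>2)"
    by (elim exE conjE)
  have o: "ip (X (P r)) (X (P t)) = (if r = t then 1 else 0)" if "r \<in> D" "t \<in> D" for r t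
    using raw(3) that by (simp add: dipX)
  have e: "gip a (X (P r)) = mu r * ip a (X (P r))" if "a \<in> S" "r \<in> D" for a r
    using raw(4) that by (simp add: ipX gipX)
  have m: "ip a a = (\<Sum>r\<in>D. (ip a (X (P r)))\<^sup>2)" if "a \<in> S" for a
    using raw(5) that by (simp add: ipX)
  have k: "gip a a = (\<Sum>r\<in>D. mu r * (ip a (X (P r)))\<^sup>2)" if "a \<in> S" for a
    using raw(6) that by (simp add: ipX)
  show thesis
    by (rule that[of D "\<lambda>r. X (P r)" mu]) (use raw(1,2) XH o e m k in auto)
qed

text \<open>Nonlinear terms need not belong to the Galerkin space; their coefficients are still controlled.\<close>

lemma bessel_inequality:
  assumes D: "finite (D :: nat set)" and \<psi>: "\<And>r. r \<in> D \<Longrightarrow> L2_fun \<Omega> (\<psi> r)"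
    and o: "\<And>r t. r \<in> D \<Longrightarrow> t \<in> D \<Longrightarrow> ip (\<psi> r) (\<psi> t) = (if r = t then 1 else 0)"
    and g: "L2_fun \<Omega> g"
  shows "(\<Sum>r\<in>D. (ip g (\<psi> r))\<^sup>2) \<le> ip g g"
proof -
  define c where "c r = ip g (\<psi> r)" for r
  define X where "X = (\<lambda>x. \<Sum>r\<in>D. c r * \<psi> r x)"
  have X: "L2_fun \<Omega> X" unfolding X_def using D \<psi> by (intro L2_sum L2_mult_const)
  have gX: "ip g X = (\<Sum>r\<in>D. (c r)\<^sup>2)"
    unfolding X_def using ip_sum_right[OF D \<psi> g] by (simp add: c_def power2_eq_square)
  have "ip X X = (\<Sum>r\<in>D. c r * ip X (\<psi> r))"
    by (subst (2) X_def) (rule ip_sum_right[OF D \<psi> X])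
  also have "\<dots> = (\<Sum>r\<in>D. (c r)\<^sup>2)"
  proof (intro sum.cong refl)
    fix r assume r: "r \<in> D"
    have "ip (\<psi> r) X = (\<Sum>t\<in>D. c t * ip (\<psi> r) (\<psi> t))"
      unfolding X_def by (rule ip_sum_right[OF D \<psi> \<psi>[OF r]])
    also have "\<dots> = (\<Sum>t\<in>D. if t = r then c r else 0)"
      using r by (intro sum.cong) (auto simp: o)
    finally show "c r * ip X (\<psi> r) = (c r)\<^sup>2"
      using D r by (simp add: ip_commute[of X] power2_eq_square)
  qed
  finally have XX: "ip X X = (\<Sum>r\<in>D. (c r)\<^sup>2)" .
  have "0 \<le> (LINT x|M. (g x - X x)\<^sup>2)" by simp
  also have "\<dots> = (LINT x|M. g x * g x - 2 * (g x * X x) + X x * X x)"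
    by (intro Bochner_Integration.integral_cong) (auto simp: power2_eq_square algebra_simps)
  also have "\<dots> = ip g g - 2 * ip g X + ip X X"
    unfolding ip_def using g X by (simp add: L2_mult_integrable)
  finally show ?thesis using gX XX by (simp add: c_def)
qed

end

section \<open>The error equations in an eigenbasis\<close>

context pde_domain
begin

lemma laplacian_exists: "lap_dom \<Omega> bc v \<Longrightarrow> is_laplacian \<Omega> bc v (lap \<Omega> bc v)"
  unfolding lap_dom_def lap_def by (erule exE) (rule someI[of "is_laplacian \<Omega> bc v"])

lemma lap_dom_H1: "lap_dom \<Omega> bc v \<Longrightarrow> H1_fun \<Omega> bc v"
  and lap_L2: "lap_dom \<Omega> bc v \<Longrightarrow> L2_fun \<Omega> (lap \<Omega> bc v)"
  using laplacian_exists[of v] by (auto simp: is_laplacian_def)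

lemma lap_dom_L2: "lap_dom \<Omega> bc v \<Longrightarrow> L2_fun \<Omega> v"
  by (rule H1_L2[OF lap_dom_H1])

lemma ip_lap: "lap_dom \<Omega> bc v \<Longrightarrow> H1_fun \<Omega> bc \<psi> \<Longrightarrow> ip (lap \<Omega> bc v) \<psi> = - gip v \<psi>"
  using laplacian_exists[of v] by (simp add: is_laplacian_def ip_def gip_def)

lemma ip_add_left:
  assumes "L2_fun \<Omega> u" "L2_fun \<Omega> v" "L2_fun \<Omega> w"
  shows "ip (\<lambda>x. u x + v x) w = ip u w + ip v w"
  using L2_mult_integrable[OF assms(1,3)] L2_mult_integrable[OF assms(2,3)]
  by (simp add: ip_def distrib_right)

lemma ip_diff_left:
  assumes "L2_fun \<Omega> u" "L2_fun \<Omega> v" "L2_fun \<Omega> w"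
  shows "ip (\<lambda>x. u x - v x) w = ip u w - ip v w"
  using L2_mult_integrable[OF assms(1,3)] L2_mult_integrable[OF assms(2,3)]
  by (simp add: ip_def left_diff_distrib)

lemma ip_scale_left: "ip (\<lambda>x. c * u x) w = c * ip u w"
  by (simp add: ip_def mult.assoc)

lemma ip_minus_left: "ip (\<lambda>x. - u x) w = - ip u w"
  using ip_scale_left[of "- 1"] by simp

lemma ip_sum_left:
  assumes "finite I" "\<And>i. i \<in> I \<Longrightarrow> L2_fun \<Omega> (b i)" "L2_fun \<Omega> v"
  shows "ip (\<lambda>x. \<Sum>i\<in>I. c i * b i x) v = (\<Sum>i\<in>I. c i * ip (b i) v)"
  using ip_sum_right[OF assms] by (simp add: ip_commute[of _ v])

lemma gip_diff_left:
  assumes v: "H1_fun \<Omega> bc v" and w: "H1_fun \<Omega> bc w" and \<psi>: "H1_fun \<Omega> bc \<psi>"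
  shows "gip (\<lambda>x. v x - w x) \<psi> = gip v \<psi> - gip w \<psi>"
proof -
  have "is_weak_grad \<Omega> bc (\<lambda>x. v x - w x) (\<lambda>x. weak_grad \<Omega> bc v x - weak_grad \<Omega> bc w x)"
    using is_weak_grad_lincomb[OF weak_grad_exists[OF v] weak_grad_exists[OF w], of "- 1"] by simp
  then have "gip \<psi> (\<lambda>x. v x - w x)
      = (LINT x|M. inner (weak_grad \<Omega> bc \<psi> x) (weak_grad \<Omega> bc v x - weak_grad \<Omega> bc w x))"
    by (rule gip_cong_AE[OF _ weak_grad_L2[OF \<psi>]])
  also have "\<dots> = gip \<psi> v - gip \<psi> w"
    unfolding gip_def inner_diff_right using v w \<psi>
    by (intro Bochner_Integration.integral_diff L2_inner_integrable weak_grad_L2)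
  finally show ?thesis by (simp add: gip_commute[of \<psi>])
qed

lemma L2_cong_AE_left:
  assumes "AE x in M. u x = v x" "L2_fun \<Omega> u" "L2_fun \<Omega> v" "L2_fun \<Omega> w"
  shows "ip u w = ip v w"
proof -
  have m: "u \<in> borel_measurable M" "v \<in> borel_measurable M" "w \<in> borel_measurable M"
    using assms by (auto simp: L2_fun_def)
  show ?thesis
    unfolding ip_def
  proof (rule integral_cong_AE)
    show "(\<lambda>x. u x * w x) \<in> borel_measurable M" "(\<lambda>x. v x * w x) \<in> borel_measurable M" using m by simp_all
    show "AE x in M. u x * w x = v x * w x" using assms(1) by eventually_elim simp
  qed
qed

lemma measurable_cong_AE:
  fixes u v :: "'a \<Rightarrow> real"
  assumes u: "u \<in> borel_measurable M" and eq: "AE x in M. u x = v x"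
  shows "v \<in> borel_measurable M"
proof -
  have "AE x in lebesgue. x \<in> \<Omega> \<longrightarrow> u x = v x"
    using eq by (simp add: AE_restrict_space_iff)
  then have "AE x in lebesgue. indicator \<Omega> x *\<^sub>R u x = indicator \<Omega> x *\<^sub>R v x"
    by eventually_elim (auto simp: indicator_def)
  moreover have "(\<lambda>x. indicator \<Omega> x *\<^sub>R u x) \<in> borel_measurable lebesgue"
    using u by (subst (asm) borel_measurable_restrict_space_iff) (auto simp: mult.commute)
  ultimately have "(\<lambda>x. indicator \<Omega> x *\<^sub>R v x) \<in> borel_measurable lebesgue"
    by (rule borel_measurable_AE[rotated])
  then show ?thesis
    by (subst borel_measurable_restrict_space_iff) (auto simp: mult.commute)
qed

text \<open>Functions that agree almost everywhere have the same set of weak gradients, so the choice in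
  \<open>weak_grad\<close> is the same for both.\<close>

lemma H1_norm_cong_AE:
  assumes u: "L2_fun \<Omega> u" and eq: "AE x in M. u x = v x"
  shows "H1_norm \<Omega> bc v = H1_norm \<Omega> bc u"
proof -
  have um: "u \<in> borel_measurable M" using u by (rule L2_fun_measurable)
  have vm: "v \<in> borel_measurable M" by (rule measurable_cong_AE[OF um eq])
  have "AE x in M. norm (v x) \<le> 1 * norm (u x)" using eq by eventually_elim simp
  then have v: "L2_fun \<Omega> v" by (rule L2_dominated[OF u vm])
  have "(LINT x|M. u x * frechet_derivative \<phi> (at x) e) = (LINT x|M. v x * frechet_derivative \<phi> (at x) e)"
    if "test_function \<Omega> bc \<phi>" "e \<in> Basis" for \<phi> e
    using L2_cong_AE_left[OF eq u v test_function_L2(2)[OF that]] by (simp add: ip_def)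
  then have "is_weak_grad \<Omega> bc u g = is_weak_grad \<Omega> bc v g" for g
    using u v by (auto simp: is_weak_grad_def)
  then have "weak_grad \<Omega> bc u = weak_grad \<Omega> bc v" by (simp add: weak_grad_def)
  moreover have "(LINT x|M. (u x)\<^sup>2) = (LINT x|M. (v x)\<^sup>2)"
  proof (rule integral_cong_AE)
    show "(\<lambda>x. (u x)\<^sup>2) \<in> borel_measurable M" "(\<lambda>x. (v x)\<^sup>2) \<in> borel_measurable M" using um vm by simp_all
    show "AE x in M. (u x)\<^sup>2 = (v x)\<^sup>2" using eq by eventually_elim simp
  qed
  ultimately show ?thesis by (simp add: H1_norm_def)
qed

lemma lipschitz_difference:
  assumes f: "L-lipschitz_on UNIV f" and v: "L2_fun \<Omega> v" and w: "L2_fun \<Omega> w"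
  shows "L2_fun \<Omega> (\<lambda>x. f (v x) - f (w x))"
    and "ip (\<lambda>x. f (v x) - f (w x)) (\<lambda>x. f (v x) - f (w x)) \<le> L\<^sup>2 * ip (\<lambda>x. v x - w x) (\<lambda>x. v x - w x)"
proof -
  have L: "0 \<le> L" using f by (rule lipschitz_on_nonneg)
  have fc: "f \<in> borel_measurable borel"
    by (intro borel_measurable_continuous_onI lipschitz_on_continuous_on[OF f])
  have [measurable]: "(\<lambda>x. f (v x)) \<in> borel_measurable M" "(\<lambda>x. f (w x)) \<in> borel_measurable M"
    using L2_fun_measurable[OF v] L2_fun_measurable[OF w] fc by (auto intro: measurable_compose)
  have le: "\<bar>f (v x) - f (w x)\<bar> \<le> L * \<bar>v x - w x\<bar>" for x
    using lipschitz_onD[OF f, of "v x" "w x"] by (simp add: dist_real_def)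
  show fL2: "L2_fun \<Omega> (\<lambda>x. f (v x) - f (w x))"
    by (rule L2_dominated[OF L2_diff[OF v w], where B = L]) (use le in auto)
  have "ip (\<lambda>x. f (v x) - f (w x)) (\<lambda>x. f (v x) - f (w x)) \<le> (LINT x|M. L\<^sup>2 * ((v x - w x) * (v x - w x)))"
    unfolding ip_def
  proof (rule integral_mono)
    show "integrable M (\<lambda>x. (f (v x) - f (w x)) * (f (v x) - f (w x)))"
      by (rule L2_mult_integrable[OF fL2 fL2])
    show "integrable M (\<lambda>x. L\<^sup>2 * ((v x - w x) * (v x - w x)))"
      using L2_mult_integrable[OF L2_diff[OF v w] L2_diff[OF v w]] by simp
    fix x
    have "\<bar>f (v x) - f (w x)\<bar>\<^sup>2 \<le> (L * \<bar>v x - w x\<bar>)\<^sup>2" using le by (intro power_mono) auto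
    then have "(f (v x) - f (w x))\<^sup>2 \<le> L\<^sup>2 * (v x - w x)\<^sup>2" by (simp add: power_mult_distrib)
    then show "(f (v x) - f (w x)) * (f (v x) - f (w x)) \<le> L\<^sup>2 * ((v x - w x) * (v x - w x))"
      by (simp only: power2_eq_square[of "f (v x) - f (w x)"] power2_eq_square[of "v x - w x"])
  qed
  then show "ip (\<lambda>x. f (v x) - f (w x)) (\<lambda>x. f (v x) - f (w x)) \<le> L\<^sup>2 * ip (\<lambda>x. v x - w x) (\<lambda>x. v x - w x)"
    by (simp add: ip_def)
qed

lemma Ds_op_L2: "lap_dom \<Omega> bc v \<Longrightarrow> L2_fun \<Omega> (Ds_op \<Omega> bc \<alpha> \<beta> v)"
  unfolding Ds_op_def by (intro L2_add L2_mult_const lap_L2 lap_dom_L2)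

lemma ip_Ds:
  assumes v: "lap_dom \<Omega> bc v" and \<psi>: "H1_fun \<Omega> bc \<psi>"
  shows "ip (Ds_op \<Omega> bc \<alpha> \<beta> v) \<psi> = (1 + \<alpha>) * gip v \<psi> + \<beta> * ip v \<psi>"
proof -
  have "ip (Ds_op \<Omega> bc \<alpha> \<beta> v) \<psi> = ip (\<lambda>x. - (1 + \<alpha>) * lap \<Omega> bc v x) \<psi> + ip (\<lambda>x. \<beta> * v x) \<psi>"
    unfolding Ds_op_def
    by (intro ip_add_left L2_mult_const lap_L2 lap_dom_L2 v H1_L2 \<psi>)
  also have "\<dots> = - (1 + \<alpha>) * ip (lap \<Omega> bc v) \<psi> + \<beta> * ip v \<psi>"
    by (simp only: ip_scale_left)
  finally show ?thesis using ip_lap[OF v \<psi>] by (simp add: algebra_simps)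
qed

lemma fs_op_L2:
  assumes "N_dom eqn \<Omega> bc f \<alpha> \<beta> v"
  shows "L2_fun \<Omega> (fs_op \<Omega> bc f \<alpha> \<beta> v)"
  using assms by (cases eqn) (auto simp: N_dom_def lap_dom_L2)

lemma ip_fs_difference:
  assumes f: "L-lipschitz_on UNIV f" and v: "lap_dom \<Omega> bc v" and w: "lap_dom \<Omega> bc w" and \<psi>: "H1_fun \<Omega> bc \<psi>"
  shows "ip (\<lambda>x. fs_op \<Omega> bc f \<alpha> \<beta> v x - fs_op \<Omega> bc f \<alpha> \<beta> w x) \<psi>
    = - ip (\<lambda>x. f (v x) - f (w x)) \<psi> + \<alpha> * gip (\<lambda>x. v x - w x) \<psi> + \<beta> * ip (\<lambda>x. v x - w x) \<psi>"
proof -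
  note L2 = lap_dom_L2[OF v] lap_dom_L2[OF w] lap_L2[OF v] lap_L2[OF w] H1_L2[OF \<psi>]
    lipschitz_difference(1)[OF f lap_dom_L2[OF v] lap_dom_L2[OF w]]
  have "ip (\<lambda>x. fs_op \<Omega> bc f \<alpha> \<beta> v x - fs_op \<Omega> bc f \<alpha> \<beta> w x) \<psi>
      = ip (\<lambda>x. (- 1 * (f (v x) - f (w x)) + (- \<alpha>) * (lap \<Omega> bc v x - lap \<Omega> bc w x)) + \<beta> * (v x - w x)) \<psi>"
    by (rule arg_cong[where f = "\<lambda>u. ip u \<psi>"]) (auto simp: fs_op_def algebra_simps)
  also have "\<dots> = ip (\<lambda>x. - 1 * (f (v x) - f (w x)) + (- \<alpha>) * (lap \<Omega> bc v x - lap \<Omega> bc w x)) \<psi>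
      + ip (\<lambda>x. \<beta> * (v x - w x)) \<psi>"
    by (intro ip_add_left L2_add L2_mult_const L2_diff L2)
  also have "ip (\<lambda>x. - 1 * (f (v x) - f (w x)) + (- \<alpha>) * (lap \<Omega> bc v x - lap \<Omega> bc w x)) \<psi>
      = ip (\<lambda>x. - 1 * (f (v x) - f (w x))) \<psi> + ip (\<lambda>x. (- \<alpha>) * (lap \<Omega> bc v x - lap \<Omega> bc w x)) \<psi>"
    by (intro ip_add_left L2_add L2_mult_const L2_diff L2)
  also have "ip (\<lambda>x. (- \<alpha>) * (lap \<Omega> bc v x - lap \<Omega> bc w x)) \<psi> = \<alpha> * gip (\<lambda>x. v x - w x) \<psi>"
    unfolding ip_scale_left ip_diff_left[OF L2(3,4,5)] gip_diff_left[OF lap_dom_H1[OF v] lap_dom_H1[OF w] \<psi>]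
      ip_lap[OF v \<psi>] ip_lap[OF w \<psi>] by (simp add: algebra_simps)
  finally show ?thesis by (simp only: ip_scale_left)
qed

lemma L_op_L2: "L_dom eqn \<Omega> bc \<alpha> \<beta> v \<Longrightarrow> L2_fun \<Omega> (L_op eqn \<Omega> bc \<alpha> \<beta> v)"
  using L2_mult_const[OF Ds_op_L2, of v "- 1"]
  by (cases eqn) (auto simp: L_op_def L_dom_def lap_L2)

lemma N_op_L2: "N_dom eqn \<Omega> bc f \<alpha> \<beta> v \<Longrightarrow> L2_fun \<Omega> (N_op eqn \<Omega> bc f \<alpha> \<beta> v)"
  using fs_op_L2[of eqn f \<alpha> \<beta> v] L2_mult_const[OF lap_L2, of "fs_op \<Omega> bc f \<alpha> \<beta> v" "- 1"]
  by (cases eqn) (auto simp: N_op_def N_dom_def)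

text \<open>Testing the difference of two stage equations with an eigenfunction gives the scalar stages.
  The eigenvalue relation enters for
  the functions to which the Laplacian is applied: the stage errors and, for Cahn--Hilliard, the
  arguments of \<open>G\<close>.\<close>

lemma modal_stages_of_difference:
  assumes f: "L-lipschitz_on UNIV f"
    and v: "imex_stages eqn \<Omega> bc f \<alpha> \<beta> A Ah \<tau> w0 v" and w: "imex_stages eqn \<Omega> bc f \<alpha> \<beta> A Ah \<tau> w1 w"
    and \<psi>: "H1_fun \<Omega> bc \<psi>"
    and e: "\<And>i. i \<le> dim_row A \<Longrightarrow> gip (\<lambda>x. v i x - w i x) \<psi> = \<mu> * ip (\<lambda>x. v i x - w i x) \<psi>"
    and eD: "\<And>j. eqn = CahnHilliard \<Longrightarrow> j \<in> {1..dim_row A} \<Longrightarrow>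
      gip (\<lambda>x. Ds_op \<Omega> bc \<alpha> \<beta> (v j) x - Ds_op \<Omega> bc \<alpha> \<beta> (w j) x) \<psi>
        = \<mu> * ip (\<lambda>x. Ds_op \<Omega> bc \<alpha> \<beta> (v j) x - Ds_op \<Omega> bc \<alpha> \<beta> (w j) x) \<psi>"
    and ef: "\<And>j. eqn = CahnHilliard \<Longrightarrow> j \<in> {1..dim_row A} \<Longrightarrow>
      gip (\<lambda>x. fs_op \<Omega> bc f \<alpha> \<beta> (v (j - 1)) x - fs_op \<Omega> bc f \<alpha> \<beta> (w (j - 1)) x) \<psi>
        = \<mu> * ip (\<lambda>x. fs_op \<Omega> bc f \<alpha> \<beta> (v (j - 1)) x - fs_op \<Omega> bc f \<alpha> \<beta> (w (j - 1)) x) \<psi>"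
  shows "modal_stages A Ah \<alpha> \<beta> \<tau> (if eqn = AllenCahn then 1 else \<mu>) \<mu>
    (\<lambda>j. ip (\<lambda>x. f (v (j - 1) x) - f (w (j - 1) x)) \<psi>) (\<lambda>i. ip (\<lambda>x. v i x - w i x) \<psi>)"
  unfolding modal_stages_def
proof
  define \<gamma> where "\<gamma> = (if eqn = AllenCahn then 1 else \<mu>)"
  let ?e = "\<lambda>i. ip (\<lambda>x. v i x - w i x) \<psi>"
  let ?g = "\<lambda>j. ip (\<lambda>x. f (v (j - 1) x) - f (w (j - 1) x)) \<psi>"
  have \<psi>2: "L2_fun \<Omega> \<psi>" by (rule H1_L2[OF \<psi>])
  have Ld: "L_dom eqn \<Omega> bc \<alpha> \<beta> (v j)" "L_dom eqn \<Omega> bc \<alpha> \<beta> (w j)" 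
    and Nd: "N_dom eqn \<Omega> bc f \<alpha> \<beta> (v (j - 1))" "N_dom eqn \<Omega> bc f \<alpha> \<beta> (w (j - 1))"
    if "j \<in> {1..dim_row A}" for j
    using v w that by (auto simp: imex_stages_def)
  have lin: "ip (L_op eqn \<Omega> bc \<alpha> \<beta> (v j)) \<psi> - ip (L_op eqn \<Omega> bc \<alpha> \<beta> (w j)) \<psi>
      = - (\<gamma> * (((1 + \<alpha>) * \<mu> + \<beta>) * ?e j))" if j: "j \<in> {1..dim_row A}" for j
  proof -
    have dom: "lap_dom \<Omega> bc (v j)" "lap_dom \<Omega> bc (w j)" using Ld[OF j] by (auto simp: L_dom_def)
    have D2: "L2_fun \<Omega> (Ds_op \<Omega> bc \<alpha> \<beta> (v j))" "L2_fun \<Omega> (Ds_op \<Omega> bc \<alpha> \<beta> (w j))"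
      using dom by (auto intro: Ds_op_L2)
    have d: "ip (Ds_op \<Omega> bc \<alpha> \<beta> (v j)) \<psi> - ip (Ds_op \<Omega> bc \<alpha> \<beta> (w j)) \<psi> = ((1 + \<alpha>) * \<mu> + \<beta>) * ?e j"
    proof -
      have "ip (Ds_op \<Omega> bc \<alpha> \<beta> (v j)) \<psi> - ip (Ds_op \<Omega> bc \<alpha> \<beta> (w j)) \<psi>
          = (1 + \<alpha>) * (gip (v j) \<psi> - gip (w j) \<psi>) + \<beta> * (ip (v j) \<psi> - ip (w j) \<psi>)"
        by (simp add: ip_Ds dom \<psi> algebra_simps)
      also have "gip (v j) \<psi> - gip (w j) \<psi> = \<mu> * ?e j"
        using e[of j] j gip_diff_left[OF lap_dom_H1[OF dom(1)] lap_dom_H1[OF dom(2)] \<psi>] by simp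
      also have "ip (v j) \<psi> - ip (w j) \<psi> = ?e j"
        by (rule ip_diff_left[symmetric]) (intro lap_dom_L2 dom \<psi>2)+
      finally show ?thesis by (simp add: algebra_simps)
    qed
    show ?thesis
    proof (cases eqn)
      case AllenCahn
      then show ?thesis using d by (simp add: L_op_def \<gamma>_def ip_minus_left)
    next
      case CahnHilliard
      then have dom': "lap_dom \<Omega> bc (Ds_op \<Omega> bc \<alpha> \<beta> (v j))" "lap_dom \<Omega> bc (Ds_op \<Omega> bc \<alpha> \<beta> (w j))"
        using Ld[OF j] by (auto simp: L_dom_def)
      have "ip (L_op eqn \<Omega> bc \<alpha> \<beta> (v j)) \<psi> - ip (L_op eqn \<Omega> bc \<alpha> \<beta> (w j)) \<psi>
          = - (gip (Ds_op \<Omega> bc \<alpha> \<beta> (v j)) \<psi> - gip (Ds_op \<Omega> bc \<alpha> \<beta> (w j)) \<psi>)"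
        using CahnHilliard by (simp add: L_op_def ip_lap dom' \<psi>)
      also have "\<dots> = - (\<mu> * (ip (Ds_op \<Omega> bc \<alpha> \<beta> (v j)) \<psi> - ip (Ds_op \<Omega> bc \<alpha> \<beta> (w j)) \<psi>))"
        using eD[OF CahnHilliard j] gip_diff_left[OF lap_dom_H1[OF dom'(1)] lap_dom_H1[OF dom'(2)] \<psi>]
          ip_diff_left[OF D2 \<psi>2] by simp
      finally show ?thesis using CahnHilliard d by (simp add: \<gamma>_def)
    qed
  qed
  have nonlin: "ip (N_op eqn \<Omega> bc f \<alpha> \<beta> (v (j - 1))) \<psi> - ip (N_op eqn \<Omega> bc f \<alpha> \<beta> (w (j - 1))) \<psi>
      = - (\<gamma> * (?g j - (\<alpha> * \<mu> + \<beta>) * ?e (j - 1)))" if j: "j \<in> {1..dim_row A}" for j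
  proof -
    have dom: "lap_dom \<Omega> bc (v (j - 1))" "lap_dom \<Omega> bc (w (j - 1))" using Nd[OF j] by (auto simp: N_dom_def)
    have f2: "L2_fun \<Omega> (fs_op \<Omega> bc f \<alpha> \<beta> (v (j - 1)))" "L2_fun \<Omega> (fs_op \<Omega> bc f \<alpha> \<beta> (w (j - 1)))"
      using Nd[OF j] by (auto intro: fs_op_L2)
    have d: "ip (fs_op \<Omega> bc f \<alpha> \<beta> (v (j - 1))) \<psi> - ip (fs_op \<Omega> bc f \<alpha> \<beta> (w (j - 1))) \<psi>
        = - (?g j - (\<alpha> * \<mu> + \<beta>) * ?e (j - 1))"
    proof -
      have "gip (\<lambda>x. v (j - 1) x - w (j - 1) x) \<psi> = \<mu> * ?e (j - 1)"
        using j by (intro e) auto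
      then show ?thesis
        using ip_fs_difference[OF f dom \<psi>, of \<alpha> \<beta>] ip_diff_left[OF f2 \<psi>2]
        by (simp add: algebra_simps)
    qed
    show ?thesis
    proof (cases eqn)
      case AllenCahn
      then show ?thesis using d by (simp add: N_op_def \<gamma>_def ip_minus_left)
    next
      case CahnHilliard
      then have dom': "lap_dom \<Omega> bc (fs_op \<Omega> bc f \<alpha> \<beta> (v (j - 1)))" "lap_dom \<Omega> bc (fs_op \<Omega> bc f \<alpha> \<beta> (w (j - 1)))"
        using Nd[OF j] by (auto simp: N_dom_def)
      have "ip (N_op eqn \<Omega> bc f \<alpha> \<beta> (v (j - 1))) \<psi> - ip (N_op eqn \<Omega> bc f \<alpha> \<beta> (w (j - 1))) \<psi>
          = gip (fs_op \<Omega> bc f \<alpha> \<beta> (v (j - 1))) \<psi> - gip (fs_op \<Omega> bc f \<alpha> \<beta> (w (j - 1))) \<psi>"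
        unfolding N_op_def CahnHilliard G_op.simps ip_minus_left ip_lap[OF dom'(1) \<psi>] ip_lap[OF dom'(2) \<psi>]
        by simp
      also have "\<dots> = \<mu> * (ip (fs_op \<Omega> bc f \<alpha> \<beta> (v (j - 1))) \<psi> - ip (fs_op \<Omega> bc f \<alpha> \<beta> (w (j - 1))) \<psi>)"
        using ef[OF CahnHilliard j] gip_diff_left[OF lap_dom_H1[OF dom'(1)] lap_dom_H1[OF dom'(2)] \<psi>]
          ip_diff_left[OF f2 \<psi>2] by simp
      finally show ?thesis unfolding d using CahnHilliard by (simp add: \<gamma>_def algebra_simps)
    qed
  qed
  fix i assume i: "i \<in> {1..dim_row A}"
  have sub: "j \<in> {1..i} \<Longrightarrow> j \<in> {1..dim_row A}" for j using i by auto
  have stage: "ip (u i) \<psi> = ip (u 0) \<psi> + \<tau> *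
      ((\<Sum>j=1..i. A $$ (i - 1, j - 1) * ip (L_op eqn \<Omega> bc \<alpha> \<beta> (u j)) \<psi>) +
       (\<Sum>j=1..i. Ah $$ (i - 1, j - 1) * ip (N_op eqn \<Omega> bc f \<alpha> \<beta> (u (j - 1))) \<psi>))"
    and u2: "L2_fun \<Omega> (u i)" "L2_fun \<Omega> (u 0)"
    if u: "imex_stages eqn \<Omega> bc f \<alpha> \<beta> A Ah \<tau> u0 u" for u u0
  proof -
    have Lu: "L2_fun \<Omega> (L_op eqn \<Omega> bc \<alpha> \<beta> (u j))" and Nu: "L2_fun \<Omega> (N_op eqn \<Omega> bc f \<alpha> \<beta> (u (j - 1)))"
      if "j \<in> {1..i}" for j
      using u sub[OF that] by (auto simp: imex_stages_def intro: L_op_L2 N_op_L2)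
    have "L_dom eqn \<Omega> bc \<alpha> \<beta> (u i)" using u i by (auto simp: imex_stages_def)
    then show ui: "L2_fun \<Omega> (u i)" by (auto simp: L_dom_def intro: lap_dom_L2)
    have "N_dom eqn \<Omega> bc f \<alpha> \<beta> (u (1 - 1))"
      using u i unfolding imex_stages_def by (metis atLeastAtMost_iff order_refl order_trans)
    then show u0: "L2_fun \<Omega> (u 0)" by (auto simp: N_dom_def intro: lap_dom_L2)
    let ?S1 = "\<lambda>x. \<Sum>j=1..i. A $$ (i - 1, j - 1) * L_op eqn \<Omega> bc \<alpha> \<beta> (u j) x"
    let ?S2 = "\<lambda>x. \<Sum>j=1..i. Ah $$ (i - 1, j - 1) * N_op eqn \<Omega> bc f \<alpha> \<beta> (u (j - 1)) x"
    have S: "L2_fun \<Omega> ?S1" "L2_fun \<Omega> ?S2" by (intro L2_sum L2_mult_const Lu Nu; simp)+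
    have AE: "AE x in M. u i x = u 0 x + \<tau> * (?S1 x + ?S2 x)" using u i by (auto simp: imex_stages_def)
    have "ip (u i) \<psi> = ip (\<lambda>x. u 0 x + \<tau> * (?S1 x + ?S2 x)) \<psi>"
      by (rule L2_cong_AE_left[OF AE ui _ \<psi>2]) (intro L2_add L2_mult_const u0 S)
    also have "\<dots> = ip (u 0) \<psi> + ip (\<lambda>x. \<tau> * (?S1 x + ?S2 x)) \<psi>"
      by (intro ip_add_left L2_add L2_mult_const u0 S \<psi>2)
    also have "ip (\<lambda>x. \<tau> * (?S1 x + ?S2 x)) \<psi> = \<tau> * (ip ?S1 \<psi> + ip ?S2 \<psi>)"
      unfolding ip_scale_left ip_add_left[OF S \<psi>2] ..
    also have "ip ?S1 \<psi> = (\<Sum>j=1..i. A $$ (i - 1, j - 1) * ip (L_op eqn \<Omega> bc \<alpha> \<beta> (u j)) \<psi>)"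
      by (intro ip_sum_left Lu \<psi>2) auto
    also have "ip ?S2 \<psi> = (\<Sum>j=1..i. Ah $$ (i - 1, j - 1) * ip (N_op eqn \<Omega> bc f \<alpha> \<beta> (u (j - 1))) \<psi>)"
      by (intro ip_sum_left Nu \<psi>2) auto
    finally show "ip (u i) \<psi> = ip (u 0) \<psi> + \<tau> *
      ((\<Sum>j=1..i. A $$ (i - 1, j - 1) * ip (L_op eqn \<Omega> bc \<alpha> \<beta> (u j)) \<psi>) +
       (\<Sum>j=1..i. Ah $$ (i - 1, j - 1) * ip (N_op eqn \<Omega> bc f \<alpha> \<beta> (u (j - 1))) \<psi>))" .
  qed
  have "?e i = ip (v i) \<psi> - ip (w i) \<psi>" "?e 0 = ip (v 0) \<psi> - ip (w 0) \<psi>"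
    using u2[OF v] u2[OF w] \<psi>2 by (simp_all add: ip_diff_left)
  then have "?e i = ?e 0 + \<tau> *
      ((\<Sum>j=1..i. A $$ (i - 1, j - 1) * (ip (L_op eqn \<Omega> bc \<alpha> \<beta> (v j)) \<psi> - ip (L_op eqn \<Omega> bc \<alpha> \<beta> (w j)) \<psi>)) +
       (\<Sum>j=1..i. Ah $$ (i - 1, j - 1) * (ip (N_op eqn \<Omega> bc f \<alpha> \<beta> (v (j - 1))) \<psi> - ip (N_op eqn \<Omega> bc f \<alpha> \<beta> (w (j - 1))) \<psi>)))"
    unfolding stage[OF v] stage[OF w] right_diff_distrib[of "A $$ _"] right_diff_distrib[of "Ah $$ _"] sum_subtractf
    by (simp add: algebra_simps)
  also have "(\<Sum>j=1..i. A $$ (i - 1, j - 1) * (ip (L_op eqn \<Omega> bc \<alpha> \<beta> (v j)) \<psi> - ip (L_op eqn \<Omega> bc \<alpha> \<beta> (w j)) \<psi>))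
      = (\<Sum>j=1..i. - \<gamma> * (A $$ (i - 1, j - 1) * (((1 + \<alpha>) * \<mu> + \<beta>) * ?e j)))"
  proof (intro sum.cong refl)
    fix j assume j: "j \<in> {1..i}"
    show "A $$ (i - 1, j - 1) * (ip (L_op eqn \<Omega> bc \<alpha> \<beta> (v j)) \<psi> - ip (L_op eqn \<Omega> bc \<alpha> \<beta> (w j)) \<psi>)
        = - \<gamma> * (A $$ (i - 1, j - 1) * (((1 + \<alpha>) * \<mu> + \<beta>) * ?e j))"
      unfolding lin[OF sub[OF j]] by simp
  qed
  also have "(\<Sum>j=1..i. Ah $$ (i - 1, j - 1) * (ip (N_op eqn \<Omega> bc f \<alpha> \<beta> (v (j - 1))) \<psi> - ip (N_op eqn \<Omega> bc f \<alpha> \<beta> (w (j - 1))) \<psi>))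
      = (\<Sum>j=1..i. - \<gamma> * (Ah $$ (i - 1, j - 1) * (?g j - (\<alpha> * \<mu> + \<beta>) * ?e (j - 1))))"
  proof (intro sum.cong refl)
    fix j assume j: "j \<in> {1..i}"
    show "Ah $$ (i - 1, j - 1) * (ip (N_op eqn \<Omega> bc f \<alpha> \<beta> (v (j - 1))) \<psi> - ip (N_op eqn \<Omega> bc f \<alpha> \<beta> (w (j - 1))) \<psi>)
        = - \<gamma> * (Ah $$ (i - 1, j - 1) * (?g j - (\<alpha> * \<mu> + \<beta>) * ?e (j - 1)))"
      unfolding nonlin[OF sub[OF j]] by simp
  qed
  also have "?e 0 + \<tau> * ((\<Sum>j=1..i. - \<gamma> * (A $$ (i - 1, j - 1) * (((1 + \<alpha>) * \<mu> + \<beta>) * ?e j)))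
      + (\<Sum>j=1..i. - \<gamma> * (Ah $$ (i - 1, j - 1) * (?g j - (\<alpha> * \<mu> + \<beta>) * ?e (j - 1)))))
    = ?e 0 - \<tau> * \<gamma> * ((\<Sum>j=1..i. A $$ (i - 1, j - 1) * (((1 + \<alpha>) * \<mu> + \<beta>) * ?e j))
      + (\<Sum>j=1..i. Ah $$ (i - 1, j - 1) * (?g j - (\<alpha> * \<mu> + \<beta>) * ?e (j - 1))))"
  proof -
    have "c + \<tau> * (- \<gamma> * X + - \<gamma> * Y) = c - \<tau> * \<gamma> * (X + Y)" for c X Y :: real
      by (simp add: algebra_simps)
    then show ?thesis by (simp only: sum_distrib_left[symmetric])
  qed
  finally have "?e i = ?e 0 - \<tau> * \<gamma> * ((\<Sum>j=1..i. A $$ (i - 1, j - 1) * (((1 + \<alpha>) * \<mu> + \<beta>) * ?e j))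
      + (\<Sum>j=1..i. Ah $$ (i - 1, j - 1) * (?g j - (\<alpha> * \<mu> + \<beta>) * ?e (j - 1))))" .
  then show "?e i = ?e 0 - \<tau> * (if eqn = AllenCahn then 1 else \<mu>) *
      ((\<Sum>j=1..i. A $$ (i - 1, j - 1) * (((1 + \<alpha>) * \<mu> + \<beta>) * ?e j))
      + (\<Sum>j=1..i. Ah $$ (i - 1, j - 1) * (?g j - (\<alpha> * \<mu> + \<beta>) * ?e (j - 1))))"
    by (simp only: \<gamma>_def)
qed

end

lemma (in pde_domain) stages_lap_dom:
  assumes v: "imex_stages eqn \<Omega> bc f \<alpha> \<beta> A Ah \<tau> w v" and s: "1 \<le> dim_row A" and i: "i \<le> dim_row A"
  shows "lap_dom \<Omega> bc (v i)"
proof (cases "i = 0")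
  case True
  have "N_dom eqn \<Omega> bc f \<alpha> \<beta> (v (1 - 1))"
    using v s unfolding imex_stages_def by (metis atLeastAtMost_iff order_refl)
  then show ?thesis using True by (simp add: N_dom_def)
next
  case False
  then have "L_dom eqn \<Omega> bc \<alpha> \<beta> (v i)" using v i by (auto simp: imex_stages_def)
  then show ?thesis by (simp add: L_dom_def)
qed

locale imex_error_setting = pde_domain \<Omega> bc + stable_imex A Ah s \<alpha> \<beta> L
  for \<Omega> :: "'a::euclidean_space set" and bc :: "'a boundary"
    and A Ah :: "real mat" and s :: nat and \<alpha> \<beta> L :: real
begin

lemma dim_A: "dim_row A = s"
  using A(1) by simp

text \<open>The functions on which the error equations of the first \<open>N\<close> steps evaluate the Dirichlet form make
  up one finite family. Its eigenbasis turns the equations into a scalar error run whose weighted sum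
  of squares is the squared \<open>H\<^sup>1\<close> error.\<close>

lemma error_run_of_solution:
  assumes f: "L-lipschitz_on UNIV f"
    and u: "\<And>n. n \<le> N \<Longrightarrow> lap_dom \<Omega> bc (u (real n * \<tau>))"
    and trunc: "\<And>n v. n < N \<Longrightarrow> imex_stages eqn \<Omega> bc f \<alpha> \<beta> A Ah \<tau> (u (real n * \<tau>)) v \<Longrightarrow>
        H1_norm \<Omega> bc (truncation_error eqn \<Omega> bc f \<alpha> \<beta> A Ah \<tau> u n v) \<le> R"
    and exact: "\<And>n. n < N \<Longrightarrow> \<exists>v. imex_stages eqn \<Omega> bc f \<alpha> \<beta> A Ah \<tau> (u (real n * \<tau>)) v"
    and U0: "U 0 = u 0"
    and numeric: "\<And>n. n < N \<Longrightarrow> \<exists>v. imex_stages eqn \<Omega> bc f \<alpha> \<beta> A Ah \<tau> (U n) v \<and> U (n + 1) = v (dim_row A)"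
  obtains D \<mu> x where "\<forall>r\<in>D. 0 \<le> \<mu> r"
    "modal_error_run A Ah \<alpha> \<beta> L N \<tau> R D (if eqn = AllenCahn then \<lambda>_. 1 else \<mu>) \<mu> x"
    "(H1_norm \<Omega> bc (\<lambda>y. u (real N * \<tau>) y - U N y))\<^sup>2 = (\<Sum>r\<in>D. (1 + \<mu> r) * (x N r)\<^sup>2)"
proof -
  obtain V where V: "\<And>n. n < N \<Longrightarrow> imex_stages eqn \<Omega> bc f \<alpha> \<beta> A Ah \<tau> (u (real n * \<tau>)) (V n)"
    using exact by metis
  obtain v where v: "\<And>n. n < N \<Longrightarrow> imex_stages eqn \<Omega> bc f \<alpha> \<beta> A Ah \<tau> (U n) (v n)"
    and U: "\<And>n. n < N \<Longrightarrow> U (Suc n) = v n s"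
    using numeric unfolding dim_A Suc_eq_plus1 by metis
  define x where "x n = (\<lambda>y. u (real n * \<tau>) y - U n y)" for n
  define e where "e n i = (\<lambda>y. V n i y - v n i y)" for n i
  define res where "res n = (\<lambda>y. x (Suc n) y - e n s y)" for n
  define dD where "dD n j = (\<lambda>y. Ds_op \<Omega> bc \<alpha> \<beta> (V n j) y - Ds_op \<Omega> bc \<alpha> \<beta> (v n j) y)" for n j
  define df where "df n j = (\<lambda>y. fs_op \<Omega> bc f \<alpha> \<beta> (V n (j - 1)) y - fs_op \<Omega> bc f \<alpha> \<beta> (v n (j - 1)) y)" for n j
  define g where "g n j = (\<lambda>y. f (V n (j - 1) y) - f (v n (j - 1) y))" for n j
  \<comment> \<open>For Cahn--Hilliard the outer operator \<open>G\<close> is the Laplacian, so the functions it is applied to have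
    to be in the family, too. For Allen--Cahn they need not be in \<open>H\<^sup>1\<close>.\<close>
  define S where "S = x ` {..N} \<union> (\<lambda>(n, i). e n i) ` ({..<N} \<times> {..s}) \<union> res ` {..<N} \<union>
    (if eqn = CahnHilliard then (\<lambda>(n, j). dD n j) ` ({..<N} \<times> {1..s}) \<union> (\<lambda>(n, j). df n j) ` ({..<N} \<times> {1..s}) else {})"
  have finS: "finite S" by (simp add: S_def)
  have inS: "n \<le> N \<Longrightarrow> x n \<in> S" "n < N \<Longrightarrow> i \<le> s \<Longrightarrow> e n i \<in> S" "n < N \<Longrightarrow> res n \<in> S"
    "eqn = CahnHilliard \<Longrightarrow> n < N \<Longrightarrow> j \<in> {1..s} \<Longrightarrow> dD n j \<in> S"
    "eqn = CahnHilliard \<Longrightarrow> n < N \<Longrightarrow> j \<in> {1..s} \<Longrightarrow> df n j \<in> S" for n i j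
    unfolding S_def by force+
  have dom: "lap_dom \<Omega> bc (V n i)" "lap_dom \<Omega> bc (v n i)" if "n < N" "i \<le> s" for n i
    using stages_lap_dom[OF V[OF that(1)]] stages_lap_dom[OF v[OF that(1)]] that(2) s_pos by (auto simp: dim_A)
  have domU: "lap_dom \<Omega> bc (U n)" if "n \<le> N" for n
    using that U dom(2) u[of 0] U0 by (cases n) auto
  have He: "H1_fun \<Omega> bc (e n i)" if "n < N" "i \<le> s" for n i
    unfolding e_def using dom[OF that] by (intro H1_diff lap_dom_H1)
  have Hx: "H1_fun \<Omega> bc (x n)" if "n \<le> N" for n
    unfolding x_def using u domU that by (intro H1_diff lap_dom_H1)
  have Hres: "H1_fun \<Omega> bc (res n)" if "n < N" for n
    unfolding res_def using that by (intro H1_diff Hx He) auto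
  have Ld: "L_dom eqn \<Omega> bc \<alpha> \<beta> (V n j)" "L_dom eqn \<Omega> bc \<alpha> \<beta> (v n j)"
    and Nd: "N_dom eqn \<Omega> bc f \<alpha> \<beta> (V n (j - 1))" "N_dom eqn \<Omega> bc f \<alpha> \<beta> (v n (j - 1))"
    if "n < N" "j \<in> {1..s}" for n j
    using V[OF that(1)] v[OF that(1)] that(2) unfolding imex_stages_def dim_A by auto
  have HD: "H1_fun \<Omega> bc (dD n j)" "H1_fun \<Omega> bc (df n j)" if "eqn = CahnHilliard" "n < N" "j \<in> {1..s}" for n j
  proof -
    have l: "lap_dom \<Omega> bc (Ds_op \<Omega> bc \<alpha> \<beta> (V n j))" "lap_dom \<Omega> bc (Ds_op \<Omega> bc \<alpha> \<beta> (v n j))"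
      "lap_dom \<Omega> bc (fs_op \<Omega> bc f \<alpha> \<beta> (V n (j - 1)))" "lap_dom \<Omega> bc (fs_op \<Omega> bc f \<alpha> \<beta> (v n (j - 1)))"
      using Ld[OF that(2,3)] Nd[OF that(2,3)] that(1) by (auto simp: L_dom_def N_dom_def)
    show "H1_fun \<Omega> bc (dD n j)" unfolding dD_def by (intro H1_diff lap_dom_H1 l)
    show "H1_fun \<Omega> bc (df n j)" unfolding df_def by (intro H1_diff lap_dom_H1 l)
  qed
  have HS: "H1_fun \<Omega> bc b" if "b \<in> S" for b
    using that Hx He Hres HD unfolding S_def by (auto split: if_splits)
  obtain D :: "nat set" and \<psi> \<mu> where D: "finite D" and H\<psi>: "\<And>r. r \<in> D \<Longrightarrow> H1_fun \<Omega> bc (\<psi> r)"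
    and \<mu>: "\<And>r. r \<in> D \<Longrightarrow> 0 \<le> \<mu> r"
    and ortho: "\<And>r t. r \<in> D \<Longrightarrow> t \<in> D \<Longrightarrow> ip (\<psi> r) (\<psi> t) = (if r = t then 1 else 0)"
    and eig: "\<And>b r. b \<in> S \<Longrightarrow> r \<in> D \<Longrightarrow> gip b (\<psi> r) = \<mu> r * ip b (\<psi> r)"
    and mass: "\<And>b. b \<in> S \<Longrightarrow> ip b b = (\<Sum>r\<in>D. (ip b (\<psi> r))\<^sup>2)"
    and stiff: "\<And>b. b \<in> S \<Longrightarrow> gip b b = (\<Sum>r\<in>D. \<mu> r * (ip b (\<psi> r))\<^sup>2)"
    by (rule galerkin_eigenbasis[OF finS HS]) (assumption | blast)+
  have norm: "(H1_norm \<Omega> bc b)\<^sup>2 = (\<Sum>r\<in>D. (1 + \<mu> r) * (ip b (\<psi> r))\<^sup>2)" if "b \<in> S" for b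
    using ip_self_nonneg[of b] gip_self_nonneg[of b] mass[OF that] stiff[OF that]
    by (simp add: H1_norm_eq distrib_right sum.distrib)
  have residual: "(H1_norm \<Omega> bc (res n))\<^sup>2 \<le> R\<^sup>2" if n: "n < N" for n
  proof -
    have res_eq: "res n = (\<lambda>y. u (real (n + 1) * \<tau>) y - V n s y)"
      using U[OF n] by (auto simp: res_def x_def e_def)
    have "AE y in M. V n s y = V n 0 y + \<tau> *
           ((\<Sum>j=1..s. A $$ (s - 1, j - 1) * L_op eqn \<Omega> bc \<alpha> \<beta> (V n j) y) +
            (\<Sum>j=1..s. Ah $$ (s - 1, j - 1) * N_op eqn \<Omega> bc f \<alpha> \<beta> (V n (j - 1)) y))"
      using V[OF n] s_pos unfolding imex_stages_def dim_A by auto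
    then have "AE y in M. res n y = truncation_error eqn \<Omega> bc f \<alpha> \<beta> A Ah \<tau> u n (V n) y"
    proof eventually_elim
      case (elim y)
      have "V n 0 = u (real n * \<tau>)" using V[OF n] by (simp add: imex_stages_def)
      then show ?case using elim
        unfolding res_eq truncation_error_def dim_A Let_def by simp
    qed
    then have "H1_norm \<Omega> bc (truncation_error eqn \<Omega> bc f \<alpha> \<beta> A Ah \<tau> u n (V n)) = H1_norm \<Omega> bc (res n)"
      by (rule H1_norm_cong_AE[OF H1_L2[OF Hres[OF n]]])
    then have "H1_norm \<Omega> bc (res n) \<le> R" using trunc[OF n V[OF n]] by simp
    moreover have "0 \<le> H1_norm \<Omega> bc (res n)"
      using ip_self_nonneg gip_self_nonneg by (simp add: H1_norm_eq)
    ultimately show ?thesis by (rule power_mono)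
  qed
  have "modal_error_run A Ah \<alpha> \<beta> L N \<tau> R D (if eqn = AllenCahn then \<lambda>_. 1 else \<mu>) \<mu> (\<lambda>n r. ip (x n) (\<psi> r))"
    unfolding modal_error_run_def
  proof (intro conjI allI impI ballI D)
    show "ip (x 0) (\<psi> r) = 0" for r by (simp add: x_def U0 ip_def)
    fix n assume n: "n < N"
    have ev: "e n 0 = x n"
      using V[OF n] v[OF n] by (simp add: e_def x_def imex_stages_def)
    have "modal_stages A Ah \<alpha> \<beta> \<tau> ((if eqn = AllenCahn then \<lambda>_. 1 else \<mu>) r) (\<mu> r)
        (\<lambda>j. ip (g n j) (\<psi> r)) (\<lambda>i. ip (e n i) (\<psi> r))" if r: "r \<in> D" for r
    proof -
      have "modal_stages A Ah \<alpha> \<beta> \<tau> (if eqn = AllenCahn then 1 else \<mu> r) (\<mu> r)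
          (\<lambda>j. ip (g n j) (\<psi> r)) (\<lambda>i. ip (e n i) (\<psi> r))"
        unfolding g_def e_def
      proof (rule modal_stages_of_difference[OF f V[OF n] v[OF n] H\<psi>[OF r]], unfold dim_A)
        show "gip (\<lambda>y. V n i y - v n i y) (\<psi> r) = \<mu> r * ip (\<lambda>y. V n i y - v n i y) (\<psi> r)" if "i \<le> s" for i
          using eig[OF inS(2)[OF n that] r] by (simp add: e_def)
      next
        fix j assume c: "eqn = CahnHilliard" and j: "j \<in> {1..s}"
        show "gip (\<lambda>y. Ds_op \<Omega> bc \<alpha> \<beta> (V n j) y - Ds_op \<Omega> bc \<alpha> \<beta> (v n j) y) (\<psi> r)
            = \<mu> r * ip (\<lambda>y. Ds_op \<Omega> bc \<alpha> \<beta> (V n j) y - Ds_op \<Omega> bc \<alpha> \<beta> (v n j) y) (\<psi> r)"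
          using eig[OF inS(4)[OF c n j] r] by (simp add: dD_def)
        show "gip (\<lambda>y. fs_op \<Omega> bc f \<alpha> \<beta> (V n (j - 1)) y - fs_op \<Omega> bc f \<alpha> \<beta> (v n (j - 1)) y) (\<psi> r)
            = \<mu> r * ip (\<lambda>y. fs_op \<Omega> bc f \<alpha> \<beta> (V n (j - 1)) y - fs_op \<Omega> bc f \<alpha> \<beta> (v n (j - 1)) y) (\<psi> r)"
          using eig[OF inS(5)[OF c n j] r] by (simp add: df_def)
      qed
      then show ?thesis by (cases "eqn = AllenCahn") simp_all
    qed
    moreover have "(\<Sum>r\<in>D. (ip (g n j) (\<psi> r))\<^sup>2) \<le> L\<^sup>2 * (\<Sum>r\<in>D. (ip (e n (j - 1)) (\<psi> r))\<^sup>2)"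
      if j: "j \<in> {1..s}" for j
    proof -
      have V2: "L2_fun \<Omega> (V n (j - 1))" "L2_fun \<Omega> (v n (j - 1))" using dom[OF n, of "j - 1"] j by (auto intro: lap_dom_L2)
      have "(\<Sum>r\<in>D. (ip (g n j) (\<psi> r))\<^sup>2) \<le> ip (g n j) (g n j)"
        using lipschitz_difference(1)[OF f V2] H1_L2[OF H\<psi>] unfolding g_def
        by (intro bessel_inequality D ortho) auto
      also have "\<dots> \<le> L\<^sup>2 * ip (e n (j - 1)) (e n (j - 1))"
        unfolding g_def e_def by (rule lipschitz_difference(2)[OF f V2])
      also have "ip (e n (j - 1)) (e n (j - 1)) = (\<Sum>r\<in>D. (ip (e n (j - 1)) (\<psi> r))\<^sup>2)"
        using j n by (intro mass inS(2)) auto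
      finally show ?thesis .
    qed
    moreover have "(\<Sum>r\<in>D. (1 + \<mu> r) * (ip (x (Suc n)) (\<psi> r) - ip (e n s) (\<psi> r))\<^sup>2) \<le> R\<^sup>2"
    proof -
      have "ip (res n) (\<psi> r) = ip (x (Suc n)) (\<psi> r) - ip (e n s) (\<psi> r)" if "r \<in> D" for r
        unfolding res_def using n that by (intro ip_diff_left H1_L2 Hx He H\<psi>) auto
      then have "(\<Sum>r\<in>D. (1 + \<mu> r) * (ip (x (Suc n)) (\<psi> r) - ip (e n s) (\<psi> r))\<^sup>2) = (H1_norm \<Omega> bc (res n))\<^sup>2"
        unfolding norm[OF inS(3)[OF n]] by (intro sum.cong refl) simp
      then show ?thesis using residual[OF n] by simp
    qed
    ultimately show "\<exists>e' g'. (\<forall>r\<in>D. e' 0 r = ip (x n) (\<psi> r)) \<and>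
      (\<forall>r\<in>D. modal_stages A Ah \<alpha> \<beta> \<tau> ((if eqn = AllenCahn then \<lambda>_. 1 else \<mu>) r) (\<mu> r) (\<lambda>j. g' j r) (\<lambda>i. e' i r)) \<and>
      (\<forall>j\<in>{1..dim_row A}. (\<Sum>r\<in>D. (g' j r)\<^sup>2) \<le> L\<^sup>2 * (\<Sum>r\<in>D. (e' (j - 1) r)\<^sup>2)) \<and>
      (\<Sum>r\<in>D. (1 + \<mu> r) * (ip (x (Suc n)) (\<psi> r) - e' (dim_row A) r)\<^sup>2) \<le> R\<^sup>2"
      unfolding dim_A
      by (intro exI[of _ "\<lambda>i r. ip (e n i) (\<psi> r)"] exI[of _ "\<lambda>j r. ip (g n j) (\<psi> r)"]) (simp add: ev)
  qed
  moreover have "(H1_norm \<Omega> bc (\<lambda>y. u (real N * \<tau>) y - U N y))\<^sup>2 = (\<Sum>r\<in>D. (1 + \<mu> r) * (ip (x N) (\<psi> r))\<^sup>2)"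
    using norm[OF inS(1)[of N]] by (simp add: x_def)
  ultimately show thesis using that[of D \<mu> "\<lambda>n r. ip (x n) (\<psi> r)"] \<mu> by blast
qed

end

section \<open>The error estimate\<close>

theorem theorem4p1:
  fixes \<Omega> :: "'a::euclidean_space set" and bc :: "'a boundary" and eqn :: equation
    and A Ah :: "real mat" and s p :: nat and \<alpha> \<beta> L :: real
  assumes dim: "DIM('a) \<in> {1, 2, 3}"
    and domain: "admissible_domain \<Omega> bc"
    and L_pos: "0 < L"
    and s_pos: "1 \<le> s"
    and A: "A \<in> carrier_mat s s" "lower_triangular A"
    and Ah: "Ah \<in> carrier_mat s s" "lower_triangular Ah" "invertible_mat Ah"
    and row_sums: "\<forall>i<s. (\<Sum>j<s. A $$ (i, j)) = (\<Sum>j<s. Ah $$ (i, j))"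
    and pd: "pos_def (H0_mat Ah)" "pos_def (H1_mat L \<beta> A Ah)" "pos_def (H2_mat \<alpha> A Ah)"
      "pos_def (Q_mat A Ah)"
    and beta: "\<beta> \<ge> L / (2 * lambda_min (Q_mat A Ah))"
    and alpha: "\<alpha> \<ge> - (lambda_min (H2_base_mat A Ah) / lambda_min (Q_mat A Ah))"
  shows "\<exists>m. \<forall>B K. \<exists>C>0. \<forall>T>0. \<forall>F f u.
    (\<forall>z. (F has_real_derivative f z) (at z)) \<and> L-lipschitz_on UNIV f \<and>
    exact_solution eqn \<Omega> bc f T u \<and>
    Ck_bounded_on m B ({0..T} \<times> \<Omega>) (\<lambda>(t, x). u t x) \<and>
    truncation_order eqn \<Omega> bc f \<alpha> \<beta> A Ah T u p K \<longrightarrow>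
    (\<forall>\<tau>>0. \<forall>U.
       truncation_stages_exist eqn \<Omega> bc f \<alpha> \<beta> A Ah \<tau> T u \<and>
       imex_solution eqn \<Omega> bc f \<alpha> \<beta> A Ah \<tau> T (u 0) U \<longrightarrow>
       (\<forall>n. real n * \<tau> \<le> T \<longrightarrow>
          H1_norm \<Omega> bc (\<lambda>x. u (real n * \<tau>) x - U n x) \<le> C * exp (C * T) * \<tau> ^ p))"
proof -
  interpret imex_error_setting \<Omega> bc A Ah s \<alpha> \<beta> L
    by unfold_locales (use assms in auto)
  obtain C where C: "C > 0" and bound: "\<And>N \<tau> \<rho> T D \<mu> x. 0 < \<tau> \<Longrightarrow> real N * \<tau> \<le> T \<Longrightarrow> (\<forall>r\<in>D. 0 \<le> \<mu> r) \<Longrightarrow>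
    modal_error_run A Ah \<alpha> \<beta> L N \<tau> (\<tau> * \<rho>) D (if eqn = AllenCahn then \<lambda>_. 1 else \<mu>) \<mu> x \<Longrightarrow>
    (\<Sum>r\<in>D. (1 + \<mu> r) * (x N r)\<^sup>2) \<le> C * exp (C * T) * \<rho>\<^sup>2"
    using modal_error_bound[of eqn] by blast
  \<comment> \<open>The modal bound is quadratic in the error; enlarging the constants absorbs the square root.\<close>
  have main: "H1_norm \<Omega> bc (\<lambda>x. u (real n * \<tau>) x - U n x)
      \<le> ((C + 1) * (\<bar>K\<bar> + 1)) * exp ((C + 1) * (\<bar>K\<bar> + 1) * T) * \<tau> ^ p"
    if T: "0 < T" and f: "L-lipschitz_on UNIV f" and ex: "exact_solution eqn \<Omega> bc f T u"
      and ord: "truncation_order eqn \<Omega> bc f \<alpha> \<beta> A Ah T u p K" and \<tau>: "0 < \<tau>"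
      and st: "truncation_stages_exist eqn \<Omega> bc f \<alpha> \<beta> A Ah \<tau> T u"
      and num: "imex_solution eqn \<Omega> bc f \<alpha> \<beta> A Ah \<tau> T (u 0) U" and n: "real n * \<tau> \<le> T"
    for K T f u \<tau> U n
  proof -
    have time: "real m * \<tau> \<le> T" if "m \<le> n" for m
    proof -
      have "real m * \<tau> \<le> real n * \<tau>" using that \<tau> by (intro mult_right_mono) auto
      then show ?thesis using n by simp
    qed
    have time': "real (m + 1) * \<tau> \<le> T" if "m < n" for m using that time[of "m + 1"] by simp
    obtain D \<mu> x where D: "\<forall>r\<in>D. 0 \<le> \<mu> r"
      and run: "modal_error_run A Ah \<alpha> \<beta> L n \<tau> (\<tau> * (\<bar>K\<bar> * \<tau> ^ p)) D (if eqn = AllenCahn then \<lambda>_. 1 else \<mu>) \<mu> x"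
      and norm: "(H1_norm \<Omega> bc (\<lambda>y. u (real n * \<tau>) y - U n y))\<^sup>2 = (\<Sum>r\<in>D. (1 + \<mu> r) * (x n r)\<^sup>2)"
    proof (rule error_run_of_solution[where N = n and u = u and U = U and \<tau> = \<tau> and eqn = eqn and f = f
          and R = "\<tau> * (\<bar>K\<bar> * \<tau> ^ p)", OF f])
      show "lap_dom \<Omega> bc (u (real m * \<tau>))" if "m \<le> n" for m
        using ex time[OF that] \<tau> by (auto simp: exact_solution_def)
      show "H1_norm \<Omega> bc (truncation_error eqn \<Omega> bc f \<alpha> \<beta> A Ah \<tau> u m v) \<le> \<tau> * (\<bar>K\<bar> * \<tau> ^ p)"
        if m: "m < n" and v: "imex_stages eqn \<Omega> bc f \<alpha> \<beta> A Ah \<tau> (u (real m * \<tau>)) v" for m v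
      proof -
        have "H1_norm \<Omega> bc (truncation_error eqn \<Omega> bc f \<alpha> \<beta> A Ah \<tau> u m v) \<le> K * \<tau> ^ (p + 1)"
          using ord \<tau> time'[OF m] v unfolding truncation_order_def by blast
        also have "\<dots> \<le> \<bar>K\<bar> * \<tau> ^ (p + 1)" using \<tau> by (intro mult_right_mono) auto
        finally show ?thesis by (simp add: mult_ac)
      qed
      show "\<exists>v. imex_stages eqn \<Omega> bc f \<alpha> \<beta> A Ah \<tau> (u (real m * \<tau>)) v" if "m < n" for m
        using st time'[OF that] unfolding truncation_stages_exist_def by blast
      show "U 0 = u 0" using num by (simp add: imex_solution_def)
      show "\<exists>v. imex_stages eqn \<Omega> bc f \<alpha> \<beta> A Ah \<tau> (U m) v \<and> U (m + 1) = v (dim_row A)" if "m < n" for m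
        using num time'[OF that] unfolding imex_solution_def by blast
    qed
    have "(H1_norm \<Omega> bc (\<lambda>y. u (real n * \<tau>) y - U n y))\<^sup>2 \<le> C * exp (C * T) * (\<bar>K\<bar> * \<tau> ^ p)\<^sup>2"
      unfolding norm by (rule bound[OF \<tau> n D run])
    also have "\<dots> \<le> ((C + 1) * exp ((C + 1) * T))\<^sup>2 * ((\<bar>K\<bar> + 1) * \<tau> ^ p)\<^sup>2"
    proof (intro mult_mono power_mono)
      have "1 \<le> (C + 1) * exp ((C + 1) * T)"
        using C T by (smt (verit) mult_le_cancel_left1 mult_nonneg_nonneg one_le_exp_iff)
      then have "(C + 1) * exp ((C + 1) * T) \<le> ((C + 1) * exp ((C + 1) * T))\<^sup>2"
        by (rule self_le_power) simp
      moreover have "C * exp (C * T) \<le> (C + 1) * exp ((C + 1) * T)"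
        using C T by (intro mult_mono) auto
      ultimately show "C * exp (C * T) \<le> ((C + 1) * exp ((C + 1) * T))\<^sup>2" by linarith
    qed (use \<tau> in auto)
    also have "\<dots> = ((C + 1) * exp ((C + 1) * T) * ((\<bar>K\<bar> + 1) * \<tau> ^ p))\<^sup>2"
      by (simp add: power_mult_distrib)
    finally have "H1_norm \<Omega> bc (\<lambda>y. u (real n * \<tau>) y - U n y)
        \<le> (C + 1) * exp ((C + 1) * T) * ((\<bar>K\<bar> + 1) * \<tau> ^ p)"
      by (rule power2_le_imp_le) (use C \<tau> in auto)
    also have "\<dots> \<le> (C + 1) * exp ((C + 1) * (\<bar>K\<bar> + 1) * T) * ((\<bar>K\<bar> + 1) * \<tau> ^ p)"
    proof -
      have "(C + 1) * 1 * T \<le> (C + 1) * (\<bar>K\<bar> + 1) * T"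
        using C T by (intro mult_right_mono mult_left_mono) auto
      then show ?thesis using C \<tau> by (intro mult_right_mono mult_left_mono) auto
    qed
    finally show ?thesis by (simp add: mult_ac)
  qed
  show ?thesis
  proof (rule exI[of _ 0], intro allI)
    fix B K :: real
    have "0 < (C + 1) * (\<bar>K\<bar> + 1)" using C by (intro mult_pos_pos) auto
    then show "\<exists>C>0. \<forall>T>0. \<forall>F f u.
      (\<forall>z. (F has_real_derivative f z) (at z)) \<and> L-lipschitz_on UNIV f \<and>
      exact_solution eqn \<Omega> bc f T u \<and>
      Ck_bounded_on 0 B ({0..T} \<times> \<Omega>) (\<lambda>(t, x). u t x) \<and>
      truncation_order eqn \<Omega> bc f \<alpha> \<beta> A Ah T u p K \<longrightarrow>
      (\<forall>\<tau>>0. \<forall>U.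
         truncation_stages_exist eqn \<Omega> bc f \<alpha> \<beta> A Ah \<tau> T u \<and>
         imex_solution eqn \<Omega> bc f \<alpha> \<beta> A Ah \<tau> T (u 0) U \<longrightarrow>
         (\<forall>n. real n * \<tau> \<le> T \<longrightarrow>
            H1_norm \<Omega> bc (\<lambda>x. u (real n * \<tau>) x - U n x) \<le> C * exp (C * T) * \<tau> ^ p))"
      using main by blast
  qed
qed

end
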